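(* Suppose that $f$ is continuous, and that $\rho\in C^2(\mathbb{R})$ with $\rho$, $\rho'$ and $\rho''$ bounded. Suppose that either $\omega(x)=\mathbf{1}_{x\leq 0}$, or $\omega\in C^3(\mathbb{R})$ is non-increasing and $\{x:\omega(x)\in (0,1)\}$ is bounded. Let $(u,b)$ be the unique weak solution of the free boundary problem $$\begin{cases} u_t(x,t)=\frac12 u_{xx}(x,t)+f(t)u(x,t)-\Lambda\,\omega(x-b(t))\,u(x,t) & x\in\mathbb{R},\ t>0,\\ \int_{\mathbb{R}}u(y,t)\,dy=1 & t>0,\\ u(x,0)=\rho(x) & x\in\mathbb{R},\end{cases}$$ and let $\tau$ be the stopping time $$\tau:=\inf\left\{t:\Lambda\int_0^t \omega(W_s-b(s))\,ds\geq U\right\},$$ where $U\sim \mathrm{Exp}(1)$ and $W$ is a Brownian motion, independent of $U$, with $W_0\sim\rho$. Then $b$ is the unique barrier such that $\mathbb{P}(\tau>y)=\exp\left(-\int_0^y f(s)\,ds\right)$ for all $y\ge0$. That is, $b$ solves the soft-killed inverse first passage problem with initial distribution $\rho$ and target distribution $p$ given by $p([t,\infty])=\exp(-\int_0^tf(s)ds)$.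
   Context: Standing assumptions and notation. $\omega:\mathbb{R}\to[0,1]$ is a selection weighting, i.e. monotone non-increasing with $\omega(x)\to1$ as $x\to-\infty$ and $\omega(x)\to 0$ as $x\to\infty$. The branching rate $f:[0,\infty)\to[0,\infty)$ is bounded, and $\Lambda\in(0,\infty)$ satisfies $\Lambda>\|f\|_\infty$. $\rho$ is (the density of) a probability measure on $\mathbb{R}$ absolutely continuous with respect to Lebesgue measure. We write $\langle\mu,g\rangle=\int_{\mathbb{R}}g\,d\mu$. Convention: when $f(t)=0$ the infimum defining $b(t)$ below is $-\infty$, and then $\omega(x-b(t))$ is read as $\omega(+\infty)=0$. Barrier. A barrier (boundary) is a function $b$ of time $t\in[0,\infty)$ with real values (up to the convention above). The soft-killed inverse first passage problem for $(\rho,p)$, where $p$ is a probability distribution on $[0,\infty]$, is to find a barrier $b$ such that $\tau=\inf\{t:\Lambda\int_0^t\omega(W_s-b(s))ds\ge U\}$ has distribution $p$, where $W$ is a Brownian motion with $W_0\sim\rho$ and $U\sim\mathrm{Exp}(1)$ is independent of $W$. Weak solution. $\mathcal{BC}^{2,1}(\mathbb{R}\times[0,\infty),\mathbb{R})$ is the set of bounded continuous functions $\phi(x,t)$ with bounded and continuous derivatives $\phi_x,\phi_{xx},\phi_t$. A pair $(u,b)$ is a weak solution of the free boundary problem if $u(\cdot,t)\ge0$, $\int_{\mathbb{R}}u(y,t)dy=1$, and, with $\mu_t(dx)=u(x,t)dx$ (and $\mu_0=\rho$) and $b(t)=\inf\{x:\Lambda\langle\mu_t,\omega(\cdot-x)\rangle\ge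 f(t)\}$, for all $\phi\in\mathcal{BC}^{2,1}(\mathbb{R}\times[0,\infty),\mathbb{R})$ and all $t\ge0$, $$\langle \mu_t,\phi(\cdot,t)\rangle = \langle \rho, \phi(\cdot,0)\rangle + \int_0^t \Big\langle \mu_s, \tfrac12 \phi_{xx}(\cdot,s)+\phi_t(\cdot,s)+f(s)\phi(\cdot,s)-\Lambda\phi(\cdot,s)\omega(\cdot-b(s))\Big\rangle ds.$$
   Formalization: Uniqueness of the barrier b is proved among Borel measurable barriers and up to a Lebesgue-null set of times, since changing b at a single time does not change τ, so pointwise uniqueness among all barriers is false. *)

theory Defs
  imports "HOL-Probability.Probability"
begin

section \<open>Data of the problem\<close>

definition selection_weighting :: "(real \<Rightarrow> real) \<Rightarrow> bool" where
  "selection_weighting \<omega> \<longleftrightarrow>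
     (\<forall>x. 0 \<le> \<omega> x \<and> \<omega> x \<le> 1) \<and> antimono \<omega> \<and>
     (\<omega> \<longlongrightarrow> 1) at_bot \<and> (\<omega> \<longlongrightarrow> 0) at_top"

definition C_k :: "nat \<Rightarrow> (real \<Rightarrow> real) \<Rightarrow> bool" where
  "C_k k g \<longleftrightarrow>
     (\<forall>j<k. (deriv ^^ j) g differentiable_on UNIV) \<and> continuous_on UNIV ((deriv ^^ k) g)"

definition prob_density_fun :: "(real \<Rightarrow> real) \<Rightarrow> bool" where
  "prob_density_fun g \<longleftrightarrow>
     (\<forall>x. 0 \<le> g x) \<and> integrable lborel g \<and> (\<integral>x. g x \<partial>lborel) = 1"

text \<open>The value \<open>\<omega>(x - \<beta>)\<close> for an extended real \<open>\<beta>\<close>. At \<open>\<beta> = -\<infinity>\<close> it is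
  \<open>\<omega>(+\<infinity>) = 0\<close>. The value at \<open>\<beta> = \<infinity>\<close> only makes the function total: barriers never
  take the value \<open>\<infinity>\<close>.\<close>

definition shifted_weight :: "(real \<Rightarrow> real) \<Rightarrow> real \<Rightarrow> ereal \<Rightarrow> real" where
  "shifted_weight \<omega> x \<beta> =
     (case \<beta> of ereal r \<Rightarrow> \<omega> (x - r) | PInfty \<Rightarrow> 1 | MInfty \<Rightarrow> 0)"

text \<open>Only the times in \<open>[0,\<infinity>)\<close> matter. Measurability is needed for the time integral
  in the killing time below to make sense. Since a barrier enters the killing time only through
  that integral, two barriers equal at Lebesgue-almost all times have the same killing time;
  hence uniqueness of a barrier is to be read up to a Lebesgue-null set of times.\<close>

definition barrier :: "(real \<Rightarrow> ereal) \<Rightarrow> bool" where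
  "barrier b \<longleftrightarrow> b \<in> borel_measurable (restrict_space borel {0..}) \<and> (\<forall>t\<ge>0. b t \<noteq> \<infinity>)"


section \<open>Weak solutions of the free boundary problem\<close>

definition density_measure :: "(real \<Rightarrow> real) \<Rightarrow> real measure" where
  "density_measure g = density lborel (\<lambda>x. ennreal (g x))"

text \<open>Bounded continuous test functions \<open>\<phi>(x,t)\<close> on \<open>\<real> \<times> [0,\<infinity>)\<close> with derivatives
  \<open>\<phi>\<^sub>x\<close>, \<open>\<phi>\<^sub>x\<^sub>x\<close>, \<open>\<phi>\<^sub>t\<close>, also bounded and continuous (the time derivative is one-sided at 0).\<close>

definition bounded_cont :: "(real \<Rightarrow> real \<Rightarrow> real) \<Rightarrow> bool" where
  "bounded_cont g \<longleftrightarrow>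
     continuous_on (UNIV \<times> {0..}) (\<lambda>(x, t). g x t) \<and>
     bounded ((\<lambda>(x, t). g x t) ` (UNIV \<times> {0..}))"

definition BC21 :: "(real \<Rightarrow> real \<Rightarrow> real) \<Rightarrow> (real \<Rightarrow> real \<Rightarrow> real) \<Rightarrow>
    (real \<Rightarrow> real \<Rightarrow> real) \<Rightarrow> (real \<Rightarrow> real \<Rightarrow> real) \<Rightarrow> bool" where
  "BC21 \<phi> \<phi>x \<phi>xx \<phi>t \<longleftrightarrow>
     bounded_cont \<phi> \<and> bounded_cont \<phi>x \<and> bounded_cont \<phi>xx \<and> bounded_cont \<phi>t \<and>
     (\<forall>x. \<forall>t\<ge>0.
        ((\<lambda>y. \<phi> y t) has_real_derivative \<phi>x x t) (at x) \<and>
        ((\<lambda>y. \<phi>x y t) has_real_derivative \<phi>xx x t) (at x) \<and>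
        ((\<lambda>s. \<phi> x s) has_real_derivative \<phi>t x t) (at t within {0..}))"

text \<open>The barrier determined by \<open>\<mu>\<^sub>t(dx) = u(x,t) dx\<close>:
  \<open>inf {x. \<Lambda> \<langle>\<mu>\<^sub>t, \<omega>(\<cdot> - x)\<rangle> \<ge> f(t)}\<close>, which is \<open>-\<infinity>\<close> when \<open>f(t) = 0\<close>.\<close>

definition solution_barrier ::
  "(real \<Rightarrow> real) \<Rightarrow> real \<Rightarrow> (real \<Rightarrow> real) \<Rightarrow> (real \<Rightarrow> real \<Rightarrow> real) \<Rightarrow> real \<Rightarrow> ereal" where
  "solution_barrier \<omega> \<Lambda> f u t =
     Inf {ereal x |x. f t \<le> \<Lambda> * (\<integral>y. \<omega> (y - x) \<partial>density_measure (\<lambda>y. u y t))}"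

definition weak_integrand ::
  "(real \<Rightarrow> real) \<Rightarrow> real \<Rightarrow> (real \<Rightarrow> real) \<Rightarrow> (real \<Rightarrow> real \<Rightarrow> real) \<Rightarrow> (real \<Rightarrow> ereal) \<Rightarrow>
   (real \<Rightarrow> real \<Rightarrow> real) \<Rightarrow> (real \<Rightarrow> real \<Rightarrow> real) \<Rightarrow> (real \<Rightarrow> real \<Rightarrow> real) \<Rightarrow> real \<Rightarrow> real" where
  "weak_integrand \<omega> \<Lambda> f u b \<phi> \<phi>xx \<phi>t s =
     (\<integral>x. (1/2 * \<phi>xx x s + \<phi>t x s + f s * \<phi> x s - \<Lambda> * \<phi> x s * shifted_weight \<omega> x (b s))
        \<partial>density_measure (\<lambda>x. u x s))"

definition weak_solution ::
  "(real \<Rightarrow> real) \<Rightarrow> real \<Rightarrow> (real \<Rightarrow> real) \<Rightarrow> (real \<Rightarrow> real) \<Rightarrow>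
   (real \<Rightarrow> real \<Rightarrow> real) \<Rightarrow> (real \<Rightarrow> ereal) \<Rightarrow> bool" where
  "weak_solution \<omega> \<Lambda> f \<rho> u b \<longleftrightarrow>
     (\<forall>t\<ge>0. prob_density_fun (\<lambda>x. u x t)) \<and>
     (\<forall>x. u x 0 = \<rho> x) \<and>
     (\<forall>t\<ge>0. b t = solution_barrier \<omega> \<Lambda> f u t) \<and>
     (\<forall>\<phi> \<phi>x \<phi>xx \<phi>t. BC21 \<phi> \<phi>x \<phi>xx \<phi>t \<longrightarrow>
        (\<forall>t\<ge>0.
           set_integrable lborel {0..t} (weak_integrand \<omega> \<Lambda> f u b \<phi> \<phi>xx \<phi>t) \<and>
           (\<integral>x. \<phi> x t \<partial>density_measure (\<lambda>x. u x t)) =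
             (\<integral>x. \<phi> x 0 \<partial>density_measure \<rho>) +
             (LINT s:{0..t}|lborel. weak_integrand \<omega> \<Lambda> f u b \<phi> \<phi>xx \<phi>t s)))"


section \<open>Brownian motion and the soft-killed inverse first passage problem\<close>

text \<open>Standard Brownian motion on \<open>[0,\<infinity>)\<close> with arbitrary initial law: independence of the
  initial value and the increments is the case \<open>ts 0 = 0\<close> of the third condition.\<close>

definition brownian_motion :: "'a measure \<Rightarrow> (real \<Rightarrow> 'a \<Rightarrow> real) \<Rightarrow> bool" where
  "brownian_motion M W \<longleftrightarrow>
     prob_space M \<and>
     (\<forall>t\<ge>0. W t \<in> borel_measurable M) \<and>
     (\<forall>(ts :: nat \<Rightarrow> real) n. 0 \<le> ts 0 \<and> strict_mono ts \<longrightarrow>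
        prob_space.indep_vars M (\<lambda>_. borel)
          (\<lambda>i z. if i = 0 then W (ts 0) z else W (ts i) z - W (ts (i - 1)) z) {..n}) \<and>
     (\<forall>s t. 0 \<le> s \<and> s < t \<longrightarrow>
        distributed M lborel (\<lambda>z. W t z - W s z)
          (\<lambda>x. ennreal (normal_density 0 (sqrt (t - s)) x))) \<and>
     (\<forall>z\<in>space M. continuous_on {0..} (\<lambda>t. W t z))"

text \<open>A random variable independent of the whole path \<open>(W\<^sub>t)\<^sub>t\<^sub>\<ge>\<^sub>0\<close>, i.e. of the sigma-algebra
  that the path generates.\<close>

definition indep_of_process ::
  "'a measure \<Rightarrow> ('a \<Rightarrow> real) \<Rightarrow> (real \<Rightarrow> 'a \<Rightarrow> real) \<Rightarrow> bool" where
  "indep_of_process M U W \<longleftrightarrow>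
     prob_space.indep_set M
       (sets (vimage_algebra (space M) U borel))
       (sets (vimage_algebra (space M) (\<lambda>z. \<lambda>t\<in>{0..}. W t z) (Pi\<^sub>M {0..} (\<lambda>_. borel))))"

definition killing_setup ::
  "'a measure \<Rightarrow> (real \<Rightarrow> 'a \<Rightarrow> real) \<Rightarrow> ('a \<Rightarrow> real) \<Rightarrow> (real \<Rightarrow> real) \<Rightarrow> bool" where
  "killing_setup M W U \<rho> \<longleftrightarrow>
     brownian_motion M W \<and>
     distributed M lborel (W 0) (\<lambda>x. ennreal (\<rho> x)) \<and>
     distributed M lborel U (\<lambda>x. ennreal (exponential_density 1 x)) \<and>
     indep_of_process M U W"

definition killing_time ::
  "(real \<Rightarrow> real) \<Rightarrow> real \<Rightarrow> (real \<Rightarrow> ereal) \<Rightarrow> (real \<Rightarrow> 'a \<Rightarrow> real) \<Rightarrow> ('a \<Rightarrow> real) \<Rightarrow> 'a \<Rightarrow> ereal" where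
  "killing_time \<omega> \<Lambda> b W U z =
     Inf {ereal t |t. 0 \<le> t \<and>
            U z \<le> \<Lambda> * (LINT s:{0..t}|lborel. shifted_weight \<omega> (W s z) (b s))}"

definition has_survival_function ::
  "'a measure \<Rightarrow> ('a \<Rightarrow> ereal) \<Rightarrow> (real \<Rightarrow> real) \<Rightarrow> bool" where
  "has_survival_function M T f \<longleftrightarrow>
     T \<in> borel_measurable M \<and>
     (\<forall>y\<ge>0. measure M {z \<in> space M. ereal y < T z} = exp (- (LINT s:{0..y}|lborel. f s)))"

text \<open>The target distribution on \<open>[0,\<infinity>]\<close>, as a Borel measure on the extended reals. The case
  \<open>t = 0\<close> says that it is concentrated on \<open>[0,\<infinity>]\<close>.\<close>

definition target_distribution :: "(real \<Rightarrow> real) \<Rightarrow> ereal measure \<Rightarrow> bool" where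
  "target_distribution f p \<longleftrightarrow>
     prob_space p \<and> sets p = sets borel \<and>
     (\<forall>t\<ge>0. measure p {ereal t..} = exp (- (LINT s:{0..t}|lborel. f s)))"

definition solves_soft_killed_ifp ::
  "'a measure \<Rightarrow> (real \<Rightarrow> 'a \<Rightarrow> real) \<Rightarrow> ('a \<Rightarrow> real) \<Rightarrow> (real \<Rightarrow> real) \<Rightarrow> real \<Rightarrow>
   (real \<Rightarrow> real) \<Rightarrow> ereal measure \<Rightarrow> (real \<Rightarrow> ereal) \<Rightarrow> bool" where
  "solves_soft_killed_ifp M W U \<omega> \<Lambda> \<rho> p b \<longleftrightarrow>
     killing_setup M W U \<rho> \<and> barrier b \<and>
     killing_time \<omega> \<Lambda> b W U \<in> borel_measurable M \<and>
     distr M borel (killing_time \<omega> \<Lambda> b W U) = p"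

end

theory Submission
  imports Defs
begin

text \<open>Write \<open>\<mu>\<^sub>t\<close> for the law with density \<open>u(\<cdot>,t)\<close>, \<open>A\<^sub>t = \<Lambda> \<integral>\<^sub>0\<^sup>t \<omega>(W\<^sub>s - b(s)) ds\<close> for the accumulated hazard and
\<open>F(t) = \<integral>\<^sub>0\<^sup>t f(s) ds\<close>. As \<open>U\<close> is exponential and independent of the path, \<open>P(\<tau> > t) = E exp(- A\<^sub>t)\<close>
(\<open>prob_less_killing_time\<close>). Hence the survival function is \<open>exp(- F)\<close> exactly when the measure
\<open>\<nu>\<^sub>t(g) = E [g(W\<^sub>t) exp(F(t) - A\<^sub>t)]\<close> has mass one at all times (\<open>survival_function_iff_unit_mass\<close>).

Both \<open>\<mu>\<close> and \<open>\<nu>\<close> solve the linear equation \<open>\<partial>\<^sub>t m = \<half> \<partial>\<^sub>x\<^sub>x m + c m\<close> with the rate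
\<open>c(s,x) = f(s) - \<Lambda> \<omega>(x - b(s))\<close>, in the Duhamel form
\<open>m\<^sub>t(g) = m\<^sub>0(P\<^sub>t g) + \<integral>\<^sub>0\<^sup>t m\<^sub>s(c\<^sub>s P\<^bsub>t-s\<^esub> g) ds\<close>, where \<open>P\<close> is the heat semigroup. For \<open>\<mu>\<close> one puts the
backward heat flow of a cosine into the weak equation (\<open>weak_solution_mild_evolution\<close>). For \<open>\<nu>\<close> one
integrates \<open>exp(C\<^sub>t) = 1 + \<integral>\<^sub>0\<^sup>t c(s,W\<^sub>s) exp(C\<^sub>s) ds\<close>, where \<open>C = F - A\<close>, against a cosine of \<open>W\<^sub>t\<close>
and uses that \<open>W\<^sub>t - W\<^sub>s\<close> is
independent of the past of \<open>s\<close> (\<open>tilted_mild_evolution\<close>). The Duhamel formula extends from cosines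
to all bounded Borel functions by a monotone class argument (\<open>bounded_borel_trig_induct\<close>), and a
Gronwall iteration in total variation (\<open>mild_evolution_unique\<close>) then gives \<open>\<mu> = \<nu>\<close>. So \<open>\<nu>\<close> has mass
one and \<open>b\<close> solves the problem.

For uniqueness let \<open>b'\<close> be another solution, with rate \<open>c'\<close> and evolution \<open>\<nu>'\<close>. Mass one for both
evolutions forces the flux balance \<open>\<mu>\<^sub>s(c\<^sub>s) = 0 = \<nu>'\<^sub>s(c'\<^sub>s)\<close> for almost all \<open>s\<close>. Because \<open>\<omega>\<close> is monotone,
\<open>c\<^sub>s - c'\<^sub>s\<close> has a constant sign, so
\<open>\<nu>'\<^sub>s \<bar>c\<^sub>s - c'\<^sub>s\<bar> = \<bar>\<nu>'\<^sub>s(c\<^sub>s) - \<nu>'\<^sub>s(c'\<^sub>s)\<bar> = \<bar>\<nu>'\<^sub>s(c\<^sub>s) - \<mu>\<^sub>s(c\<^sub>s)\<bar>\<close>: the error caused by the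
different barriers is controlled by the distance of the two evolutions. The nonlinear problem is
therefore Lipschitz in total variation, and the same Gronwall iteration gives \<open>\<mu> = \<nu>'\<close>
(\<open>unit_mass_evolution_unique\<close>). Finally \<open>\<mu>\<^sub>s\<close> charges every interval for \<open>s > 0\<close>, so
\<open>\<mu>\<^sub>s(\<omega>(\<cdot> - \<beta>))\<close> is strictly increasing in \<open>\<beta>\<close> (\<open>shifted_weight_integral_strict_mono\<close>), and the flux
balance determines the barrier at almost every time.\<close>


section \<open>Trigonometric functions determine bounded Borel functions\<close>

inductive trig_poly :: "(real \<Rightarrow> real) \<Rightarrow> bool" where
  cos: "trig_poly (\<lambda>x. cos (\<theta> * x + \<alpha>))"
| add: "trig_poly g \<Longrightarrow> trig_poly h \<Longrightarrow> trig_poly (\<lambda>x. g x + h x)"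
| scale: "trig_poly g \<Longrightarrow> trig_poly (\<lambda>x. a * g x)"

lemma trig_poly_mult_cos:
  assumes "trig_poly g" shows "trig_poly (\<lambda>x. cos (\<theta> * x + \<alpha>) * g x)"
  using assms
proof induction
  case (cos \<theta>' \<alpha>')
  have "(\<lambda>x. cos (\<theta> * x + \<alpha>) * cos (\<theta>' * x + \<alpha>')) =
    (\<lambda>x. 1/2 * (cos ((\<theta> - \<theta>') * x + (\<alpha> - \<alpha>')) + cos ((\<theta> + \<theta>') * x + (\<alpha> + \<alpha>'))))"
    by (simp add: fun_eq_iff cos_times_cos algebra_simps)
  then show ?case by (simp only:) (intro trig_poly.intros)
next
  case (add g h)
  then show ?case by (simp add: distrib_left trig_poly.add)
next
  case (scale g a)
  then show ?case using trig_poly.scale[OF scale.IH, of a] by (simp add: mult.left_commute)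
qed

lemma trig_poly_mult:
  assumes "trig_poly g" "trig_poly h" shows "trig_poly (\<lambda>x. g x * h x)"
  using assms
proof induction
  case (cos \<theta> \<alpha>)
  then show ?case by (rule trig_poly_mult_cos)
next
  case (add g1 g2)
  then show ?case by (simp add: distrib_right trig_poly.add)
next
  case (scale g a)
  then show ?case using trig_poly.scale[of "\<lambda>x. g x * h x" a] by (simp add: mult.assoc)
qed

lemma trig_poly_polynomial:
  assumes "real_polynomial_function p" "trig_poly h"
  shows "trig_poly (\<lambda>x. p (h x :: real))"
  using assms(1)
proof induction
  case (linear p)
  then obtain a where "p = (\<lambda>x. x * a)" using real_bounded_linear by auto
  then show ?case using trig_poly.scale[OF assms(2), of a] by (simp add: mult.commute)
next
  case (const a)
  have "(\<lambda>x. a) = (\<lambda>x. a * cos (0 * x + 0))" by simp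
  then show ?case by (simp only:) (intro trig_poly.intros)
qed (auto intro: trig_poly.add trig_poly_mult)

text \<open>A monotone class theorem. Trigonometric polynomials form an algebra, so by Weierstrass the class
contains \<open>\<psi>(cos(\<theta> x + \<alpha>))\<close> for continuous \<open>\<psi>\<close> and hence, in the limit, the indicator of
\<open>{x. 0 < sin((x - a) / n)}\<close>. As \<open>n\<close> grows, these sets tend to the half-line \<open>{a<..}\<close>, and the half-lines
are an intersection-stable generator of the Borel sets.\<close>

theorem bounded_borel_trig_induct:
  fixes P :: "(real \<Rightarrow> real) \<Rightarrow> bool"
  assumes g: "g \<in> borel_measurable borel" "\<And>x. \<bar>g x\<bar> \<le> B"
    and cos: "\<And>\<theta> \<alpha>. P (\<lambda>x. cos (\<theta> * x + \<alpha>))"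
    and add: "\<And>g h. P g \<Longrightarrow> P h \<Longrightarrow> P (\<lambda>x. g x + h x)"
    and scale: "\<And>a g. P g \<Longrightarrow> P (\<lambda>x. a * g x)"
    and lim: "\<And>F g B. (\<And>n::nat. P (F n)) \<Longrightarrow> (\<And>n x. \<bar>F n x\<bar> \<le> B) \<Longrightarrow>
      (\<And>x. (\<lambda>n. F n x) \<longlonglongrightarrow> g x) \<Longrightarrow> P g"
  shows "P g"
proof -
  have trig: "P h" if "trig_poly h" for h
    using that by induction (auto intro: cos add scale)
  have one: "P (\<lambda>x. a)" for a
    using scale[OF cos[of 0 0], of a] by simp
  have comp: "P (\<lambda>x. \<psi> (cos (\<theta> * x + \<alpha>)))" if \<psi>: "continuous_on {-1..1} \<psi>" for \<psi> :: "real \<Rightarrow> real" and \<theta> \<alpha>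
  proof -
    have "\<exists>p. real_polynomial_function p \<and> (\<forall>y\<in>{-1..1}. \<bar>\<psi> y - p y\<bar> < 1 / Suc n)" for n
      by (rule Stone_Weierstrass_real_polynomial_function[OF _ \<psi>, of "1 / Suc n"]) auto
    then obtain p where p: "\<And>n. real_polynomial_function (p n)"
      "\<And>n y. y \<in> {-1..1} \<Longrightarrow> \<bar>\<psi> y - p n y\<bar> < 1 / Suc n" by metis
    have "bounded (\<psi> ` {-1..1})"
      using compact_imp_bounded[OF compact_continuous_image[OF \<psi>]] by simp
    then obtain C where "\<forall>y\<in>{-1..1}. \<bar>\<psi> y\<bar> \<le> C"
      unfolding bounded_iff by auto
    then have C: "y \<in> {-1..1} \<Longrightarrow> \<bar>\<psi> y\<bar> \<le> C" for y
      by blast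
    show ?thesis
    proof (rule lim[of "\<lambda>n x. p n (cos (\<theta> * x + \<alpha>))" "C + 1"])
      show "P (\<lambda>x. p n (cos (\<theta> * x + \<alpha>)))" for n
        by (rule trig[OF trig_poly_polynomial[OF p(1) trig_poly.cos]])
      fix x
      have c: "cos (\<theta> * x + \<alpha>) \<in> {-1..1}" by auto
      have "1 / real (Suc n) \<le> 1" for n by simp
      then show "\<bar>p n (cos (\<theta> * x + \<alpha>))\<bar> \<le> C + 1" for n
        using p(2)[OF c, of n] C[OF c] by (smt (verit, best))
      have "(\<lambda>n. p n (cos (\<theta> * x + \<alpha>)) - \<psi> (cos (\<theta> * x + \<alpha>))) \<longlonglongrightarrow> 0"
        by (rule LIMSEQ_norm_0) (use p(2)[OF c] in \<open>simp add: abs_minus_commute\<close>)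
      then show "(\<lambda>n. p n (cos (\<theta> * x + \<alpha>))) \<longlonglongrightarrow> \<psi> (cos (\<theta> * x + \<alpha>))"
        by (rule LIM_zero_cancel)
    qed
  qed
  have pos: "P (\<lambda>x. of_bool (0 < cos (\<theta> * x + \<alpha>)))" for \<theta> \<alpha>
  proof (rule lim[of "\<lambda>n x. min 1 (max 0 (real n * cos (\<theta> * x + \<alpha>)))" 1])
    show "P (\<lambda>x. min 1 (max 0 (real n * cos (\<theta> * x + \<alpha>))))" for n
      by (rule comp) (intro continuous_intros)
    show "(\<lambda>n. min 1 (max 0 (real n * cos (\<theta> * x + \<alpha>)))) \<longlonglongrightarrow> of_bool (0 < cos (\<theta> * x + \<alpha>))" for x
    proof (cases "0 < cos (\<theta> * x + \<alpha>)")
      case True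
      define y where "y = cos (\<theta> * x + \<alpha>)"
      have y: "0 < y" using True y_def by simp
      obtain N :: nat where N: "1 / y < N" using reals_Archimedean2 by blast
      have "min 1 (max 0 (real n * y)) = 1" if "n \<ge> N" for n
      proof -
        have "1 / y < n" using N that by linarith
        then show ?thesis using y by (auto simp: field_simps min_def max_def)
      qed
      then show ?thesis using y unfolding y_def[symmetric]
        by (intro tendsto_eventually eventually_sequentiallyI[of N]) simp
    next
      case False
      then have "real n * cos (\<theta> * x + \<alpha>) \<le> 0" for n
        by (intro mult_nonneg_nonpos) auto
      then have "max 0 (real n * cos (\<theta> * x + \<alpha>)) = 0" for n
        by (rule max_absorb1)
      then show ?thesis using False by simp
    qed
  qed auto
  have ioi: "P (indicator {a<..})" for a :: real
  proof (rule lim[of "\<lambda>n x. of_bool (0 < cos (1 / Suc n * x + (- a / Suc n - pi/2)))" 1])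
    show "P (\<lambda>x. of_bool (0 < cos (1 / Suc n * x + (- a / Suc n - pi/2))))" for n
      by (rule pos)
    show "(\<lambda>n. of_bool (0 < cos (1 / Suc n * x + (- a / Suc n - pi/2)))) \<longlonglongrightarrow> (indicator {a<..} x :: real)" for x
    proof -
      have eq: "cos (1 / Suc n * x + (- a / Suc n - pi/2)) = sin ((x - a) / Suc n)" for n
      proof -
        have "1 / Suc n * x + (- a / Suc n - pi/2) = - (pi/2 - (x - a) / Suc n)"
          by (simp add: diff_divide_distrib)
        then show ?thesis by (simp only: cos_minus sin_cos_eq of_real_eq_id id_apply)
      qed
      obtain N :: nat where N: "\<bar>x - a\<bar> / pi < N" using reals_Archimedean2 by blast
      (* For large n the argument lies between -pi and pi, where the sine has the sign of its argument. *)
      have "(0 < sin ((x - a) / Suc n)) = (a < x)" if "n \<ge> N" for n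
      proof -
        have "\<bar>x - a\<bar> / pi < Suc n" using N that by linarith
        then have lt: "\<bar>(x - a) / Suc n\<bar> < pi" by (simp add: field_simps)
        show ?thesis
        proof (cases "a < x")
          case True
          then have "0 < (x - a) / Suc n" by simp
          then show ?thesis using sin_gt_zero[of "(x - a) / Suc n"] lt True by auto
        next
          case False
          then have "0 \<le> (a - x) / Suc n" by simp
          then have "0 \<le> sin ((a - x) / Suc n)"
            using lt by (intro sin_ge_zero) (auto simp: diff_divide_distrib)
          moreover have "sin ((x - a) / Suc n) = - sin ((a - x) / Suc n)"
            by (simp only: sin_minus[symmetric] minus_divide_left minus_diff_eq)
          ultimately show ?thesis using False by simp
        qed
      qed
      then show ?thesis unfolding eq
        by (intro tendsto_eventually eventually_sequentiallyI[of N]) (simp add: indicator_def)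
    qed
  qed auto
  have sums: "P (\<lambda>x. \<Sum>i\<in>I. F i x)" if "finite I" "\<And>i. i \<in> I \<Longrightarrow> P (F i)" for I :: "'i set" and F
    using that by (induction I) (auto intro: add one)
  have ind: "P (indicator A)" if "A \<in> sets borel" for A :: "real set"
  proof -
    have stable: "Int_stable (range greaterThan :: real set set)"
    proof -
      have "{a<..} \<inter> {b<..} = {max a b<..}" for a b :: real by auto
      then show ?thesis by (simp add: Int_stable_def)
    qed
    have sub: "range (greaterThan :: real \<Rightarrow> real set) \<subseteq> Pow UNIV" by simp
    have "A \<in> sigma_sets UNIV (range greaterThan)"
      using that by (simp add: borel_Ioi)
    from stable sub this show ?thesis
    proof (induction A rule: sigma_sets_induct_disjoint)
      case (basic A)
      then show ?case using ioi by auto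
    next
      case empty
      then show ?case using one[of 0] by (simp add: indicator_def[abs_def])
    next
      case (compl A)
      have "P (\<lambda>x. 1 + (-1) * indicator A x)"
        by (intro add scale one compl)
      moreover have "(\<lambda>x. 1 + (-1) * indicator A x) = (indicator (UNIV - A) :: real \<Rightarrow> real)"
        by (auto simp: indicator_def)
      ultimately show ?case by simp
    next
      case (union A)
      show ?case
      proof (rule lim[of "\<lambda>n x. \<Sum>i<n. indicator (A i) x" 1])
        show "P (\<lambda>x. \<Sum>i<n. indicator (A i) x)" for n
          by (intro sums union(3)) auto
        have eq: "(\<Sum>i<n. indicator (A i) x) = (indicator (\<Union>i<n. A i) x :: real)" for n x
          using union(1) by (intro indicator_UN_disjoint[symmetric]) (auto simp: disjoint_family_on_def)
        show "\<bar>\<Sum>i<n. indicator (A i) x\<bar> \<le> (1::real)" for n x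
          unfolding eq by (auto simp: indicator_def)
        show "(\<lambda>n. \<Sum>i<n. indicator (A i) x) \<longlonglongrightarrow> (indicator (\<Union>i. A i) x :: real)" for x
          unfolding eq by (rule LIMSEQ_indicator_UN)
      qed
    qed
  qed
  obtain s where s: "\<And>i. simple_function borel (s i :: real \<Rightarrow> real)"
      "\<And>x. (\<lambda>i. s i x) \<longlonglongrightarrow> g x" "\<And>i x. dist (s i x) 0 \<le> 2 * dist (g x) 0"
    using borel_measurable_implies_sequence_metric[OF g(1), of 0] by auto
  show ?thesis
  proof (rule lim[of s "2 * B"])
    fix i
    have fin: "finite (range (s i))" using simple_functionD(1)[OF s(1)[of i]] by simp
    have "P (\<lambda>x. \<Sum>y\<in>range (s i). y * indicator (s i -` {y}) x)"
      using simple_functionD(2)[OF s(1)[of i]] by (intro sums fin scale ind) auto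
    moreover have "(\<lambda>x. \<Sum>y\<in>range (s i). y * indicator (s i -` {y}) x) = s i"
    proof
      fix x
      have "(\<Sum>y\<in>range (s i). y * indicator (s i -` {y}) x) = (\<Sum>y\<in>range (s i). if y = s i x then y else 0)"
        by (intro sum.cong) (auto simp: indicator_def)
      then show "(\<Sum>y\<in>range (s i). y * indicator (s i -` {y}) x) = s i x"
        using fin by simp
    qed
    ultimately show "P (s i)" by simp
    show "\<bar>s i x\<bar> \<le> 2 * B" for x using s(3)[of i x] g(2)[of x] by simp
  qed (rule s)
qed


section \<open>Mild evolutions of measures and their uniqueness\<close>

lemma (in finite_measure) abs_integral_le:
  fixes h :: "'a \<Rightarrow> real"
  assumes "\<And>x. \<bar>h x\<bar> \<le> B"
  shows "\<bar>\<integral>x. h x \<partial>M\<bar> \<le> B * measure M (space M)"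
proof (cases "integrable M h")
  case True
  have "\<bar>\<integral>x. h x \<partial>M\<bar> \<le> (\<integral>x. \<bar>h x\<bar> \<partial>M)" by (rule integral_abs_bound)
  also have "\<dots> \<le> (\<integral>x. B \<partial>M)" using True assms by (intro integral_mono) auto
  finally show ?thesis by (simp add: mult.commute)
next
  case False
  have "0 \<le> \<bar>h undefined\<bar>" by simp
  then have "0 \<le> B" using assms[of undefined] by linarith
  then show ?thesis using False by (simp add: not_integrable_integral_eq)
qed

lemma char_eq_cos_sin:
  assumes "real_distribution M"
  shows "Re (char M t) = (\<integral>x. cos (t * x) \<partial>M)" "Im (char M t) = (\<integral>x. sin (t * x) \<partial>M)"
proof -
  interpret real_distribution M by fact
  have i: "integrable M (\<lambda>x. iexp (t * x))" by (rule integrable_iexp) auto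
  show "Re (char M t) = (\<integral>x. cos (t * x) \<partial>M)"
    unfolding char_def integral_Re[OF i, symmetric] by (simp add: Re_exp)
  show "Im (char M t) = (\<integral>x. sin (t * x) \<partial>M)"
    unfolding char_def integral_Im[OF i, symmetric] by (simp add: Im_exp)
qed

lemma std_normal_cos: "(\<integral>z. cos (t * z) \<partial>std_normal_distribution) = exp (- (t\<^sup>2 / 2))"
  and std_normal_sin: "(\<integral>z. sin (t * z) \<partial>std_normal_distribution) = 0"
  using char_eq_cos_sin[OF real_dist_normal_dist, of t]
  unfolding char_std_normal_distribution by simp_all

lemma normal_cos_shift:
  "(\<integral>z. cos (a + t * z) \<partial>std_normal_distribution) = exp (- (t\<^sup>2 / 2)) * cos a"
proof -
  interpret real_distribution std_normal_distribution by (rule real_dist_normal_dist)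
  have "integrable std_normal_distribution (\<lambda>z. cos (t * z))"
    "integrable std_normal_distribution (\<lambda>z. sin (t * z))"
    by (intro integrable_const_bound[where B=1]; simp)+
  then show ?thesis by (simp add: cos_add std_normal_cos std_normal_sin)
qed

text \<open>The heat semigroup at time \<open>r\<close>. Scaling a standard normal variable makes \<open>r = 0\<close> the identity
without a case distinction.\<close>

definition heat :: "real \<Rightarrow> (real \<Rightarrow> real) \<Rightarrow> real \<Rightarrow> real" where
  "heat r g x = (\<integral>z. g (x + sqrt r * z) \<partial>std_normal_distribution)"

lemma heat_cos:
  assumes "0 \<le> r"
  shows "heat r (\<lambda>x. cos (\<theta> * x + \<alpha>)) x = exp (- (\<theta>\<^sup>2 * r / 2)) * cos (\<theta> * x + \<alpha>)"
proof -
  have "(\<lambda>z. cos (\<theta> * (x + sqrt r * z) + \<alpha>)) = (\<lambda>z. cos ((\<theta> * x + \<alpha>) + (\<theta> * sqrt r) * z))"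
    by (simp add: algebra_simps)
  then show ?thesis using assms by (simp add: heat_def normal_cos_shift power_mult_distrib)
qed

lemma heat_measurable [measurable]:
  fixes g :: "real \<Rightarrow> real"
  assumes [measurable]: "g \<in> borel_measurable borel"
  shows "heat r g \<in> borel_measurable borel"
proof -
  interpret real_distribution std_normal_distribution by (rule real_dist_normal_dist)
  show ?thesis unfolding heat_def[abs_def] by measurable
qed

lemma heat_integrable:
  fixes g :: "real \<Rightarrow> real"
  assumes [measurable]: "g \<in> borel_measurable borel" and "\<And>x. \<bar>g x\<bar> \<le> B"
  shows "integrable std_normal_distribution (\<lambda>z. g (x + a * z))"
proof -
  interpret real_distribution std_normal_distribution by (rule real_dist_normal_dist)
  show ?thesis by (intro integrable_const_bound[where B=B]) (auto simp: assms(2))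
qed

lemma abs_heat_le:
  fixes g :: "real \<Rightarrow> real"
  assumes "\<And>x. \<bar>g x\<bar> \<le> B"
  shows "\<bar>heat r g x\<bar> \<le> B"
proof -
  interpret real_distribution std_normal_distribution by (rule real_dist_normal_dist)
  have "prob UNIV = 1" using prob_space by simp
  then show ?thesis using abs_integral_le[of "\<lambda>z. g (x + sqrt r * z)" B] assms
    by (simp add: heat_def)
qed

lemma heat_add:
  fixes g h :: "real \<Rightarrow> real"
  assumes "g \<in> borel_measurable borel" "\<And>x. \<bar>g x\<bar> \<le> B" "h \<in> borel_measurable borel" "\<And>x. \<bar>h x\<bar> \<le> B'"
  shows "heat r (\<lambda>x. g x + h x) x = heat r g x + heat r h x"
  unfolding heat_def
  using heat_integrable[OF assms(1,2)] heat_integrable[OF assms(3,4)] by simp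

lemma heat_scale: "heat r (\<lambda>x. a * g x) x = a * heat r g x"
  by (simp add: heat_def)

lemma heat_bounded_limit:
  fixes F :: "nat \<Rightarrow> real \<Rightarrow> real"
  assumes [measurable]: "\<And>n. F n \<in> borel_measurable borel" and B: "\<And>n x. \<bar>F n x\<bar> \<le> B"
    and lim: "\<And>x. (\<lambda>n. F n x) \<longlonglongrightarrow> g x"
  shows "(\<lambda>n. heat r (F n) x) \<longlonglongrightarrow> heat r g x"
proof -
  interpret real_distribution std_normal_distribution by (rule real_dist_normal_dist)
  have [measurable]: "g \<in> borel_measurable borel"
    by (rule borel_measurable_LIMSEQ_real[where u=F]) (auto intro: lim)
  show ?thesis unfolding heat_def
    by (rule integral_dominated_convergence[where w="\<lambda>_. B"]) (auto simp: B lim)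
qed

text \<open>Finite measures that solve \<open>\<partial>\<^sub>t m = \<half> \<partial>\<^sub>x\<^sub>x m + c m\<close> in Duhamel form, tested against cosines only: on these
the heat semigroup acts by the factor \<open>exp(- \<theta>\<^sup>2 r / 2)\<close>, so the formula is easy to establish.
The phase \<open>\<alpha>\<close> accounts for the sines.\<close>

locale mild_evolution =
  fixes m :: "real \<Rightarrow> real measure" and c :: "real \<Rightarrow> real \<Rightarrow> real" and L :: real and K :: "real \<Rightarrow> real"
  assumes finite_measure: "0 \<le> t \<Longrightarrow> finite_measure (m t)"
    and sets_eq: "0 \<le> t \<Longrightarrow> sets (m t) = sets borel"
    and mass_le: "0 \<le> t \<Longrightarrow> t \<le> T \<Longrightarrow> measure (m t) UNIV \<le> K T"
    and c_measurable: "0 \<le> t \<Longrightarrow> c t \<in> borel_measurable borel"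
    and c_bound: "0 \<le> t \<Longrightarrow> \<bar>c t x\<bar> \<le> L"
    and cos_integrable: "0 \<le> t \<Longrightarrow> set_integrable lborel {0..t}
       (\<lambda>s. exp (- (\<theta>\<^sup>2 * (t - s) / 2)) * (\<integral>x. cos (\<theta> * x + \<alpha>) * c s x \<partial>m s))"
    and duhamel_cos: "0 \<le> t \<Longrightarrow> (\<integral>x. cos (\<theta> * x + \<alpha>) \<partial>m t) =
       exp (- (\<theta>\<^sup>2 * t / 2)) * (\<integral>x. cos (\<theta> * x + \<alpha>) \<partial>m 0) +
       (LINT s:{0..t}|lborel. exp (- (\<theta>\<^sup>2 * (t - s) / 2)) * (\<integral>x. cos (\<theta> * x + \<alpha>) * c s x \<partial>m s))"
begin

lemma space_eq: "0 \<le> t \<Longrightarrow> space (m t) = UNIV"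
  using sets_eq_imp_space_eq[OF sets_eq] by simp

lemma bounded_integrable:
  fixes h :: "real \<Rightarrow> real"
  assumes "0 \<le> t" "h \<in> borel_measurable borel" "\<And>x. \<bar>h x\<bar> \<le> B"
  shows "integrable (m t) h"
proof -
  interpret M: finite_measure "m t" by (rule finite_measure) fact
  show ?thesis using assms
    by (intro M.integrable_const_bound[where B=B]) (auto simp: measurable_cong_sets[OF sets_eq refl])
qed

lemma abs_integral_mass_le:
  fixes h :: "real \<Rightarrow> real"
  assumes "0 \<le> t" "t \<le> T" "\<And>x. \<bar>h x\<bar> \<le> B"
  shows "\<bar>\<integral>x. h x \<partial>m t\<bar> \<le> B * K T"
proof -
  interpret M: finite_measure "m t" by (rule finite_measure) fact
  have "0 \<le> \<bar>h undefined\<bar>" by simp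
  then have "0 \<le> B" using assms(3)[of undefined] by linarith
  have "\<bar>\<integral>x. h x \<partial>m t\<bar> \<le> B * measure (m t) UNIV"
    using M.abs_integral_le[of h B] assms by (simp add: space_eq)
  also have "\<dots> \<le> B * K T" using mass_le[OF assms(1,2)] \<open>0 \<le> B\<close> by (rule mult_left_mono)
  finally show ?thesis .
qed

lemma heat_times_c:
  assumes "0 \<le> s" "g \<in> borel_measurable borel" "\<And>x. \<bar>g x\<bar> \<le> B"
  shows "(\<lambda>x. heat r g x * c s x) \<in> borel_measurable borel" "\<bar>heat r g x * c s x\<bar> \<le> B * L"
proof -
  note [measurable] = assms(2) c_measurable[OF assms(1)]
  show "(\<lambda>x. heat r g x * c s x) \<in> borel_measurable borel" by measurable
  show "\<bar>heat r g x * c s x\<bar> \<le> B * L"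
    unfolding abs_mult
    by (rule mult_mono') (use abs_heat_le[OF assms(3)] c_bound[OF assms(1)] in auto)
qed

text \<open>Both sides are linear in the test function and, by dominated convergence, stable under bounded
pointwise limits, so the formula passes from cosines to all bounded Borel functions. Arbitrary Borel
test functions are needed since the rate \<open>c\<close> reappears in the integrand and is merely measurable.\<close>

theorem duhamel:
  assumes "g \<in> borel_measurable borel" "\<And>x. \<bar>g x\<bar> \<le> B" and t: "0 \<le> t"
  shows "set_integrable lborel {0..t} (\<lambda>s. \<integral>x. heat (t - s) g x * c s x \<partial>m s)"
    and "(\<integral>x. g x \<partial>m t) = (\<integral>x. heat t g x \<partial>m 0) +
       (LINT s:{0..t}|lborel. (\<integral>x. heat (t - s) g x * c s x \<partial>m s))"
proof -
  define P where "P g \<longleftrightarrow> g \<in> borel_measurable borel \<and> (\<exists>B. \<forall>x. \<bar>g x\<bar> \<le> B) \<and>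
    set_integrable lborel {0..t} (\<lambda>s. \<integral>x. heat (t - s) g x * c s x \<partial>m s) \<and>
    (\<integral>x. g x \<partial>m t) = (\<integral>x. heat t g x \<partial>m 0) +
       (LINT s:{0..t}|lborel. (\<integral>x. heat (t - s) g x * c s x \<partial>m s))" for g
  have "P g" using assms(1,2)
  proof (rule bounded_borel_trig_induct)
    fix \<theta> \<alpha> :: real
    have eq: "(\<integral>x. heat (t - s) (\<lambda>x. cos (\<theta> * x + \<alpha>)) x * c s x \<partial>m s) =
      exp (- (\<theta>\<^sup>2 * (t - s) / 2)) * (\<integral>x. cos (\<theta> * x + \<alpha>) * c s x \<partial>m s)" if "s \<in> {0..t}" for s
      using that by (simp add: heat_cos mult.assoc)
    have "set_integrable lborel {0..t} (\<lambda>s. \<integral>x. heat (t - s) (\<lambda>x. cos (\<theta> * x + \<alpha>)) x * c s x \<partial>m s)"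
      by (subst set_integrable_cong[OF refl refl eq]) (auto intro: cos_integrable[OF t])
    moreover have "(LINT s:{0..t}|lborel. (\<integral>x. heat (t - s) (\<lambda>x. cos (\<theta> * x + \<alpha>)) x * c s x \<partial>m s)) =
      (LINT s:{0..t}|lborel. exp (- (\<theta>\<^sup>2 * (t - s) / 2)) * (\<integral>x. cos (\<theta> * x + \<alpha>) * c s x \<partial>m s))"
      by (intro set_lebesgue_integral_cong) (auto simp: eq)
    moreover have "\<exists>B. \<forall>x. \<bar>cos (\<theta> * x + \<alpha>)\<bar> \<le> B" by (rule exI[of _ 1]) simp
    ultimately show "P (\<lambda>x. cos (\<theta> * x + \<alpha>))"
      unfolding P_def by (simp add: duhamel_cos[OF t, of \<theta> \<alpha>] ext[OF heat_cos[OF t]])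
  next
    fix g h assume "P g" "P h"
    then obtain B B' where g: "g \<in> borel_measurable borel" "\<And>x. \<bar>g x\<bar> \<le> B"
      and h: "h \<in> borel_measurable borel" "\<And>x. \<bar>h x\<bar> \<le> B'"
      unfolding P_def by blast
    have eq: "(\<integral>x. heat r (\<lambda>x. g x + h x) x * c s x \<partial>m s) =
      (\<integral>x. heat r g x * c s x \<partial>m s) + (\<integral>x. heat r h x * c s x \<partial>m s)" if "0 \<le> s" for r s
      unfolding heat_add[OF g h] distrib_right
      by (intro Bochner_Integration.integral_add bounded_integrable[OF that heat_times_c[OF that g]]
            bounded_integrable[OF that heat_times_c[OF that h]])
    have "set_integrable lborel {0..t} (\<lambda>s. \<integral>x. heat (t - s) (\<lambda>x. g x + h x) x * c s x \<partial>m s)"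
      using \<open>P g\<close> \<open>P h\<close> unfolding P_def
      by (subst set_integrable_cong[OF refl refl eq]) auto
    moreover have "(LINT s:{0..t}|lborel. \<integral>x. heat (t - s) (\<lambda>x. g x + h x) x * c s x \<partial>m s) =
      (LINT s:{0..t}|lborel. (\<integral>x. heat (t - s) g x * c s x \<partial>m s) + (\<integral>x. heat (t - s) h x * c s x \<partial>m s))"
      by (intro set_lebesgue_integral_cong) (auto simp: eq)
    moreover have "(\<integral>x. g x + h x \<partial>m t) = (\<integral>x. g x \<partial>m t) + (\<integral>x. h x \<partial>m t)"
      by (intro Bochner_Integration.integral_add bounded_integrable[OF t g] bounded_integrable[OF t h])
    moreover have "(\<integral>x. heat t (\<lambda>x. g x + h x) x \<partial>m 0) = (\<integral>x. heat t g x \<partial>m 0) + (\<integral>x. heat t h x \<partial>m 0)"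
      unfolding heat_add[OF g h]
      by (intro Bochner_Integration.integral_add bounded_integrable[OF order_refl _ abs_heat_le[OF g(2)]]
           bounded_integrable[OF order_refl _ abs_heat_le[OF h(2)]] heat_measurable g h)
    moreover have "\<bar>g x + h x\<bar> \<le> B + B'" for x
      using g(2)[of x] h(2)[of x] by linarith
    ultimately show "P (\<lambda>x. g x + h x)"
      using \<open>P g\<close> \<open>P h\<close> unfolding P_def by auto
  next
    fix a g assume "P g"
    then obtain B where B: "\<And>x. \<bar>g x\<bar> \<le> B" unfolding P_def by auto
    then have "\<bar>a * g x\<bar> \<le> \<bar>a\<bar> * B" for x by (simp add: abs_mult mult_left_mono)
    then show "P (\<lambda>x. a * g x)"
      using \<open>P g\<close> unfolding P_def heat_scale by (auto simp: mult.assoc distrib_left)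
  next
    fix F :: "nat \<Rightarrow> real \<Rightarrow> real" and g B
    assume P: "\<And>n. P (F n)" and B: "\<And>n x. \<bar>F n x\<bar> \<le> B" and lim: "\<And>x. (\<lambda>n. F n x) \<longlonglongrightarrow> g x"
    have F: "F n \<in> borel_measurable borel" for n using P[of n] unfolding P_def by simp
    have g: "g \<in> borel_measurable borel"
      by (rule borel_measurable_LIMSEQ_real[where u=F]) (auto intro: lim F)
    have gB: "\<bar>g x\<bar> \<le> B" for x
      by (rule LIMSEQ_le_const2[OF tendsto_rabs[OF lim[of x]]]) (use B in auto)
    have conv: "(\<lambda>n. \<integral>x. h n x \<partial>m s) \<longlonglongrightarrow> (\<integral>x. k x \<partial>m s)"
      if "0 \<le> s" "\<And>n. h n \<in> borel_measurable borel" "\<And>n x. \<bar>h n x\<bar> \<le> C" "\<And>x. (\<lambda>n. h n x) \<longlonglongrightarrow> k x"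
      for s C k and h :: "nat \<Rightarrow> real \<Rightarrow> real"
    proof -
      interpret M: finite_measure "m s" by (rule finite_measure) fact
      have "k \<in> borel_measurable borel"
        by (rule borel_measurable_LIMSEQ_real[where u=h]) (auto intro: that)
      then show ?thesis using that
        by (intro integral_dominated_convergence[where w="\<lambda>_. C"])
           (auto simp: measurable_cong_sets[OF sets_eq refl])
    qed
    have lim_heat: "(\<lambda>n. heat r (F n) x) \<longlonglongrightarrow> heat r g x" for r x
      by (rule heat_bounded_limit[OF F B lim])
    define \<phi> where "\<phi> g s = indicator {0..t} s *\<^sub>R (\<integral>x. heat (t - s) g x * c s x \<partial>m s)" for g s
    have int: "integrable lborel (\<phi> (F n))" for n
      using P[of n] unfolding P_def \<phi>_def set_integrable_def by simp
    have \<phi>_lim: "(\<lambda>n. \<phi> (F n) s) \<longlonglongrightarrow> \<phi> g s" for s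
    proof (cases "s \<in> {0..t}")
      case True
      then have s: "0 \<le> s" by simp
      show ?thesis unfolding \<phi>_def
        by (intro tendsto_intros conv[OF s heat_times_c[OF s F B]] lim_heat)
    qed (simp add: \<phi>_def)
    have \<phi>_meas: "\<phi> g \<in> borel_measurable lborel"
      by (rule borel_measurable_LIMSEQ_real[OF \<phi>_lim]) (rule borel_measurable_integrable[OF int])
    have \<phi>_bound: "norm (\<phi> (F n) s) \<le> indicator {0..t} s *\<^sub>R (B * L * K t)" for n s
    proof (cases "s \<in> {0..t}")
      case True
      then have s: "0 \<le> s" "s \<le> t" by auto
      show ?thesis unfolding \<phi>_def
        using abs_integral_mass_le[OF s heat_times_c(2)[OF s(1) F B]] True by simp
    qed (simp add: \<phi>_def)
    have dom: "integrable lborel (\<lambda>s. indicator {0..t} s *\<^sub>R (B * L * K t))"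
      using integrable_mult_left[OF integrable_real_indicator[of "{0..t}" lborel], of "B * L * K t"]
      by (simp add: emeasure_lborel_Icc_eq)
    have int_g: "integrable lborel (\<phi> g)"
      by (rule integrable_dominated_convergence[where s="\<lambda>n. \<phi> (F n)",
            OF \<phi>_meas borel_measurable_integrable[OF int] dom])
         (use \<phi>_lim \<phi>_bound in auto)
    have lim_int: "(\<lambda>n. \<integral>s. \<phi> (F n) s \<partial>lborel) \<longlonglongrightarrow> (\<integral>s. \<phi> g s \<partial>lborel)"
      by (rule integral_dominated_convergence[where s="\<lambda>n. \<phi> (F n)",
            OF \<phi>_meas borel_measurable_integrable[OF int] dom])
         (use \<phi>_lim \<phi>_bound in auto)
    have eqn: "(\<integral>x. F n x \<partial>m t) = (\<integral>x. heat t (F n) x \<partial>m 0) + (\<integral>s. \<phi> (F n) s \<partial>lborel)" for n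
      using P[of n] unfolding P_def \<phi>_def set_lebesgue_integral_def by simp
    have "(\<lambda>n. \<integral>x. F n x \<partial>m t) \<longlonglongrightarrow> (\<integral>x. g x \<partial>m t)"
      by (rule conv[OF t F B lim])
    moreover have "(\<lambda>n. \<integral>x. F n x \<partial>m t) \<longlonglongrightarrow> (\<integral>x. heat t g x \<partial>m 0) + (\<integral>s. \<phi> g s \<partial>lborel)"
      unfolding eqn
      by (intro tendsto_add lim_int conv[OF order_refl heat_measurable[OF F] abs_heat_le[OF B]] lim_heat)
    ultimately have "(\<integral>x. g x \<partial>m t) = (\<integral>x. heat t g x \<partial>m 0) + (\<integral>s. \<phi> g s \<partial>lborel)"
      by (rule LIMSEQ_unique)
    then show "P g"
      unfolding P_def using g gB int_g by (auto simp: \<phi>_def[abs_def] set_integrable_def set_lebesgue_integral_def)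
  qed
  then show "set_integrable lborel {0..t} (\<lambda>s. \<integral>x. heat (t - s) g x * c s x \<partial>m s)"
    and "(\<integral>x. g x \<partial>m t) = (\<integral>x. heat t g x \<partial>m 0) +
       (LINT s:{0..t}|lborel. (\<integral>x. heat (t - s) g x * c s x \<partial>m s))"
    unfolding P_def by auto
qed

end

text \<open>Gronwall's argument. The hypothesis \<open>lip\<close> says that, at almost every time, the source terms differ
by at most \<open>C\<close> times any bound \<open>D\<close> for the total variation distance. Inserting a bound into the Duhamel formula
and integrating improves \<open>K C\<^sup>n t\<^sup>n / n!\<close> to the next such term. Working with explicit bounds avoids
the question whether the distance is measurable in time.\<close>

theorem mild_evolution_unique:
  fixes m m' :: "real \<Rightarrow> real measure"
  assumes "mild_evolution m c L K" and "mild_evolution m' c' L' K'"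
    and init: "m 0 = m' 0" and C: "0 \<le> C"
    and lip: "AE s in lborel. 0 \<le> s \<longrightarrow> (\<forall>\<psi> D. \<psi> \<in> borel_measurable borel \<longrightarrow> (\<forall>x. \<bar>\<psi> x\<bar> \<le> 1) \<longrightarrow>
        (\<forall>g\<in>borel_measurable borel. (\<forall>x. \<bar>g x\<bar> \<le> 1) \<longrightarrow> \<bar>(\<integral>x. g x \<partial>m s) - (\<integral>x. g x \<partial>m' s)\<bar> \<le> D) \<longrightarrow>
        \<bar>(\<integral>x. \<psi> x * c s x \<partial>m s) - (\<integral>x. \<psi> x * c' s x \<partial>m' s)\<bar> \<le> C * D)"
    and T: "0 \<le> T"
  shows "m T = m' T"
proof -
  interpret m: mild_evolution m c L K by fact
  interpret m': mild_evolution m' c' L' K' by fact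
  define D where "D n s = (K T + K' T) * (C ^ n * s ^ n / fact n)" for n and s :: real
  have bound: "\<bar>(\<integral>x. g x \<partial>m t) - (\<integral>x. g x \<partial>m' t)\<bar> \<le> D n t"
    if "0 \<le> t" "t \<le> T" "g \<in> borel_measurable borel" "\<And>x. \<bar>g x\<bar> \<le> 1" for n t g
    using that
  proof (induction n arbitrary: t g)
    case 0
    have "\<bar>\<integral>x. g x \<partial>m t\<bar> \<le> 1 * K T" "\<bar>\<integral>x. g x \<partial>m' t\<bar> \<le> 1 * K' T"
      using 0 by (intro m.abs_integral_mass_le m'.abs_integral_mass_le; simp)+
    then show ?case by (simp add: D_def)
  next
    case (Suc n)
    let ?I = "\<lambda>s. \<integral>x. heat (t - s) g x * c s x \<partial>m s" and ?I' = "\<lambda>s. \<integral>x. heat (t - s) g x * c' s x \<partial>m' s"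
    note d = m.duhamel[OF Suc.prems(3,4,1)] and d' = m'.duhamel[OF Suc.prems(3,4,1)]
    have int: "integrable lborel (\<lambda>s. indicator {0..t} s * (?I s - ?I' s))"
      using set_integral_diff(1)[OF d(1) d'(1)] by (simp add: set_integrable_def)
    have "(\<integral>x. g x \<partial>m t) - (\<integral>x. g x \<partial>m' t) = (LINT s:{0..t}|lborel. ?I s - ?I' s)"
      unfolding d(2) d'(2) init set_integral_diff(2)[OF d(1) d'(1)] by simp
    then have "\<bar>(\<integral>x. g x \<partial>m t) - (\<integral>x. g x \<partial>m' t)\<bar> =
        \<bar>\<integral>s. indicator {0..t} s * (?I s - ?I' s) \<partial>lborel\<bar>"
      by (simp only: set_lebesgue_integral_def real_scaleR_def)
    also have "\<dots> \<le> (\<integral>s. \<bar>indicator {0..t} s * (?I s - ?I' s)\<bar> \<partial>lborel)"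
      by (rule integral_abs_bound)
    also have "\<dots> \<le> (\<integral>s. C * ((K T + K' T) * (C ^ n / fact n)) * (s ^ n * indicator {0..t} s) \<partial>lborel)"
    proof (rule integral_mono_AE)
      show "integrable lborel (\<lambda>s. \<bar>indicator {0..t} s * (?I s - ?I' s)\<bar>)"
        using int by (rule integrable_abs)
      have "integrable lborel (\<lambda>s. s ^ n * indicator {0..t} s :: real)"
      proof -
        have "continuous_on {0..t} (\<lambda>s::real. s ^ n)" by (intro continuous_intros)
        from borel_integrable_atLeastAtMost'[OF this] show ?thesis
          by (simp add: set_integrable_def mult.commute)
      qed
      then show "integrable lborel (\<lambda>s. C * ((K T + K' T) * (C ^ n / fact n)) * (s ^ n * indicator {0..t} s))"
        by (rule integrable_mult_right)
      show "AE s in lborel. \<bar>indicator {0..t} s * (?I s - ?I' s)\<bar>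
          \<le> C * ((K T + K' T) * (C ^ n / fact n)) * (s ^ n * indicator {0..t} s)"
        using lip
      proof eventually_elim
        case (elim s)
        show ?case
        proof (cases "s \<in> {0..t}")
          case True
          then have s: "0 \<le> s" "s \<le> T" using Suc.prems by auto
          have "\<bar>?I s - ?I' s\<bar> \<le> C * D n s"
          proof (rule elim[rule_format, OF s(1)])
            show "heat (t - s) g \<in> borel_measurable borel" by (rule heat_measurable[OF Suc.prems(3)])
            show "\<bar>heat (t - s) g x\<bar> \<le> 1" for x by (rule abs_heat_le[OF Suc.prems(4)])
          qed (rule Suc.IH[OF s])
          then show ?thesis using True by (simp add: D_def mult_ac)
        qed simp
      qed
    qed
    also have "\<dots> = C * ((K T + K' T) * (C ^ n / fact n)) * ((t ^ Suc n - 0 ^ Suc n) / Suc n)"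
      using Suc.prems(1) by (simp only: integral_mult_right_zero integral_power)
    also have "\<dots> = D (Suc n) t"
      by (simp add: D_def mult_ac)
    finally show ?case .
  qed
  have eq: "(\<integral>x. g x \<partial>m T) = (\<integral>x. g x \<partial>m' T)"
    if g: "g \<in> borel_measurable borel" "\<And>x. \<bar>g x\<bar> \<le> 1" for g :: "real \<Rightarrow> real"
  proof -
    have "(\<lambda>n. (C * T) ^ n / fact n) \<longlonglongrightarrow> 0"
      using summable_LIMSEQ_zero[OF summable_exp[of "C * T"]] by (simp add: divide_inverse mult.commute)
    then have "(\<lambda>n. D n T) \<longlonglongrightarrow> (K T + K' T) * 0"
      unfolding D_def power_mult_distrib by (intro tendsto_intros)
    then have "\<bar>(\<integral>x. g x \<partial>m T) - (\<integral>x. g x \<partial>m' T)\<bar> \<le> (K T + K' T) * 0"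
      by (rule LIMSEQ_le_const) (use bound[OF T order_refl g] in auto)
    then show ?thesis by simp
  qed
  interpret M: finite_measure "m T" by (rule m.finite_measure) fact
  interpret M': finite_measure "m' T" by (rule m'.finite_measure) fact
  show ?thesis
  proof (rule measure_eqI)
    show "sets (m T) = sets (m' T)" using m.sets_eq[OF T] m'.sets_eq[OF T] by simp
    fix A assume "A \<in> sets (m T)"
    then have A: "A \<in> sets borel" using m.sets_eq[OF T] by simp
    have "measure (m T) A = measure (m' T) A"
    proof -
      have "\<bar>indicator A x\<bar> \<le> (1::real)" for x by (simp add: indicator_def)
      then have "(\<integral>x. indicator A x \<partial>m T) = (\<integral>x. indicator A x \<partial>m' T :: real)"
        using A by (intro eq) auto
      then show ?thesis
        using A m.sets_eq[OF T] m'.sets_eq[OF T] by (simp add: m.space_eq[OF T] m'.space_eq[OF T])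
    qed
    then show "emeasure (m T) A = emeasure (m' T) A"
      by (simp add: M.emeasure_eq_measure M'.emeasure_eq_measure)
  qed
qed


section \<open>Integrals along a path\<close>

text \<open>Rounding the time down to multiples of \<open>1/(n+1)\<close> leaves countably many random variables;
continuity of the paths removes the rounding in the limit.\<close>

lemma continuous_paths_jointly_measurable:
  fixes X :: "real \<Rightarrow> 'a \<Rightarrow> real"
  assumes X: "\<And>t. X t \<in> borel_measurable F"
    and cont: "\<And>z. z \<in> space F \<Longrightarrow> continuous_on UNIV (\<lambda>t. X t z)"
  shows "(\<lambda>p. X (fst p) (snd p)) \<in> borel_measurable (borel \<Otimes>\<^sub>M F)"
proof (rule borel_measurable_LIMSEQ_real)
  let ?X = "\<lambda>n p. X (real_of_int \<lfloor>real (Suc n) * fst p\<rfloor> / real (Suc n)) (snd p)"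
  show "?X n \<in> borel_measurable (borel \<Otimes>\<^sub>M F)" for n
  proof (rule measurable_compose_countable[where g="\<lambda>p. \<lfloor>real (Suc n) * fst p\<rfloor>"
        and f="\<lambda>i p. X (real_of_int i / real (Suc n)) (snd p)"])
    show "(\<lambda>p. X (real_of_int i / real (Suc n)) (snd p)) \<in> borel_measurable (borel \<Otimes>\<^sub>M F)" for i
      by (rule measurable_compose[OF measurable_snd X])
  qed measurable
  fix p :: "real \<times> 'a" assume "p \<in> space (borel \<Otimes>\<^sub>M F)"
  then have z: "snd p \<in> space F" by (auto simp: space_pair_measure)
  have lim: "(\<lambda>n. real_of_int \<lfloor>real (Suc n) * fst p\<rfloor> / real (Suc n)) \<longlonglongrightarrow> fst p"
  proof (rule LIMSEQ_norm_0[THEN LIM_zero_cancel])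
    fix n
    have "\<bar>real_of_int \<lfloor>real (Suc n) * fst p\<rfloor> - real (Suc n) * fst p\<bar> < 1" by linarith
    then have "\<bar>real_of_int \<lfloor>real (Suc n) * fst p\<rfloor> - real (Suc n) * fst p\<bar> / real (Suc n) < 1 / real (Suc n)"
      by (intro divide_strict_right_mono) auto
    moreover have "\<bar>real_of_int \<lfloor>real (Suc n) * fst p\<rfloor> - real (Suc n) * fst p\<bar> / real (Suc n) =
      \<bar>(real_of_int \<lfloor>real (Suc n) * fst p\<rfloor> - real (Suc n) * fst p) / real (Suc n)\<bar>"
      by (simp only: abs_divide abs_of_nat)
    moreover have "(real_of_int \<lfloor>real (Suc n) * fst p\<rfloor> - real (Suc n) * fst p) / real (Suc n) =
      real_of_int \<lfloor>real (Suc n) * fst p\<rfloor> / real (Suc n) - fst p"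
      unfolding diff_divide_distrib by (subst nonzero_mult_div_cancel_left) auto
    ultimately show "norm (real_of_int \<lfloor>real (Suc n) * fst p\<rfloor> / real (Suc n) - fst p) < 1 / real (Suc n)"
      by (simp only: real_norm_def)
  qed
  show "(\<lambda>n. ?X n p) \<longlonglongrightarrow> X (fst p) (snd p)"
    using continuous_on_tendsto_compose[OF cont[OF z] lim] by simp
qed

text \<open>Cutting \<open>[0,T]\<close> into \<open>n\<close> equal pieces bounds the total increment by \<open>K T\<^sup>2 / n\<close>. It serves below for a
difference of two functions which separately need not be differentiable at every time.\<close>

lemma constant_if_quadratic_increments:
  fixes h :: "real \<Rightarrow> real"
  assumes inc: "\<And>a b. 0 \<le> a \<Longrightarrow> a \<le> b \<Longrightarrow> b \<le> T \<Longrightarrow> \<bar>h b - h a\<bar> \<le> K * (b - a)\<^sup>2" and T: "0 \<le> T"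
  shows "h T = h 0"
proof -
  have bound: "\<bar>h T - h 0\<bar> \<le> K * T\<^sup>2 / real (Suc n)" for n
  proof -
    let ?p = "\<lambda>i. real i * T / real (Suc n)"
    have "h T - h 0 = (\<Sum>i<Suc n. h (?p (Suc i)) - h (?p i))"
      by (subst sum_lessThan_telescope) simp
    also have "\<bar>\<dots>\<bar> \<le> (\<Sum>i<Suc n. \<bar>h (?p (Suc i)) - h (?p i)\<bar>)" by (rule sum_abs)
    also have "\<dots> \<le> (\<Sum>i<Suc n. K * (T / real (Suc n))\<^sup>2)"
    proof (rule sum_mono)
      fix i assume i: "i \<in> {..<Suc n}"
      have d: "?p (Suc i) - ?p i = T / real (Suc n)"
        by (simp add: distrib_right add_divide_distrib)
      have "real (Suc i) * T \<le> real (Suc n) * T"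
        using i T by (intro mult_right_mono) auto
      then have "?p (Suc i) \<le> T" by (simp add: field_simps)
      moreover have "0 \<le> ?p i" using T by simp
      moreover have "?p i \<le> ?p (Suc i)" using T by (intro divide_right_mono mult_right_mono) auto
      ultimately show "\<bar>h (?p (Suc i)) - h (?p i)\<bar> \<le> K * (T / real (Suc n))\<^sup>2"
        using inc[of "?p i" "?p (Suc i)"] d by simp
    qed
    also have "\<dots> = K * T\<^sup>2 / real (Suc n)"
      by (simp add: power2_eq_square)
    finally show ?thesis .
  qed
  have "(\<lambda>n. K * T\<^sup>2 / real (Suc n)) \<longlonglongrightarrow> 0"
    using LIMSEQ_Suc[OF lim_const_over_n] .
  then have "\<bar>h T - h 0\<bar> \<le> 0"
    by (rule LIMSEQ_le_const) (use bound in auto)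
  then show ?thesis by simp
qed

lemma exp_diff_eq_MVT:
  fixes x y :: real
  obtains \<xi> where "min x y \<le> \<xi>" "\<xi> \<le> max x y" "exp y - exp x = exp \<xi> * (y - x)"
proof (cases x y rule: linorder_cases)
  case less
  then obtain z where "z > x" "z < y" "exp y - exp x = (y - x) * exp z"
    using MVT2[of x y exp exp] by (auto intro: DERIV_exp)
  then show ?thesis by (intro that[of z]) auto
next
  case equal
  then show ?thesis by (intro that[of x]) auto
next
  case greater
  then obtain z where "z > y" "z < x" "exp x - exp y = (x - y) * exp z"
    using MVT2[of y x exp exp] by (auto intro: DERIV_exp)
  then show ?thesis by (intro that[of z]) (auto simp: algebra_simps)
qed

lemma bounded_set_integrable:
  fixes g :: "real \<Rightarrow> real"
  assumes "g \<in> borel_measurable borel" "\<And>s. a \<le> s \<Longrightarrow> s \<le> b \<Longrightarrow> \<bar>g s\<bar> \<le> L"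
  shows "set_integrable lborel {a..b} g"
  unfolding set_integrable_def
proof (rule Bochner_Integration.integrable_bound)
  show "integrable lborel (\<lambda>s. indicator {a..b} s * L)"
    using integrable_mult_left[OF integrable_real_indicator[of "{a..b}" lborel], of L]
    by (simp add: emeasure_lborel_Icc_eq)
  show "(\<lambda>x. indicat_real {a..b} x *\<^sub>R g x) \<in> borel_measurable lborel"
    using assms(1) by measurable
  show "AE x in lborel. norm (indicat_real {a..b} x *\<^sub>R g x) \<le> norm (indicator {a..b} x * L)"
  proof (intro AE_I2)
    fix x show "norm (indicat_real {a..b} x *\<^sub>R g x) \<le> norm (indicator {a..b} x * L)"
      using assms(2)[of x] by (cases "x \<in> {a..b}") auto
  qed
qed

lemma abs_set_integral_le:
  fixes g :: "real \<Rightarrow> real"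
  assumes "a \<le> b" and bd: "\<And>s. a \<le> s \<Longrightarrow> s \<le> b \<Longrightarrow> \<bar>g s\<bar> \<le> L"
  shows "\<bar>LINT s:{a..b}|lborel. g s\<bar> \<le> L * (b - a)"
proof -
  have "0 \<le> \<bar>g a\<bar>" by simp
  then have L: "0 \<le> L" using bd[of a] assms(1) by linarith
  have "\<bar>LINT s:{a..b}|lborel. g s\<bar> \<le> (\<integral>s. \<bar>indicator {a..b} s * g s\<bar> \<partial>lborel)"
    unfolding set_lebesgue_integral_def real_scaleR_def by (rule integral_abs_bound)
  also have "\<dots> \<le> (\<integral>s. indicator {a..b} s * L \<partial>lborel)"
  proof (cases "integrable lborel (\<lambda>s. \<bar>indicator {a..b} s * g s\<bar>)")
    case True
    then show ?thesis
    proof (rule integral_mono)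
      show "integrable lborel (\<lambda>s. indicator {a..b} s * L)"
        using integrable_mult_left[OF integrable_real_indicator[of "{a..b}" lborel], of L]
        by (simp add: emeasure_lborel_Icc_eq)
      show "\<bar>indicator {a..b} s * g s\<bar> \<le> indicator {a..b} s * L" for s
        using bd[of s] by (auto simp: indicator_def)
    qed
  next
    case False
    then show ?thesis using L by (simp add: not_integrable_integral_eq)
  qed
  also have "\<dots> = L * (b - a)" using assms(1) by simp
  finally show ?thesis .
qed

lemma set_integral_split:
  fixes g :: "real \<Rightarrow> real"
  assumes "set_integrable lborel {0..b} g" "0 \<le> a" "a \<le> b"
  shows "(LINT s:{0..b}|lborel. g s) = (LINT s:{0..a}|lborel. g s) + (LINT s:{a..b}|lborel. g s)"
proof -
  have i: "set_integrable lborel {0..a} g" "set_integrable lborel {a..b} g"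
    by (rule set_integrable_subset[OF assms(1)]; use assms in auto)+
  have "(LINT s:{0..a} \<union> {a..b}|lborel. g s) = (LINT s:{0..a}|lborel. g s) + (LINT s:{a..b}|lborel. g s)"
  proof (rule set_integral_Un_AE)
    show "AE x in lborel. \<not> (x \<in> {0..a} \<and> x \<in> {a..b})"
      using AE_lborel_singleton[of a] by eventually_elim auto
  qed (use i in auto)
  moreover have "{0..a} \<union> {a..b} = {0..b}" using assms by auto
  ultimately show ?thesis by simp
qed

lemma set_integral_Lipschitz:
  fixes g :: "real \<Rightarrow> real"
  assumes g: "g \<in> borel_measurable borel" "\<And>s. 0 \<le> s \<Longrightarrow> \<bar>g s\<bar> \<le> L" and ab: "0 \<le> a" "a \<le> b"
  shows "\<bar>(LINT s:{0..b}|lborel. g s) - (LINT s:{0..a}|lborel. g s)\<bar> \<le> L * (b - a)"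
proof -
  have "(LINT s:{0..b}|lborel. g s) = (LINT s:{0..a}|lborel. g s) + (LINT s:{a..b}|lborel. g s)"
    by (rule set_integral_split[OF bounded_set_integrable[OF g(1)] ab]) (use g(2) in auto)
  then show ?thesis
    using abs_set_integral_le[OF ab(2), of g L] g(2) ab by simp
qed

text \<open>The chain rule for an indefinite integral of a function that is only measurable and bounded. By the mean value
theorem both sides have the same increments up to an error quadratic in the length of the interval.\<close>

lemma exp_indefinite_integral:
  fixes g :: "real \<Rightarrow> real"
  assumes g[measurable]: "g \<in> borel_measurable borel" and L: "\<And>s. 0 \<le> s \<Longrightarrow> \<bar>g s\<bar> \<le> L" and T: "0 \<le> T"
    and Cm: "(\<lambda>t. LINT s:{0..t}|lborel. g s) \<in> borel_measurable borel"
  shows "exp (LINT s:{0..T}|lborel. g s) =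
    1 + (LINT s:{0..T}|lborel. g s * exp (LINT r:{0..s}|lborel. g r))"
proof -
  define C where "C t = (LINT s:{0..t}|lborel. g s)" for t
  have [measurable]: "C \<in> borel_measurable borel" using Cm unfolding C_def[abs_def] .
  have "0 \<le> \<bar>g 0\<bar>" by simp
  then have L0: "0 \<le> L" using L[of 0] by linarith
  have C0: "C 0 = 0" using abs_set_integral_le[of 0 0 g L] L by (simp add: C_def)
  have lip: "\<bar>C b - C a\<bar> \<le> L * (b - a)" if "0 \<le> a" "a \<le> b" for a b
    unfolding C_def using g L that by (rule set_integral_Lipschitz)
  have CT: "\<bar>C s\<bar> \<le> L * T" if "0 \<le> s" "s \<le> T" for s
  proof -
    have "L * (s - 0) \<le> L * T" using that L0 by (intro mult_left_mono) auto
    then show ?thesis using lip[of 0 s] that C0 by simp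
  qed
  have exp_lip: "\<bar>exp y - exp x\<bar> \<le> exp (L * T) * \<bar>y - x\<bar>" if "x \<le> L * T" "y \<le> L * T" for x y
  proof -
    obtain \<xi> where "\<xi> \<le> max x y" "exp y - exp x = exp \<xi> * (y - x)" by (rule exp_diff_eq_MVT)
    then show ?thesis using that by (simp add: abs_mult mult_right_mono)
  qed
  let ?h = "\<lambda>s. g s * exp (C s)"
  have h_bound: "\<bar>?h s\<bar> \<le> L * exp (L * T)" if "0 \<le> s" "s \<le> T" for s
    unfolding abs_mult using L[OF that(1)] CT[OF that] by (intro mult_mono) auto
  have h_int: "set_integrable lborel {0..b} ?h" if "b \<le> T" for b
    by (rule bounded_set_integrable[where L="L * exp (L * T)"]) (use h_bound that in auto)
  have "exp (C T) - (LINT s:{0..T}|lborel. ?h s) = exp (C 0) - (LINT s:{0..0}|lborel. ?h s)"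
  proof (rule constant_if_quadratic_increments[where h="\<lambda>t. exp (C t) - (LINT s:{0..t}|lborel. ?h s)"])
    fix a b assume ab: "0 \<le> a" "a \<le> b" "b \<le> T"
    obtain \<xi> where \<xi>: "min (C a) (C b) \<le> \<xi>" "\<xi> \<le> max (C a) (C b)" "exp (C b) - exp (C a) = exp \<xi> * (C b - C a)"
      by (rule exp_diff_eq_MVT)
    have gi: "set_integrable lborel {a..b} g"
      by (rule bounded_set_integrable[OF g, where L=L]) (use L ab in auto)
    have hi: "set_integrable lborel {a..b} ?h"
      by (rule bounded_set_integrable[where L="L * exp (L * T)"]) (use h_bound ab in auto)
    have "C b - C a = (LINT s:{a..b}|lborel. g s)"
    proof -
      have "set_integrable lborel {0..b} g"
        by (rule bounded_set_integrable[OF g, where L=L]) (use L in auto)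
      then show ?thesis unfolding C_def using set_integral_split[of b g a] ab by simp
    qed
    then have "(exp (C b) - (LINT s:{0..b}|lborel. ?h s)) - (exp (C a) - (LINT s:{0..a}|lborel. ?h s)) =
      exp \<xi> * (LINT s:{a..b}|lborel. g s) - (LINT s:{a..b}|lborel. ?h s)"
      using \<xi>(3) set_integral_split[OF h_int[OF ab(3)] ab(1,2)] by simp
    also have "\<dots> = (LINT s:{a..b}|lborel. exp \<xi> * g s - ?h s)"
      using gi hi by simp
    finally have eq: "(exp (C b) - (LINT s:{0..b}|lborel. ?h s)) - (exp (C a) - (LINT s:{0..a}|lborel. ?h s)) =
      (LINT s:{a..b}|lborel. exp \<xi> * g s - ?h s)" .
    have "\<bar>LINT s:{a..b}|lborel. exp \<xi> * g s - ?h s\<bar> \<le> (L * (exp (L * T) * (L * (b - a)))) * (b - a)"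
    proof (rule abs_set_integral_le[OF ab(2)])
      fix s assume s: "a \<le> s" "s \<le> b"
      have "C a \<le> L * T" "C b \<le> L * T" "C s \<le> L * T"
        using CT[of a] CT[of b] CT[of s] ab s by auto
      moreover have "\<bar>\<xi> - C s\<bar> \<le> L * (b - a)"
      proof -
        have "L * (s - a) \<le> L * (b - a)" "L * (b - s) \<le> L * (b - a)"
          using s L0 by (intro mult_left_mono; simp)+
        then show ?thesis using \<xi>(1,2) lip[of a s] lip[of s b] ab s by linarith
      qed
      ultimately have "\<bar>exp \<xi> - exp (C s)\<bar> \<le> exp (L * T) * (L * (b - a))"
        using exp_lip[of "C s" \<xi>] \<xi>(2) by (smt (verit) mult_left_mono exp_ge_zero)
      then have "\<bar>g s\<bar> * \<bar>exp \<xi> - exp (C s)\<bar> \<le> L * (exp (L * T) * (L * (b - a)))"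
        using L[of s] ab s by (intro mult_mono) auto
      moreover have "exp \<xi> * g s - ?h s = g s * (exp \<xi> - exp (C s))" by (simp add: algebra_simps)
      ultimately show "\<bar>exp \<xi> * g s - ?h s\<bar> \<le> L * (exp (L * T) * (L * (b - a)))"
        by (simp only: abs_mult)
    qed
    then show "\<bar>(exp (C b) - (LINT s:{0..b}|lborel. ?h s)) - (exp (C a) - (LINT s:{0..a}|lborel. ?h s))\<bar>
        \<le> (L * exp (L * T) * L) * (b - a)\<^sup>2"
      unfolding eq by (simp add: power2_eq_square mult_ac)
  qed (rule T)
  moreover have "(LINT s:{0..0}|lborel. ?h s) = 0"
    using abs_set_integral_le[of 0 0 ?h "L * exp (L * T)"] h_bound T by simp
  ultimately show ?thesis using C0 by (simp add: C_def)
qed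


section \<open>Brownian motion: independence of the past and an increment\<close>

locale brownian = prob_space M for M :: "'a measure" +
  fixes W :: "real \<Rightarrow> 'a \<Rightarrow> real"
  assumes brownian: "brownian_motion M W"
begin

lemma W_measurable: "0 \<le> t \<Longrightarrow> W t \<in> borel_measurable M"
  using brownian unfolding brownian_motion_def by blast

lemma W_continuous: "z \<in> space M \<Longrightarrow> continuous_on {0..} (\<lambda>t. W t z)"
  using brownian unfolding brownian_motion_def by blast

lemma increment_normal:
  "0 \<le> s \<Longrightarrow> s < t \<Longrightarrow> distributed M lborel (\<lambda>z. W t z - W s z)
     (\<lambda>x. ennreal (normal_density 0 (sqrt (t - s)) x))"
  using brownian unfolding brownian_motion_def by blast

text \<open>The family whose independence the definition of Brownian motion postulates: index 0 carries the
initial value of the grid.\<close>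

definition grid_increment :: "(nat \<Rightarrow> real) \<Rightarrow> nat \<Rightarrow> 'a \<Rightarrow> real" where
  "grid_increment ts i z = (if i = 0 then W (ts 0) z else W (ts i) z - W (ts (i - 1)) z)"

lemma indep_grid_increment:
  assumes "0 \<le> ts 0" "strict_mono ts"
  shows "indep_var (Pi\<^sub>M {..n} (\<lambda>_. borel)) (\<lambda>z. \<lambda>i\<in>{..n}. grid_increment ts i z)
    (Pi\<^sub>M {Suc n} (\<lambda>_. borel)) (\<lambda>z. \<lambda>i\<in>{Suc n}. grid_increment ts i z)"
proof -
  have "indep_vars (\<lambda>_. borel) (grid_increment ts) {..Suc n}"
    using brownian assms unfolding brownian_motion_def grid_increment_def by blast
  then show ?thesis by (rule indep_var_restrict) auto
qed

lemma indep_initial_increment: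
  assumes "0 < t"
  shows "indep_var borel (W 0) borel (\<lambda>z. W t z - W 0 z)"
proof -
  let ?ts = "\<lambda>i::nat. real i * t"
  have "strict_mono ?ts" using assms by (auto simp: strict_mono_def)
  then have "indep_var borel ((\<lambda>x. x 0) \<circ> (\<lambda>z. \<lambda>i\<in>{..0}. grid_increment ?ts i z))
     borel ((\<lambda>x. x (Suc 0)) \<circ> (\<lambda>z. \<lambda>i\<in>{Suc 0}. grid_increment ?ts i z))"
    by (intro indep_var_compose[OF indep_grid_increment]) auto
  then show ?thesis by (simp add: comp_def grid_increment_def)
qed

text \<open>The history up to time \<open>s\<close> observed at the dyadic subdivision of level \<open>N\<close>. These
sigma-algebras increase with \<open>N\<close>, so their union is stable under intersections, and by continuity of the
paths it generates the whole history.\<close>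

definition dyadic_past :: "real \<Rightarrow> nat \<Rightarrow> 'a measure" where
  "dyadic_past s N = sigma (space M)
     {W (s * real i / 2 ^ N) -` B \<inter> space M | i B. i \<le> 2 ^ N \<and> B \<in> sets borel}"

lemma space_dyadic_past [simp]: "space (dyadic_past s N) = space M"
  unfolding dyadic_past_def by (rule space_measure_of) auto

lemma sets_dyadic_past: "sets (dyadic_past s N) = sigma_sets (space M)
    {W (s * real i / 2 ^ N) -` B \<inter> space M | i B. i \<le> 2 ^ N \<and> B \<in> sets borel}"
  unfolding dyadic_past_def by (rule sets_measure_of) auto

lemma sets_dyadic_past_subset:
  assumes "space F = space M" "\<And>i. i \<le> 2 ^ N \<Longrightarrow> W (s * real i / 2 ^ N) \<in> borel_measurable F"
  shows "sets (dyadic_past s N) \<subseteq> sets F"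
  unfolding sets_dyadic_past
proof (rule sets.sigma_sets_subset[of _ F, unfolded assms(1)])
  show "{W (s * real i / 2 ^ N) -` B \<inter> space M | i B. i \<le> 2 ^ N \<and> B \<in> sets borel} \<subseteq> sets F"
    using measurable_sets[OF assms(2)] assms(1) by auto
qed

lemma measurable_dyadic_past: "i \<le> 2 ^ N \<Longrightarrow> W (s * real i / 2 ^ N) \<in> borel_measurable (dyadic_past s N)"
  by (rule measurableI) (auto simp: sets_dyadic_past intro!: sigma_sets.Basic)

lemma dyadic_past_mono:
  assumes "N \<le> N'" shows "sets (dyadic_past s N) \<subseteq> sets (dyadic_past s N')"
proof (rule sets_dyadic_past_subset)
  fix i :: nat assume i: "i \<le> 2 ^ N"
  have eq: "(2::nat) ^ N' = 2 ^ N * 2 ^ (N' - N)" using assms by (simp flip: power_add)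
  have "(2::real) ^ N' = 2 ^ N * 2 ^ (N' - N)" using assms by (simp flip: power_add)
  then have "s * real (i * 2 ^ (N' - N)) / 2 ^ N' = s * real i / 2 ^ N" by simp
  moreover have "i * 2 ^ (N' - N) \<le> 2 ^ N'" unfolding eq using i by (rule mult_right_mono) simp
  ultimately show "W (s * real i / 2 ^ N) \<in> borel_measurable (dyadic_past s N')"
    using measurable_dyadic_past[of "i * 2 ^ (N' - N)" N' s] by simp
qed simp

text \<open>On a grid through the dyadic points of \<open>[0,s]\<close> followed by \<open>t\<close>, the observed history is a
function of the increments up to \<open>s\<close>, while \<open>W\<^sub>t - W\<^sub>s\<close> is the next increment.\<close>

lemma indep_dyadic_past:
  assumes st: "0 < s" "s < t" and E: "E \<in> sets (dyadic_past s N)" and D: "D \<in> sets borel"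
  shows "E \<in> events"
    and "prob (E \<inter> ((\<lambda>z. W t z - W s z) -` D \<inter> space M)) =
      prob E * prob ((\<lambda>z. W t z - W s z) -` D \<inter> space M)"
proof -
  let ?n = "2 ^ N :: nat"
  (* Beyond t the grid continues in unit steps, only to be strictly increasing on all naturals. *)
  define ts :: "nat \<Rightarrow> real" where "ts i = (if i \<le> ?n then s * real i / 2 ^ N else t + (real i - real (Suc ?n)))" for i :: nat
  define Y where "Y = grid_increment ts"
  have ts: "ts 0 = 0" "ts ?n = s" "ts (Suc ?n) = t" by (auto simp: ts_def)
  have "ts i < ts (Suc i)" for i
  proof -
    consider "Suc i \<le> ?n" | "i = ?n" | "?n < i" by linarith
    then show ?thesis
    proof cases
      case 1
      then show ?thesis using st by (simp add: ts_def divide_strict_right_mono)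
    next
      case 2
      then show ?thesis using st ts by simp
    next
      case 3
      then show ?thesis by (simp add: ts_def)
    qed
  qed
  then have mono: "strict_mono ts" by (simp add: strict_mono_Suc_iff)
  have ind: "indep_var (Pi\<^sub>M {..?n} (\<lambda>_. borel)) (\<lambda>z. \<lambda>i\<in>{..?n}. Y i z)
    (Pi\<^sub>M {Suc ?n} (\<lambda>_. borel)) (\<lambda>z. \<lambda>i\<in>{Suc ?n}. Y i z)"
    using indep_grid_increment[of ts ?n, OF _ mono] unfolding Y_def by (simp add: ts)
  then have Ym: "(\<lambda>z. \<lambda>i\<in>{..?n}. Y i z) \<in> M \<rightarrow>\<^sub>M Pi\<^sub>M {..?n} (\<lambda>_. borel)"
    unfolding indep_var_eq by simp
  define F where "F = vimage_algebra (space M) (\<lambda>z. \<lambda>i\<in>{..?n}. Y i z) (Pi\<^sub>M {..?n} (\<lambda>_. borel))"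
  have YF: "Y i \<in> borel_measurable F" if "i \<le> ?n" for i
  proof -
    have "(\<lambda>z. (\<lambda>i\<in>{..?n}. Y i z) i) \<in> borel_measurable F"
      unfolding F_def
      by (rule measurable_compose[OF measurable_vimage_algebra1 measurable_component_singleton])
         (use that in \<open>auto simp: space_PiM split: if_splits\<close>)
    then show ?thesis using that by simp
  qed
  have sum: "W (ts i) z = (\<Sum>j\<in>{..i}. Y j z)" for i :: nat and z
    by (induction i) (auto simp: Y_def grid_increment_def)
  have "sets (dyadic_past s N) \<subseteq> sets F"
  proof (rule sets_dyadic_past_subset)
    show "space F = space M" by (simp add: F_def)
    fix i :: nat assume i: "i \<le> 2 ^ N"
    have "(\<lambda>z. \<Sum>j\<le>i. Y j z) \<in> borel_measurable F"
      using i by (intro borel_measurable_sum YF) auto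
    then have "W (ts i) \<in> borel_measurable F" by (simp add: sum[abs_def, symmetric])
    then show "W (s * real i / 2 ^ N) \<in> borel_measurable F" using i by (simp add: ts_def)
  qed
  then obtain A where A: "A \<in> sets (Pi\<^sub>M {..?n} (\<lambda>_. borel))"
      "E = (\<lambda>z. \<lambda>i\<in>{..?n}. Y i z) -` A \<inter> space M"
    using E unfolding F_def by (subst (asm) sets_vimage_algebra2) (auto simp: space_PiM)
  show "E \<in> events" using A Ym by auto
  define D' where "D' = (\<lambda>x. x (Suc ?n)) -` D \<inter> space (Pi\<^sub>M {Suc ?n} (\<lambda>_. borel :: real measure))"
  have D': "D' \<in> sets (Pi\<^sub>M {Suc ?n} (\<lambda>_. borel))"
    unfolding D'_def by (rule measurable_sets[OF _ D]) (rule measurable_component_singleton, simp)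
  have eq: "(\<lambda>z. W t z - W s z) -` D \<inter> space M = (\<lambda>z. \<lambda>i\<in>{Suc ?n}. Y i z) -` D' \<inter> space M"
    by (auto simp: D'_def space_PiM Y_def grid_increment_def ts)
  have "indep_set
      (sigma_sets (space M) {(\<lambda>z. \<lambda>i\<in>{..?n}. Y i z) -` A \<inter> space M |A. A \<in> sets (Pi\<^sub>M {..?n} (\<lambda>_. borel))})
      (sigma_sets (space M) {(\<lambda>z. \<lambda>i\<in>{Suc ?n}. Y i z) -` A \<inter> space M |A. A \<in> sets (Pi\<^sub>M {Suc ?n} (\<lambda>_. borel))})"
    using ind unfolding indep_var_eq by simp
  then show "prob (E \<inter> ((\<lambda>z. W t z - W s z) -` D \<inter> space M)) =
      prob E * prob ((\<lambda>z. W t z - W s z) -` D \<inter> space M)"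
    unfolding eq by (rule indep_setD) (use A D' in \<open>auto intro!: sigma_sets.Basic\<close>)
qed

definition past :: "real \<Rightarrow> 'a measure" where
  "past s = sigma (space M) (\<Union>N. sets (dyadic_past s N))"

lemma dyadic_past_in_Pow: "(\<Union>N. sets (dyadic_past s N)) \<subseteq> Pow (space M)"
  using sets.sets_into_space[of _ "dyadic_past s _"] by auto

lemma space_past [simp]: "space (past s) = space M"
  unfolding past_def by (rule space_measure_of[OF dyadic_past_in_Pow])

lemma sets_past: "sets (past s) = sigma_sets (space M) (\<Union>N. sets (dyadic_past s N))"
  unfolding past_def by (rule sets_measure_of[OF dyadic_past_in_Pow])

lemma measurable_past:
  assumes r: "0 \<le> r" "r \<le> s" and s: "0 < s"
  shows "W r \<in> borel_measurable (past s)"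
proof (rule borel_measurable_LIMSEQ_real)
  let ?i = "\<lambda>N. nat \<lfloor>2 ^ N * (r / s)\<rfloor>"
  let ?r = "\<lambda>N. s * real (?i N) / 2 ^ N"
  show "W (?r N) \<in> borel_measurable (past s)" for N
  proof -
    have "2 ^ N * (r / s) \<le> 2 ^ N * 1" using r s by (intro mult_left_mono) auto
    then have "?i N \<le> 2 ^ N" by (simp add: nat_le_iff floor_le_iff)
    from measurable_dyadic_past[OF this, of s] show ?thesis
      by (rule measurable_from_subalg[rotated]) (auto simp: subalgebra_def sets_past)
  qed
  fix z assume "z \<in> space (past s)"
  then have z: "z \<in> space M" by simp
  have "(\<lambda>N. ?r N - r) \<longlonglongrightarrow> 0"
  proof (rule tendsto_rabs_zero_cancel, rule tendsto_sandwich[OF _ _ tendsto_const])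
    show "(\<lambda>N. s * (1/2) ^ N) \<longlonglongrightarrow> 0"
      by (rule tendsto_mult_right_zero[OF LIMSEQ_power_zero]) simp
    show "\<forall>\<^sub>F N in sequentially. \<bar>?r N - r\<bar> \<le> s * (1/2) ^ N"
    proof (intro always_eventually allI)
      fix N
      have "0 \<le> 2 ^ N * (r / s)" using r s by simp
      then have "\<bar>real (?i N) - 2 ^ N * (r / s)\<bar> \<le> 1" by linarith
      then have "(s / 2 ^ N) * \<bar>real (?i N) - 2 ^ N * (r / s)\<bar> \<le> (s / 2 ^ N) * 1"
        using s by (intro mult_left_mono) auto
      moreover have "?r N - r = (s / 2 ^ N) * (real (?i N) - 2 ^ N * (r / s))"
        using s by (simp add: field_simps)
      moreover have "\<bar>s / 2 ^ N\<bar> = s / 2 ^ N" using s by simp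
      moreover have "s * (1/2) ^ N = s / 2 ^ N * 1" by (simp add: power_one_over)
      ultimately show "\<bar>?r N - r\<bar> \<le> s * (1/2) ^ N"
        by (simp only: abs_mult)
    qed
  qed auto
  then have "?r \<longlonglongrightarrow> r" by (rule LIM_zero_cancel)
  then show "(\<lambda>N. W (?r N) z) \<longlonglongrightarrow> W r z"
    by (rule continuous_on_tendsto_compose[OF W_continuous[OF z]]) (use r s in auto)
qed

lemma past_indep_increment:
  assumes st: "0 < s" "s < t" and X: "X \<in> borel_measurable (past s)"
  shows "indep_var borel X borel (\<lambda>z. W t z - W s z)"
proof -
  let ?D = "\<lambda>z. W t z - W s z"
  let ?B = "{?D -` A \<inter> space M |A. A \<in> sets borel}"
  have Dm: "?D \<in> borel_measurable M" using W_measurable[of s] W_measurable[of t] st by auto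
  have "indep_set (sigma_sets (space M) (\<Union>N. sets (dyadic_past s N))) (sigma_sets (space M) ?B)"
  proof (rule indep_set_sigma_sets)
    show "indep_set (\<Union>N. sets (dyadic_past s N)) ?B"
    proof (rule indep_setI)
      show "(\<Union>N. sets (dyadic_past s N)) \<subseteq> events"
        using indep_dyadic_past(1)[OF st] by auto
      show "?B \<subseteq> events" using measurable_sets[OF Dm] by auto
      fix a b assume "a \<in> (\<Union>N. sets (dyadic_past s N))" "b \<in> ?B"
      then obtain N D where "a \<in> sets (dyadic_past s N)" "D \<in> sets borel" "b = ?D -` D \<inter> space M" by auto
      then show "prob (a \<inter> b) = prob a * prob b"
        using indep_dyadic_past(2)[OF st] by simp
    qed
    show "Int_stable (\<Union>N. sets (dyadic_past s N))"
    proof (rule Int_stableI)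
      fix A B assume "A \<in> (\<Union>N. sets (dyadic_past s N))" "B \<in> (\<Union>N. sets (dyadic_past s N))"
      then obtain N N' where "A \<in> sets (dyadic_past s N)" "B \<in> sets (dyadic_past s N')" by auto
      then have "A \<in> sets (dyadic_past s (max N N'))" "B \<in> sets (dyadic_past s (max N N'))"
        using dyadic_past_mono[of N "max N N'" s] dyadic_past_mono[of N' "max N N'" s] by auto
      then show "A \<inter> B \<in> (\<Union>N. sets (dyadic_past s N))" by blast
    qed
    show "Int_stable ?B"
    proof (rule Int_stableI)
      fix a b assume "a \<in> ?B" "b \<in> ?B"
      then obtain A B where "A \<in> sets borel" "B \<in> sets borel" "a = ?D -` A \<inter> space M" "b = ?D -` B \<inter> space M" by auto
      then show "a \<inter> b \<in> ?B" by (intro CollectI exI[of _ "A \<inter> B"]) auto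
    qed
  qed
  then have ind: "indep_set (sets (past s)) (sigma_sets (space M) ?B)" by (simp add: sets_past)
  have sub: "{X -` A \<inter> space M |A. A \<in> sets borel} \<subseteq> sets (past s)"
    using measurable_sets[OF X] by auto
  have gen: "sigma_sets (space M) {X -` A \<inter> space M |A. A \<in> sets borel} \<subseteq> sets (past s)"
    using sets.sigma_sets_subset[OF sub] by simp
  have Xm: "X \<in> borel_measurable M"
  proof (rule measurableI)
    fix A :: "real set" assume "A \<in> sets borel"
    then have "X -` A \<inter> space M \<in> sets (past s)" using sub by auto
    then show "X -` A \<inter> space M \<in> events" using indep_setD_ev1[OF ind] by auto
  qed simp
  show ?thesis
    unfolding indep_var_eq using Xm Dm ind gen
    by (auto simp: indep_sets2_eq)
qed

lemma increment_cos_sin: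
  assumes "0 \<le> s" "s < t"
  shows "expectation (\<lambda>z. cos (\<theta> * (W t z - W s z))) = exp (- (\<theta>\<^sup>2 * (t - s) / 2))"
    and "expectation (\<lambda>z. sin (\<theta> * (W t z - W s z))) = 0"
proof -
  let ?\<sigma> = "sqrt (t - s)"
  have \<sigma>: "0 < ?\<sigma>" using assms by simp
  have d: "distributed M lborel (\<lambda>z. (W t z - W s z - 0) / ?\<sigma>) std_normal_density"
    using increment_normal[OF assms] normal_standard_normal_convert[OF \<sigma>] by simp
  have E: "expectation (\<lambda>z. h (W t z - W s z)) = (\<integral>x. h (?\<sigma> * x) \<partial>std_normal_distribution)"
    if [measurable]: "h \<in> borel_measurable borel" for h :: "real \<Rightarrow> real"
  proof -
    have "(\<integral>x. h (?\<sigma> * x) \<partial>std_normal_distribution) = (\<integral>x. std_normal_density x * h (?\<sigma> * x) \<partial>lborel)"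
      by (subst integral_density) auto
    also have "\<dots> = expectation (\<lambda>z. h (?\<sigma> * ((W t z - W s z - 0) / ?\<sigma>)))"
      by (rule distributed_integral[OF d]) auto
    also have "\<dots> = expectation (\<lambda>z. h (W t z - W s z))"
      using \<sigma> by simp
    finally show ?thesis by simp
  qed
  show "expectation (\<lambda>z. cos (\<theta> * (W t z - W s z))) = exp (- (\<theta>\<^sup>2 * (t - s) / 2))"
    using E[of "\<lambda>y. cos (\<theta> * y)"] std_normal_cos[of "\<theta> * ?\<sigma>"] assms
    by (simp add: power_mult_distrib mult.assoc)
  show "expectation (\<lambda>z. sin (\<theta> * (W t z - W s z))) = 0"
    using E[of "\<lambda>y. sin (\<theta> * y)"] std_normal_sin[of "\<theta> * ?\<sigma>"]
    by (simp add: mult.assoc)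
qed

text \<open>The Markov property for cosines: in the addition formula for \<open>W\<^sub>t = W\<^sub>s + (W\<^sub>t - W\<^sub>s)\<close> the sine of
the increment has mean zero and its cosine has mean \<open>exp(- \<theta>\<^sup>2 (t - s) / 2)\<close>.\<close>

lemma cos_increment_expectation:
  assumes st: "0 \<le> s" "s < t" and B: "\<And>z. \<bar>Z z\<bar> \<le> B"
    and ind: "\<And>h. h \<in> borel_measurable borel \<Longrightarrow>
      indep_var borel (\<lambda>z. h (W s z) * Z z) borel (\<lambda>z. W t z - W s z)"
  shows "expectation (\<lambda>z. cos (\<theta> * W t z + \<alpha>) * Z z) =
    exp (- (\<theta>\<^sup>2 * (t - s) / 2)) * expectation (\<lambda>z. cos (\<theta> * W s z + \<alpha>) * Z z)"
proof -
  let ?D = "\<lambda>z. W t z - W s z"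
  have Dm: "?D \<in> borel_measurable M" using W_measurable[of s] W_measurable[of t] st by auto
  have E: "expectation (\<lambda>z. (h (W s z) * Z z) * k (?D z)) =
      expectation (\<lambda>z. h (W s z) * Z z) * expectation (\<lambda>z. k (?D z))"
    and I: "integrable M (\<lambda>z. (h (W s z) * Z z) * k (?D z))"
    if [measurable]: "h \<in> borel_measurable borel" "k \<in> borel_measurable borel"
      and b: "\<And>x. \<bar>h x\<bar> \<le> 1" "\<And>x. \<bar>k x\<bar> \<le> 1" for h k :: "real \<Rightarrow> real"
  proof -
    have i: "indep_var borel ((\<lambda>x. x) \<circ> (\<lambda>z. h (W s z) * Z z)) borel (k \<circ> ?D)"
      by (rule indep_var_compose[OF ind]) auto
    then have i': "indep_var borel (\<lambda>z. h (W s z) * Z z) borel (\<lambda>z. k (?D z))"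
      by (simp add: comp_def)
    then have m: "(\<lambda>z. h (W s z) * Z z) \<in> borel_measurable M" "(\<lambda>z. k (?D z)) \<in> borel_measurable M"
      unfolding indep_var_eq by auto
    have hz: "\<bar>h (W s z) * Z z\<bar> \<le> 1 * B" for z
      unfolding abs_mult using b B by (intro mult_mono) auto
    have int: "integrable M (\<lambda>z. h (W s z) * Z z)" "integrable M (\<lambda>z. k (?D z))"
      using hz b m by (auto intro!: integrable_const_bound[where B=B and f="\<lambda>z. h (W s z) * Z z"]
          integrable_const_bound[where B=1 and f="\<lambda>z. k (?D z)"])
    show "expectation (\<lambda>z. (h (W s z) * Z z) * k (?D z)) =
        expectation (\<lambda>z. h (W s z) * Z z) * expectation (\<lambda>z. k (?D z))"
      by (rule indep_var_lebesgue_integral[OF i' int])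
    show "integrable M (\<lambda>z. (h (W s z) * Z z) * k (?D z))"
      by (rule indep_var_integrable[OF i' int])
  qed
  have "cos (\<theta> * W t z + \<alpha>) * Z z =
      (cos (\<theta> * W s z + \<alpha>) * Z z) * cos (\<theta> * ?D z) - (sin (\<theta> * W s z + \<alpha>) * Z z) * sin (\<theta> * ?D z)" for z
  proof -
    have "\<theta> * W t z + \<alpha> = (\<theta> * W s z + \<alpha>) + \<theta> * ?D z" by (simp add: algebra_simps)
    then show ?thesis by (simp only: cos_add) (simp add: algebra_simps)
  qed
  then show ?thesis
    using E[of "\<lambda>x. cos (\<theta> * x + \<alpha>)" "\<lambda>x. cos (\<theta> * x)"] E[of "\<lambda>x. sin (\<theta> * x + \<alpha>)" "\<lambda>x. sin (\<theta> * x)"]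
      I[of "\<lambda>x. cos (\<theta> * x + \<alpha>)" "\<lambda>x. cos (\<theta> * x)"] I[of "\<lambda>x. sin (\<theta> * x + \<alpha>)" "\<lambda>x. sin (\<theta> * x)"]
    by (simp add: increment_cos_sin[OF st])
qed

end


section \<open>The Feynman--Kac evolution of a Brownian motion\<close>

locale feynman_kac = brownian M W for M :: "'a measure" and W +
  fixes c :: "real \<Rightarrow> real \<Rightarrow> real" and L :: real
  assumes c_joint: "(\<lambda>p. c (fst p) (snd p)) \<in> borel_measurable (borel \<Otimes>\<^sub>M borel)"
    and c_le: "\<bar>c s x\<bar> \<le> L"
begin

definition action :: "real \<Rightarrow> 'a \<Rightarrow> real" where
  "action t z = (LINT s:{0..t}|lborel. c s (W s z))"

lemma L_nonneg: "0 \<le> L"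
  using c_le[of 0 0] by linarith

lemma c_measurable: "c s \<in> borel_measurable borel"
  using measurable_compose[OF measurable_Pair1'[of s borel borel] c_joint] by simp

lemma paths_jointly_measurable:
  assumes "space F = space M" "\<And>r. 0 \<le> r \<Longrightarrow> r \<le> t \<Longrightarrow> W r \<in> borel_measurable F" "0 \<le> t"
  shows "(\<lambda>p. W (max 0 (min t (fst p))) (snd p)) \<in> borel_measurable (borel \<Otimes>\<^sub>M F)"
proof (rule continuous_paths_jointly_measurable[where X="\<lambda>r. W (max 0 (min t r))"])
  show "W (max 0 (min t r)) \<in> borel_measurable F" for r
    using assms by auto
  fix z assume "z \<in> space F"
  then have "z \<in> space M" using assms by simp
  then show "continuous_on UNIV (\<lambda>r. W (max 0 (min t r)) z)"
    by (intro continuous_on_compose2[OF W_continuous] continuous_intros) auto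
qed

text \<open>Stated for an arbitrary sigma-algebra \<open>F\<close>, because the action up to \<open>t\<close> is later needed both
as a function of the history up to \<open>t\<close> and as a function of the entire path.\<close>

lemma action_measurable:
  assumes "space F = space M" "\<And>r. 0 \<le> r \<Longrightarrow> r \<le> t \<Longrightarrow> W r \<in> borel_measurable F" "0 \<le> t"
  shows "action t \<in> borel_measurable F"
proof -
  note X = paths_jointly_measurable[OF assms]
  have swap: "(\<lambda>q. (snd q, fst q)) \<in> F \<Otimes>\<^sub>M lborel \<rightarrow>\<^sub>M borel \<Otimes>\<^sub>M F"
    by (intro measurable_Pair) auto
  have X': "(\<lambda>q. W (max 0 (min t (snd q))) (fst q)) \<in> borel_measurable (F \<Otimes>\<^sub>M lborel)"
    using measurable_compose[OF swap X] by simp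
  have "(\<lambda>q. c (snd q) (W (max 0 (min t (snd q))) (fst q))) \<in> borel_measurable (F \<Otimes>\<^sub>M lborel)"
    using measurable_compose[OF measurable_Pair[of snd _ borel, OF _ X'] c_joint] by simp
  then have "(\<lambda>q. indicator {0..t} (snd q) * c (snd q) (W (max 0 (min t (snd q))) (fst q)))
      \<in> borel_measurable (F \<Otimes>\<^sub>M lborel)"
    by measurable
  then have "(\<lambda>z. \<integral>s. indicator {0..t} s * c s (W (max 0 (min t s)) z) \<partial>lborel) \<in> borel_measurable F"
    by (intro lborel.borel_measurable_lebesgue_integral) (simp add: case_prod_unfold)
  moreover have "action t z = (\<integral>s. indicator {0..t} s * c s (W (max 0 (min t s)) z) \<partial>lborel)" for z
    unfolding action_def set_lebesgue_integral_def real_scaleR_def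
    by (intro Bochner_Integration.integral_cong) (auto simp: indicator_def min_def)
  ultimately show ?thesis by (simp add: fun_eq_iff cong: measurable_cong)
qed

lemma path_rate_measurable:
  assumes "z \<in> space M"
  shows "(\<lambda>s. c s (W (max 0 s) z)) \<in> borel_measurable borel"
proof -
  have "continuous_on UNIV (\<lambda>s. W (max 0 s) z)"
    by (intro continuous_on_compose2[OF W_continuous[OF assms]] continuous_intros) auto
  then have "(\<lambda>s. W (max 0 s) z) \<in> borel_measurable borel"
    by (rule borel_measurable_continuous_onI)
  from measurable_compose[OF measurable_Pair[OF measurable_ident this] c_joint]
  show ?thesis by simp
qed

lemma action_eq: "action t z = (LINT s:{0..t}|lborel. c s (W (max 0 s) z))"
  unfolding action_def by (intro set_lebesgue_integral_cong) auto

lemma abs_action_le: "0 \<le> t \<Longrightarrow> \<bar>action t z\<bar> \<le> L * t"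
  unfolding action_def using abs_set_integral_le[of 0 t "\<lambda>s. c s (W s z)" L] c_le by simp

lemma action_nonpos: "t \<le> 0 \<Longrightarrow> action t z = 0"
proof (cases "t = 0")
  case True
  then show ?thesis using abs_action_le[of 0 z] by simp
qed (simp add: action_def set_lebesgue_integral_def)

lemma action_Lipschitz:
  assumes "z \<in> space M" "a \<le> b"
  shows "\<bar>action b z - action a z\<bar> \<le> L * (b - a)"
proof -
  have *: "\<bar>action b z - action a z\<bar> \<le> L * (b - a)" if "0 \<le> a" "a \<le> b" for a b
    unfolding action_eq by (rule set_integral_Lipschitz[OF path_rate_measurable[OF assms(1)]]) (use c_le that in auto)
  have "action r z = action (max 0 r) z" for r
    using action_nonpos[of r z] action_nonpos[of 0 z] by (auto simp: max_def)
  then have "\<bar>action b z - action a z\<bar> \<le> L * (max 0 b - max 0 a)"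
    using *[of "max 0 a" "max 0 b"] assms(2) by (metis max.cobounded1 max.mono order_refl)
  also have "\<dots> \<le> L * (b - a)" using L_nonneg assms(2) by (intro mult_left_mono) auto
  finally show ?thesis .
qed

lemma action_continuous: "z \<in> space M \<Longrightarrow> continuous_on UNIV (\<lambda>t. action t z)"
proof (rule lipschitz_on_continuous_on[where L=L], rule lipschitz_onI)
  fix x y assume z: "z \<in> space M"
  show "dist (action x z) (action y z) \<le> L * dist x y"
    using action_Lipschitz[OF z, of x y] action_Lipschitz[OF z, of y x]
    by (cases "x \<le> y") (auto simp: dist_real_def abs_minus_commute)
qed (rule L_nonneg)

lemma action_random_variable: "action t \<in> borel_measurable M"
proof (cases "0 \<le> t")
  case True
  then show ?thesis by (intro action_measurable W_measurable) auto
next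
  case False
  then have "action t = (\<lambda>_. 0)" by (auto simp: action_nonpos)
  then show ?thesis by simp
qed

lemma action_jointly_measurable:
  "(\<lambda>p. action (fst p) (snd p)) \<in> borel_measurable (borel \<Otimes>\<^sub>M M)"
  by (rule continuous_paths_jointly_measurable[OF action_random_variable action_continuous])

lemma W_jointly_measurable:
  "(\<lambda>p. W (max 0 (fst p)) (snd p)) \<in> borel_measurable (borel \<Otimes>\<^sub>M M)"
proof (rule continuous_paths_jointly_measurable[where X="\<lambda>r. W (max 0 r)"])
  show "W (max 0 r) \<in> borel_measurable M" for r by (rule W_measurable) simp
  show "continuous_on UNIV (\<lambda>r. W (max 0 r) z)" if "z \<in> space M" for z
    by (intro continuous_on_compose2[OF W_continuous[OF that]] continuous_intros) auto
qed

lemma rate_jointly_measurable: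
  "(\<lambda>p. c (fst p) (W (max 0 (fst p)) (snd p))) \<in> borel_measurable (borel \<Otimes>\<^sub>M M)"
  using measurable_compose[OF measurable_Pair[OF measurable_fst W_jointly_measurable] c_joint] by simp

lemma exp_action_eq:
  assumes "z \<in> space M" "0 \<le> t"
  shows "exp (action t z) = 1 + (LINT s:{0..t}|lborel. c s (W s z) * exp (action s z))"
proof -
  have "exp (action t z) = 1 + (LINT s:{0..t}|lborel. c s (W (max 0 s) z) * exp (action s z))"
    unfolding action_eq
  proof (rule exp_indefinite_integral[OF path_rate_measurable[OF assms(1)] c_le assms(2)])
    show "(\<lambda>t. LINT s:{0..t}|lborel. c s (W (max 0 s) z)) \<in> borel_measurable borel"
      using borel_measurable_continuous_onI[OF action_continuous[OF assms(1)]] by (simp add: action_eq)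
  qed
  also have "(LINT s:{0..t}|lborel. c s (W (max 0 s) z) * exp (action s z)) =
     (LINT s:{0..t}|lborel. c s (W s z) * exp (action s z))"
    by (intro set_lebesgue_integral_cong) auto
  finally show ?thesis .
qed

text \<open>The Feynman--Kac measure \<open>g \<mapsto> E [g(W\<^sub>t) exp(C\<^sub>t)]\<close>, where \<open>C\<^sub>t\<close> is the action. It is not normalised:
its mass is the expected weight.\<close>

definition tilted :: "real \<Rightarrow> real measure" where
  "tilted t = distr (density M (\<lambda>z. ennreal (exp (action t z)))) borel (W t)"

lemma sets_tilted [simp]: "sets (tilted t) = sets borel"
  by (simp add: tilted_def)

lemma integral_tilted:
  fixes g :: "real \<Rightarrow> real"
  assumes "0 \<le> t" and [measurable]: "g \<in> borel_measurable borel"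
  shows "(\<integral>x. g x \<partial>tilted t) = expectation (\<lambda>z. exp (action t z) * g (W t z))"
proof -
  have [measurable]: "W t \<in> borel_measurable M" "action t \<in> borel_measurable M"
    using W_measurable[OF assms(1)] action_random_variable by auto
  show ?thesis unfolding tilted_def
    by (subst integral_distr) (auto simp: integral_density)
qed

lemma exp_action_le: "0 \<le> t \<Longrightarrow> t \<le> T \<Longrightarrow> exp (action t z) \<le> exp (L * T)"
  using abs_action_le[of t z] mult_left_mono[OF _ L_nonneg, of t T] by simp

lemma finite_measure_tilted: "0 \<le> t \<Longrightarrow> finite_measure (tilted t)"
proof -
  assume t: "0 \<le> t"
  have [measurable]: "W t \<in> borel_measurable M" "action t \<in> borel_measurable M"
    using W_measurable[OF t] action_random_variable by auto
  have "finite_measure (density M (\<lambda>z. ennreal (exp (action t z))))"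
  proof (rule finite_measureI)
    have "emeasure (density M (\<lambda>z. ennreal (exp (action t z)))) (space M) =
        (\<integral>\<^sup>+z. ennreal (exp (action t z)) * indicator (space M) z \<partial>M)"
      by (subst emeasure_density) auto
    also have "\<dots> \<le> (\<integral>\<^sup>+z. ennreal (exp (L * t)) \<partial>M)"
      using exp_action_le[OF t order_refl] by (intro nn_integral_mono) (auto simp: indicator_def)
    also have "\<dots> < \<infinity>" by (simp add: emeasure_space_1 ennreal_mult_less_top)
    finally show "emeasure (density M (\<lambda>z. ennreal (exp (action t z)))) (space (density M (\<lambda>z. ennreal (exp (action t z))))) \<noteq> \<infinity>"
      by simp
  qed
  then show ?thesis unfolding tilted_def
    by (rule finite_measure.finite_measure_distr) simp
qed

lemma measure_tilted_UNIV:
  assumes "0 \<le> t" shows "measure (tilted t) UNIV = expectation (\<lambda>z. exp (action t z))"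
proof -
  interpret finite_measure "tilted t" by (rule finite_measure_tilted) fact
  have "space (tilted t) = UNIV" by (simp add: tilted_def)
  then have "(\<integral>x. 1 \<partial>tilted t) = measure (tilted t) UNIV" by simp
  then show ?thesis using integral_tilted[OF assms, of "\<lambda>_. 1"] by simp
qed

text \<open>Multiply \<open>exp(C\<^sub>t) = 1 + \<integral>\<^sub>0\<^sup>t c(s,W\<^sub>s) exp(C\<^sub>s) ds\<close> by a cosine of \<open>W\<^sub>t\<close> and take expectations. The factor
\<open>c(s,W\<^sub>s) exp(C\<^sub>s)\<close> belongs to the past of \<open>s\<close>, so the Markov property replaces the cosine of
\<open>W\<^sub>t\<close> by a multiple of the cosine of \<open>W\<^sub>s\<close>.\<close>

theorem tilted_mild_evolution: "mild_evolution tilted c L (\<lambda>T. exp (L * T))"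
proof (rule mild_evolution.intro)
  fix t T \<theta> \<alpha> x :: real
  assume t: "0 \<le> t"
  show "finite_measure (tilted t)" by (rule finite_measure_tilted[OF t])
  show "sets (tilted t) = sets borel" by simp
  show "c t \<in> borel_measurable borel" by (rule c_measurable)
  show "\<bar>c t x\<bar> \<le> L" by (rule c_le)
  { assume tT: "t \<le> T"
    have "\<bar>expectation (\<lambda>z. exp (action t z))\<bar> \<le> exp (L * T) * prob (space M)"
      by (rule abs_integral_le) (use exp_action_le[OF t tT] in auto)
    then show "measure (tilted t) UNIV \<le> exp (L * T)"
      by (simp add: measure_tilted_UNIV[OF t] prob_space) }
  let ?\<phi> = "\<lambda>x. cos (\<theta> * x + \<alpha>)"
  let ?e = "\<lambda>s. exp (- (\<theta>\<^sup>2 * (t - s) / 2))"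
  note [measurable] = action_jointly_measurable W_jointly_measurable rate_jointly_measurable
  define H where "H s = expectation (\<lambda>z. exp (action s z) * (?\<phi> (W (max 0 s) z) * c s (W (max 0 s) z)))" for s
  have H: "(\<integral>x. ?\<phi> x * c s x \<partial>tilted s) = H s" if "0 \<le> s" for s
  proof -
    note [measurable] = c_measurable[of s]
    show ?thesis unfolding H_def using that by (subst integral_tilted) auto
  qed
  have [measurable]: "H \<in> borel_measurable borel"
    unfolding H_def[abs_def]
    by (rule borel_measurable_lebesgue_integral) (simp add: case_prod_unfold, measurable)
  have H_le: "\<bar>H s\<bar> \<le> exp (L * t) * L" if "0 \<le> s" "s \<le> t" for s
  proof -
    have "\<bar>H s\<bar> \<le> (exp (L * t) * L) * prob (space M)"
      unfolding H_def
    proof (rule abs_integral_le)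
      fix z
      have "\<bar>?\<phi> (W (max 0 s) z) * c s (W (max 0 s) z)\<bar> \<le> 1 * L"
        unfolding abs_mult using c_le by (intro mult_mono) auto
      then show "\<bar>exp (action s z) * (?\<phi> (W (max 0 s) z) * c s (W (max 0 s) z))\<bar> \<le> exp (L * t) * L"
        unfolding abs_mult[of "exp _"] using exp_action_le[OF that] by (intro mult_mono) auto
    qed
    then show ?thesis by (simp add: prob_space)
  qed
  have "set_integrable lborel {0..t} (\<lambda>s. ?e s * H s)"
  proof (rule bounded_set_integrable)
    fix s assume s: "0 \<le> s" "s \<le> t"
    show "\<bar>?e s * H s\<bar> \<le> 1 * (exp (L * t) * L)"
      unfolding abs_mult using H_le[OF s] s by (intro mult_mono) auto
  qed measurable
  then show "set_integrable lborel {0..t} (\<lambda>s. ?e s * (\<integral>x. ?\<phi> x * c s x \<partial>tilted s))"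
    by (subst set_integrable_cong[OF refl refl]) (auto simp: H)
  show "(\<integral>x. ?\<phi> x \<partial>tilted t) = exp (- (\<theta>\<^sup>2 * t / 2)) * (\<integral>x. ?\<phi> x \<partial>tilted 0) +
      (LINT s:{0..t}|lborel. ?e s * (\<integral>x. ?\<phi> x * c s x \<partial>tilted s))"
  proof (cases "t = 0")
    case True
    have "(LINT s:{0..0}|lborel. ?e s * (\<integral>x. ?\<phi> x * c s x \<partial>tilted s)) = 0"
      using abs_set_integral_le[of 0 0 "\<lambda>s. ?e s * (\<integral>x. ?\<phi> x * c s x \<partial>tilted s)" "\<bar>?e 0 * (\<integral>x. ?\<phi> x * c 0 x \<partial>tilted 0)\<bar>"]
      by simp
    then show ?thesis using True by simp
  next
    case False
    then have t0: "0 < t" using t by simp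
    note [measurable] = W_measurable[OF t] action_random_variable[of t]
    define G where "G z s = indicator {0..t} s * ((c s (W (max 0 s) z) * exp (action s z)) * ?\<phi> (W t z))" for z s
    have meas: "case_prod G \<in> borel_measurable (M \<Otimes>\<^sub>M lborel)"
    proof -
      have swap: "(\<lambda>q. (snd q, fst q)) \<in> M \<Otimes>\<^sub>M lborel \<rightarrow>\<^sub>M borel \<Otimes>\<^sub>M M"
        by (intro measurable_Pair) auto
      have [measurable]: "(\<lambda>q. c (snd q) (W (max 0 (snd q)) (fst q))) \<in> borel_measurable (M \<Otimes>\<^sub>M lborel)"
        "(\<lambda>q. action (snd q) (fst q)) \<in> borel_measurable (M \<Otimes>\<^sub>M lborel)"
        using measurable_compose[OF swap rate_jointly_measurable]
          measurable_compose[OF swap action_jointly_measurable] by auto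
      show ?thesis unfolding G_def case_prod_unfold by measurable
    qed
    interpret P: pair_sigma_finite M lborel ..
    have G_le: "\<bar>G z s\<bar> \<le> indicator {0..t} s * (L * exp (L * t))" for z s
    proof (cases "s \<in> {0..t}")
      case True
      have "\<bar>c s (W (max 0 s) z) * exp (action s z)\<bar> \<le> L * exp (L * t)"
        unfolding abs_mult using c_le exp_action_le[of s t z] True L_nonneg by (intro mult_mono) auto
      then have "\<bar>(c s (W (max 0 s) z) * exp (action s z)) * ?\<phi> (W t z)\<bar> \<le> (L * exp (L * t)) * 1"
        unfolding abs_mult[of "c s (W (max 0 s) z) * exp (action s z)"] by (intro mult_mono) (use L_nonneg in auto)
      then show ?thesis using True by (simp add: G_def)
    qed (simp add: G_def)
    have int: "integrable (M \<Otimes>\<^sub>M lborel) (case_prod G)"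
    proof (rule Bochner_Integration.integrable_bound[OF _ meas])
      have "emeasure (M \<Otimes>\<^sub>M lborel) (space M \<times> {0..t}) = emeasure M (space M) * emeasure lborel {0..t}"
        by (rule lborel.emeasure_pair_measure_Times) auto
      then have "emeasure (M \<Otimes>\<^sub>M lborel) (space M \<times> {0..t}) < \<infinity>"
        using t by (simp add: emeasure_space_1)
      then have "integrable (M \<Otimes>\<^sub>M lborel) (indicator (space M \<times> {0..t}) :: _ \<Rightarrow> real)"
        by (intro integrable_real_indicator) auto
      then show "integrable (M \<Otimes>\<^sub>M lborel) (\<lambda>q. indicator (space M \<times> {0..t}) q * (L * exp (L * t)))"
        by (rule integrable_mult_left)
      show "AE q in M \<Otimes>\<^sub>M lborel. norm (case_prod G q) \<le> norm (indicator (space M \<times> {0..t}) q * (L * exp (L * t)))"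
      proof (rule AE_I2)
        fix q :: "'a \<times> real" assume "q \<in> space (M \<Otimes>\<^sub>M lborel)"
        then have "indicator (space M \<times> {0..t}) q = (indicator {0..t} (snd q) :: real)"
          by (auto simp: space_pair_measure indicator_def)
        then show "norm (case_prod G q) \<le> norm (indicator (space M \<times> {0..t}) q * (L * exp (L * t)))"
          using G_le[of "fst q" "snd q"] L_nonneg by (auto simp: case_prod_unfold abs_mult)
      qed
    qed
    have intG: "integrable M (\<lambda>z. \<integral>s. G z s \<partial>lborel)"
      using P.integrable_fst[OF int] .
    have int\<phi>: "integrable M (\<lambda>z. ?\<phi> (W t z))"
      by (rule integrable_const_bound[where B=1]) auto
    have markov: "expectation (\<lambda>z. ?\<phi> (W t z) * Z z) = ?e s * expectation (\<lambda>z. ?\<phi> (W s z) * Z z)"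
      if "0 < s" "s < t" "Z = (\<lambda>z. c s (W s z) * exp (action s z))" for s Z
    proof (rule cos_increment_expectation)
      show "\<bar>Z z\<bar> \<le> L * exp (L * s)" for z
        unfolding that(3) abs_mult using c_le exp_action_le[of s s z] that L_nonneg by (intro mult_mono) auto
      have [measurable]: "W s \<in> borel_measurable (past s)" "action s \<in> borel_measurable (past s)"
        using that by (auto intro!: measurable_past action_measurable)
      note [measurable] = c_measurable[of s]
      show "indep_var borel (\<lambda>z. h (W s z) * Z z) borel (\<lambda>z. W t z - W s z)"
        if [measurable]: "h \<in> borel_measurable borel" for h
        by (rule past_indep_increment[OF \<open>0 < s\<close> \<open>s < t\<close>]) (unfold \<open>Z = _\<close>, measurable)
    qed (use that in auto)
    have start: "expectation (\<lambda>z. ?\<phi> (W t z) * 1) = exp (- (\<theta>\<^sup>2 * (t - 0) / 2)) * expectation (\<lambda>z. ?\<phi> (W 0 z) * 1)"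
    proof (rule cos_increment_expectation)
      show "indep_var borel (\<lambda>z. h (W 0 z) * 1) borel (\<lambda>z. W t z - W 0 z)"
        if "h \<in> borel_measurable borel" for h
        using indep_var_compose[OF indep_initial_increment[OF t0] that measurable_ident]
        by (simp add: comp_def id_def)
    qed (use t0 in auto)
    have "(\<integral>x. ?\<phi> x \<partial>tilted t) = expectation (\<lambda>z. exp (action t z) * ?\<phi> (W t z))"
      by (rule integral_tilted[OF t]) measurable
    also have "\<dots> = expectation (\<lambda>z. ?\<phi> (W t z) + (\<integral>s. G z s \<partial>lborel))"
    proof (rule Bochner_Integration.integral_cong[OF refl])
      fix z assume z: "z \<in> space M"
      have "(\<integral>s. G z s \<partial>lborel) = (\<integral>s. (indicator {0..t} s * (c s (W s z) * exp (action s z))) * ?\<phi> (W t z) \<partial>lborel)"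
        by (rule Bochner_Integration.integral_cong) (auto simp: G_def indicator_def)
      also have "\<dots> = (LINT s:{0..t}|lborel. c s (W s z) * exp (action s z)) * ?\<phi> (W t z)"
        by (simp add: set_lebesgue_integral_def)
      finally have "(\<integral>s. G z s \<partial>lborel) = (LINT s:{0..t}|lborel. c s (W s z) * exp (action s z)) * ?\<phi> (W t z)" .
      then show "exp (action t z) * ?\<phi> (W t z) = ?\<phi> (W t z) + (\<integral>s. G z s \<partial>lborel)"
        unfolding exp_action_eq[OF z t] by (simp add: distrib_right)
    qed
    also have "\<dots> = expectation (\<lambda>z. ?\<phi> (W t z)) + expectation (\<lambda>z. \<integral>s. G z s \<partial>lborel)"
      by (rule Bochner_Integration.integral_add[OF int\<phi> intG])
    also have "expectation (\<lambda>z. \<integral>s. G z s \<partial>lborel) = (\<integral>s. expectation (\<lambda>z. G z s) \<partial>lborel)"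
      by (rule P.Fubini_integral[OF int, symmetric])
    also have "\<dots> = (\<integral>s. indicator {0..t} s * (?e s * H s) \<partial>lborel)"
    proof (rule integral_cong_AE)
      show "(\<lambda>s. expectation (\<lambda>z. G z s)) \<in> borel_measurable lborel"
        using borel_measurable_integrable[OF P.integrable_snd[OF int]] .
      show "AE s in lborel. expectation (\<lambda>z. G z s) = indicator {0..t} s * (?e s * H s)"
        (* The Markov property is available strictly between the endpoints, which suffices under the time integral. *)
        using AE_lborel_singleton[of 0] AE_lborel_singleton[of t]
      proof eventually_elim
        case (elim s)
        show ?case
        proof (cases "s \<in> {0..t}")
          case True
          then have s: "0 < s" "s < t" using elim by auto
          have "expectation (\<lambda>z. G z s) = expectation (\<lambda>z. ?\<phi> (W t z) * (c s (W s z) * exp (action s z)))"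
            using s by (intro Bochner_Integration.integral_cong) (auto simp: G_def)
          also have "\<dots> = ?e s * expectation (\<lambda>z. ?\<phi> (W s z) * (c s (W s z) * exp (action s z)))"
            using markov[OF s refl] .
          also have "expectation (\<lambda>z. ?\<phi> (W s z) * (c s (W s z) * exp (action s z))) = H s"
            unfolding H_def using s by (intro Bochner_Integration.integral_cong) auto
          finally show ?thesis using True by simp
        qed (simp add: G_def)
      qed
    qed measurable
    also have "\<dots> = (LINT s:{0..t}|lborel. ?e s * (\<integral>x. ?\<phi> x * c s x \<partial>tilted s))"
      unfolding set_lebesgue_integral_def real_scaleR_def
      by (rule Bochner_Integration.integral_cong) (auto simp: indicator_def H)
    also have "expectation (\<lambda>z. ?\<phi> (W t z)) = exp (- (\<theta>\<^sup>2 * t / 2)) * (\<integral>x. ?\<phi> x \<partial>tilted 0)"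
      using start integral_tilted[of 0 ?\<phi>] by (simp add: action_nonpos)
    finally show ?thesis .
  qed
qed

end


section \<open>Weak solutions of the free boundary problem as mild evolutions\<close>

lemma shifted_weight_simps [simp]:
  "shifted_weight \<omega> x (ereal r) = \<omega> (x - r)"
  "shifted_weight \<omega> x \<infinity> = 1"
  "shifted_weight \<omega> x (-\<infinity>) = 0"
  by (simp_all add: shifted_weight_def)

lemma selection_weighting_measurable:
  assumes "selection_weighting \<omega>" shows "\<omega> \<in> borel_measurable borel"
proof -
  have "mono (\<lambda>x. - \<omega> x)"
    using assms by (auto simp: selection_weighting_def antimono_def mono_def)
  then have "(\<lambda>x. - (- \<omega> x)) \<in> borel_measurable borel"
    by (intro borel_measurable_uminus borel_measurable_mono)
  then show ?thesis by simp
qed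

lemma shifted_weight_bounds:
  assumes "selection_weighting \<omega>"
  shows "0 \<le> shifted_weight \<omega> x \<beta>" "shifted_weight \<omega> x \<beta> \<le> 1"
  using assms by (cases \<beta>; simp add: selection_weighting_def)+

lemma shifted_weight_mono:
  assumes "selection_weighting \<omega>" "\<beta> \<le> \<beta>'"
  shows "shifted_weight \<omega> x \<beta> \<le> shifted_weight \<omega> x \<beta>'"
proof (cases \<beta> \<beta>' rule: ereal2_cases)
qed (use assms in \<open>auto simp: selection_weighting_def antimono_def\<close>)

lemma shifted_weight_jointly_measurable:
  assumes "selection_weighting \<omega>"
  shows "(\<lambda>q. shifted_weight \<omega> (fst q) (snd q)) \<in> borel_measurable (borel \<Otimes>\<^sub>M borel)"
proof -
  note [measurable] = selection_weighting_measurable[OF assms]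
  have eq: "shifted_weight \<omega> x \<beta> =
      (if \<beta> = \<infinity> then 1 else if \<beta> = -\<infinity> then 0 else \<omega> (x - real_of_ereal \<beta>))" for x \<beta>
    by (cases \<beta>) auto
  show ?thesis unfolding eq by measurable
qed

lemma shifted_weight_measurable:
  assumes "selection_weighting \<omega>"
  shows "(\<lambda>x. shifted_weight \<omega> x \<beta>) \<in> borel_measurable borel"
  using measurable_compose[OF measurable_Pair2'[of \<beta> borel borel]
      shifted_weight_jointly_measurable[OF assms]] by simp

text \<open>The rate \<open>f(s) - \<Lambda> \<omega>(x - b(s))\<close> of the free boundary problem. Neither \<open>f\<close> nor \<open>b\<close> is constrained
at negative times; the value 0 there makes the rate jointly measurable on the whole plane.\<close>

definition growth_rate ::
  "(real \<Rightarrow> real) \<Rightarrow> real \<Rightarrow> (real \<Rightarrow> real) \<Rightarrow> (real \<Rightarrow> ereal) \<Rightarrow> real \<Rightarrow> real \<Rightarrow> real" where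
  "growth_rate \<omega> \<Lambda> f b s x = (if 0 \<le> s then f s - \<Lambda> * shifted_weight \<omega> x (b s) else 0)"

lemma growth_rate_jointly_measurable:
  assumes \<omega>: "selection_weighting \<omega>" and f: "continuous_on {0..} f" and b: "barrier b"
  shows "(\<lambda>p. growth_rate \<omega> \<Lambda> f b (fst p) (snd p)) \<in> borel_measurable (borel \<Otimes>\<^sub>M borel)"
proof -
  have [measurable]: "(\<lambda>s. if s \<in> {0..} then f s else 0) \<in> borel_measurable borel"
    by (rule borel_measurable_continuous_on_if) (use f in auto)
  have [measurable]: "(\<lambda>s. if s \<in> {0..} then b s else 0) \<in> borel_measurable borel"
    using b unfolding barrier_def by (subst (asm) measurable_restrict_space_iff) auto
  have [measurable]: "(\<lambda>p. shifted_weight \<omega> (snd p) (if fst p \<in> {0..} then b (fst p) else 0))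
      \<in> borel_measurable (borel \<Otimes>\<^sub>M borel)"
    using measurable_compose[OF measurable_Pair[OF measurable_snd
        measurable_compose[OF measurable_fst \<open>(\<lambda>s. if s \<in> {0..} then b s else 0) \<in> _\<close>]]
        shifted_weight_jointly_measurable[OF \<omega>]] by simp
  have eq: "growth_rate \<omega> \<Lambda> f b s x =
      (if s \<in> {0..} then (if s \<in> {0..} then f s else 0)
          - \<Lambda> * shifted_weight \<omega> x (if s \<in> {0..} then b s else 0) else 0)" for s x
    by (simp add: growth_rate_def)
  show ?thesis unfolding eq by measurable
qed

lemma growth_rate_measurable:
  assumes "selection_weighting \<omega>"
  shows "growth_rate \<omega> \<Lambda> f b s \<in> borel_measurable borel"
proof -
  have "(\<lambda>x. shifted_weight \<omega> x (b s)) \<in> borel_measurable borel"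
    by (rule shifted_weight_measurable[OF assms])
  then show ?thesis unfolding growth_rate_def[abs_def] by (cases "0 \<le> s") auto
qed

lemma abs_growth_rate_le:
  assumes "selection_weighting \<omega>" "\<And>t. 0 \<le> t \<Longrightarrow> 0 \<le> f t" "\<And>t. 0 \<le> t \<Longrightarrow> f t \<le> \<Lambda>" "0 \<le> \<Lambda>"
  shows "\<bar>growth_rate \<omega> \<Lambda> f b s x\<bar> \<le> \<Lambda>"
proof (cases "0 \<le> s")
  case True
  have "0 \<le> \<Lambda> * shifted_weight \<omega> x (b s)" "\<Lambda> * shifted_weight \<omega> x (b s) \<le> \<Lambda> * 1"
    using shifted_weight_bounds[OF assms(1)] assms(4)
    by (auto intro!: mult_nonneg_nonneg mult_left_mono simp del: mult_1_right)
  then show ?thesis using assms(2,3)[OF True] True by (simp add: growth_rate_def)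
qed (simp add: growth_rate_def assms(4))

lemma DERIV_glue:
  fixes g h :: "real \<Rightarrow> real"
  assumes g: "(g has_real_derivative D) (at a)" and h: "(h has_real_derivative D) (at a)" and eq: "g a = h a"
  shows "((\<lambda>s. if s \<le> a then g s else h s) has_real_derivative D) (at a)"
  unfolding has_field_derivative_iff
proof (rule filterlim_split_at)
  have "((\<lambda>y. (g y - g a) / (y - a)) \<longlongrightarrow> D) (at_left a)"
    using g unfolding has_field_derivative_iff by (rule tendsto_within_subset) simp
  then show "((\<lambda>y. ((if y \<le> a then g y else h y) - (if a \<le> a then g a else h a)) / (y - a)) \<longlongrightarrow> D) (at_left a)"
    by (rule Lim_transform_eventually) (auto simp: eventually_at_filter)
  have "((\<lambda>y. (h y - h a) / (y - a)) \<longlongrightarrow> D) (at_right a)"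
    using h unfolding has_field_derivative_iff by (rule tendsto_within_subset) simp
  then show "((\<lambda>y. ((if y \<le> a then g y else h y) - (if a \<le> a then g a else h a)) / (y - a)) \<longlongrightarrow> D) (at_right a)"
    by (rule Lim_transform_eventually) (auto simp: eventually_at_filter eq)
qed

text \<open>The factor \<open>exp(- \<kappa> (t - s))\<close> by which the backward heat flow scales a cosine, for \<open>s \<le> t\<close>. Its
exponential growth after \<open>t\<close> is replaced by a bounded \<open>C\<^sup>1\<close> continuation, since test functions must be
bounded for all times.\<close>

definition heat_factor :: "real \<Rightarrow> real \<Rightarrow> real \<Rightarrow> real" where
  "heat_factor \<kappa> t s = (if s \<le> t then exp (\<kappa> * (s - t)) else 2 - exp (- (\<kappa> * (s - t))))"

lemma heat_factor_derivative:
  "(heat_factor \<kappa> t has_real_derivative \<kappa> * exp (- (\<kappa> * \<bar>s - t\<bar>))) (at s)"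
proof -
  have g: "((\<lambda>s. exp (\<kappa> * (s - t))) has_real_derivative \<kappa> * exp (\<kappa> * (s - t))) (at s)" for s
    by (auto intro!: derivative_eq_intros)
  have h: "((\<lambda>s. 2 - exp (- (\<kappa> * (s - t)))) has_real_derivative \<kappa> * exp (- (\<kappa> * (s - t)))) (at s)" for s
    by (auto intro!: derivative_eq_intros)
  show ?thesis
  proof (cases s t rule: linorder_cases)
    case less
    have "(heat_factor \<kappa> t has_real_derivative \<kappa> * exp (\<kappa> * (s - t))) (at s)"
      by (rule has_field_derivative_transform_within_open[OF g, of "{..<t}"])
         (use less in \<open>auto simp: heat_factor_def\<close>)
    moreover have "- (\<kappa> * \<bar>s - t\<bar>) = \<kappa> * (s - t)" using less by (simp add: algebra_simps)
    ultimately show ?thesis by simp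
  next
    case equal
    then show ?thesis
      using DERIV_glue[of _ \<kappa> t, OF g[of t, simplified] h[of t, simplified]]
      by (simp add: heat_factor_def[abs_def])
  next
    case greater
    have "(heat_factor \<kappa> t has_real_derivative \<kappa> * exp (- (\<kappa> * (s - t)))) (at s)"
      by (rule has_field_derivative_transform_within_open[OF h, of "{t<..}"])
         (use greater in \<open>auto simp: heat_factor_def\<close>)
    then show ?thesis using greater by (simp add: abs_if)
  qed
qed

lemma abs_heat_factor_le: "0 \<le> \<kappa> \<Longrightarrow> \<bar>heat_factor \<kappa> t s\<bar> \<le> 2"
proof -
  assume \<kappa>: "0 \<le> \<kappa>"
  show ?thesis
  proof (cases "s \<le> t")
    case True
    then have "exp (\<kappa> * (s - t)) \<le> 1" using \<kappa> by (simp add: mult_nonneg_nonpos)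
    then have "exp (\<kappa> * (s - t)) \<le> 2" by linarith
    then show ?thesis using True by (simp add: heat_factor_def)
  next
    case False
    then have "exp (- (\<kappa> * (s - t))) \<le> 1" using \<kappa> by simp
    moreover have "heat_factor \<kappa> t s = 2 - exp (- (\<kappa> * (s - t)))" using False by (simp add: heat_factor_def)
    ultimately show ?thesis using exp_gt_zero[of "- (\<kappa> * (s - t))"] by linarith
  qed
qed

lemma bounded_cont_product:
  assumes "continuous_on UNIV g" "\<And>x. \<bar>g x\<bar> \<le> A" "continuous_on UNIV k" "\<And>s. \<bar>k s\<bar> \<le> B"
  shows "bounded_cont (\<lambda>x s. g x * k s)"
  unfolding bounded_cont_def
proof
  show "continuous_on (UNIV \<times> {0..}) (\<lambda>(x, t). g x * k t)"
    unfolding case_prod_unfold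
    by (intro continuous_intros continuous_on_compose2[OF assms(1)] continuous_on_compose2[OF assms(3)]) auto
  have "\<bar>g x * k s\<bar> \<le> A * B" for x s
    unfolding abs_mult by (rule mult_mono') (use assms in auto)
  then show "bounded ((\<lambda>(x, t). g x * k t) ` (UNIV \<times> {0..}))"
    by (intro boundedI[of _ "A * B"]) auto
qed

lemma BC21_cos:
  assumes \<kappa>: "0 \<le> \<kappa>"
  shows "BC21 (\<lambda>x s. cos (\<theta> * x + \<alpha>) * heat_factor \<kappa> t s)
     (\<lambda>x s. (- \<theta> * sin (\<theta> * x + \<alpha>)) * heat_factor \<kappa> t s)
     (\<lambda>x s. (- \<theta>\<^sup>2 * cos (\<theta> * x + \<alpha>)) * heat_factor \<kappa> t s)
     (\<lambda>x s. cos (\<theta> * x + \<alpha>) * (\<kappa> * exp (- (\<kappa> * \<bar>s - t\<bar>))))"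
proof -
  have h: "continuous_on UNIV (heat_factor \<kappa> t)"
    by (intro continuous_at_imp_continuous_on ballI DERIV_isCont[OF heat_factor_derivative])
  have h': "\<bar>\<kappa> * exp (- (\<kappa> * \<bar>s - t\<bar>))\<bar> \<le> \<kappa> * 1" for s
    unfolding abs_mult using \<kappa> by (intro mult_mono) auto
  have sin_le: "\<bar>- \<theta> * sin (\<theta> * x + \<alpha>)\<bar> \<le> \<bar>\<theta>\<bar> * 1" "\<bar>- \<theta>\<^sup>2 * cos (\<theta> * x + \<alpha>)\<bar> \<le> \<theta>\<^sup>2 * 1" for x
    unfolding abs_mult by (intro mult_mono; simp)+
  have "bounded_cont (\<lambda>x s. cos (\<theta> * x + \<alpha>) * heat_factor \<kappa> t s)"
    "bounded_cont (\<lambda>x s. (- \<theta> * sin (\<theta> * x + \<alpha>)) * heat_factor \<kappa> t s)"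
    "bounded_cont (\<lambda>x s. (- \<theta>\<^sup>2 * cos (\<theta> * x + \<alpha>)) * heat_factor \<kappa> t s)"
    "bounded_cont (\<lambda>x s. cos (\<theta> * x + \<alpha>) * (\<kappa> * exp (- (\<kappa> * \<bar>s - t\<bar>))))"
    by (rule bounded_cont_product[OF _ abs_cos_le_one h abs_heat_factor_le[OF \<kappa>]]
          bounded_cont_product[OF _ sin_le(1) h abs_heat_factor_le[OF \<kappa>]]
          bounded_cont_product[OF _ sin_le(2) h abs_heat_factor_le[OF \<kappa>]]
          bounded_cont_product[OF _ abs_cos_le_one _ h']; intro continuous_intros)+
  moreover have "((\<lambda>y. cos (\<theta> * y + \<alpha>) * heat_factor \<kappa> t s) has_real_derivative
      (- \<theta> * sin (\<theta> * x + \<alpha>)) * heat_factor \<kappa> t s) (at x)"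
    "((\<lambda>y. (- \<theta> * sin (\<theta> * y + \<alpha>)) * heat_factor \<kappa> t s) has_real_derivative
      (- \<theta>\<^sup>2 * cos (\<theta> * x + \<alpha>)) * heat_factor \<kappa> t s) (at x)" for x s
    by (auto intro!: derivative_eq_intros simp: power2_eq_square)
  moreover have "((\<lambda>s. cos (\<theta> * x + \<alpha>) * heat_factor \<kappa> t s) has_real_derivative
      cos (\<theta> * x + \<alpha>) * (\<kappa> * exp (- (\<kappa> * \<bar>s - t\<bar>)))) (at s within {0..})" for x s
    by (rule DERIV_cmult[OF has_field_derivative_at_within[OF heat_factor_derivative]])
  ultimately show ?thesis unfolding BC21_def by blast
qed

lemma real_distribution_density_measure:
  assumes "prob_density_fun g"
  shows "real_distribution (density_measure g)" "g \<in> borel_measurable borel"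
proof -
  have g: "integrable lborel g" "\<And>x. 0 \<le> g x" "(\<integral>x. g x \<partial>lborel) = 1"
    using assms unfolding prob_density_fun_def by auto
  then show m: "g \<in> borel_measurable borel" using borel_measurable_integrable[OF g(1)] by simp
  have "prob_space (density_measure g)"
  proof (rule prob_spaceI)
    show "emeasure (density_measure g) (space (density_measure g)) = 1"
      unfolding density_measure_def using m g
      by (simp add: emeasure_density nn_integral_eq_integral)
  qed
  then show "real_distribution (density_measure g)"
    by (simp add: real_distribution_def real_distribution_axioms_def density_measure_def)
qed

text \<open>With \<open>\<kappa> = \<theta>\<^sup>2 / 2\<close> the test function \<open>cos(\<theta> x + \<alpha>) exp(- \<kappa> (t - s))\<close> solves the backward heat equation
up to time \<open>t\<close>, so only the growth rate survives in the weak equation.\<close>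

theorem weak_solution_mild_evolution:
  assumes \<omega>: "selection_weighting \<omega>" and f: "\<And>t. 0 \<le> t \<Longrightarrow> 0 \<le> f t" "\<And>t. 0 \<le> t \<Longrightarrow> f t \<le> \<Lambda>" and \<Lambda>: "0 \<le> \<Lambda>"
    and sol: "weak_solution \<omega> \<Lambda> f \<rho> u b"
  shows "mild_evolution (\<lambda>t. density_measure (\<lambda>x. u x t)) (growth_rate \<omega> \<Lambda> f b) \<Lambda> (\<lambda>_. 1)"
proof (rule mild_evolution.intro)
  let ?m = "\<lambda>t. density_measure (\<lambda>x. u x t)" and ?c = "growth_rate \<omega> \<Lambda> f b"
  fix t T \<theta> \<alpha> x :: real
  assume t: "0 \<le> t"
  have dens: "prob_density_fun (\<lambda>x. u x s)" if "0 \<le> s" for s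
    using sol that unfolding weak_solution_def by blast
  have \<rho>: "\<rho> = (\<lambda>x. u x 0)"
    using sol unfolding weak_solution_def by auto
  interpret D: real_distribution "?m t" by (rule real_distribution_density_measure[OF dens[OF t]])
  show "finite_measure (?m t)" by (rule D.finite_measure_axioms)
  show "sets (?m t) = sets borel" by simp
  show "measure (?m t) UNIV \<le> 1" by simp
  show "?c t \<in> borel_measurable borel" by (rule growth_rate_measurable[OF \<omega>])
  show "\<bar>?c t x\<bar> \<le> \<Lambda>" by (rule abs_growth_rate_le[OF \<omega> f \<Lambda>])
  define \<kappa> where "\<kappa> = \<theta>\<^sup>2 / 2"
  have \<kappa>: "0 \<le> \<kappa>" by (simp add: \<kappa>_def)
  let ?I = "weak_integrand \<omega> \<Lambda> f u b (\<lambda>x s. cos (\<theta> * x + \<alpha>) * heat_factor \<kappa> t s)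
      (\<lambda>x s. (- \<theta>\<^sup>2 * cos (\<theta> * x + \<alpha>)) * heat_factor \<kappa> t s)
      (\<lambda>x s. cos (\<theta> * x + \<alpha>) * (\<kappa> * exp (- (\<kappa> * \<bar>s - t\<bar>))))"
  let ?J = "\<lambda>s. exp (- (\<theta>\<^sup>2 * (t - s) / 2)) * (\<integral>x. cos (\<theta> * x + \<alpha>) * ?c s x \<partial>?m s)"
  have weak: "set_integrable lborel {0..t} ?I"
    "(\<integral>x. cos (\<theta> * x + \<alpha>) * heat_factor \<kappa> t t \<partial>?m t) =
       (\<integral>x. cos (\<theta> * x + \<alpha>) * heat_factor \<kappa> t 0 \<partial>density_measure \<rho>) + (LINT s:{0..t}|lborel. ?I s)"
    using sol BC21_cos[OF \<kappa>, of \<theta> \<alpha> t] t unfolding weak_solution_def by blast+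
  have eq: "?I s = ?J s" if s: "s \<in> {0..t}" for s
  proof -
    have e: "- (\<kappa> * \<bar>s - t\<bar>) = \<kappa> * (s - t)" "- (\<theta>\<^sup>2 * (t - s) / 2) = \<kappa> * (s - t)"
      using s by (auto simp: \<kappa>_def field_simps)
    have hf: "heat_factor \<kappa> t s = exp (\<kappa> * (s - t))" using s by (simp add: heat_factor_def)
    have "?I s = (\<integral>x. exp (\<kappa> * (s - t)) * (cos (\<theta> * x + \<alpha>) * ?c s x) \<partial>?m s)"
      unfolding weak_integrand_def
    proof (rule Bochner_Integration.integral_cong[OF refl])
      fix x
      show "1 / 2 * (- \<theta>\<^sup>2 * cos (\<theta> * x + \<alpha>) * heat_factor \<kappa> t s) +
          cos (\<theta> * x + \<alpha>) * (\<kappa> * exp (- (\<kappa> * \<bar>s - t\<bar>))) +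
          f s * (cos (\<theta> * x + \<alpha>) * heat_factor \<kappa> t s) -
          \<Lambda> * (cos (\<theta> * x + \<alpha>) * heat_factor \<kappa> t s) * shifted_weight \<omega> x (b s) =
        exp (\<kappa> * (s - t)) * (cos (\<theta> * x + \<alpha>) * ?c s x)"
        using s unfolding e hf by (simp add: growth_rate_def) (simp add: \<kappa>_def algebra_simps)
    qed
    then show ?thesis unfolding e by simp
  qed
  show "set_integrable lborel {0..t} ?J"
    by (rule set_integrable_cong[THEN iffD1, OF refl refl _ weak(1)]) (rule eq)
  have "(LINT s:{0..t}|lborel. ?I s) = (LINT s:{0..t}|lborel. ?J s)"
    by (rule set_lebesgue_integral_cong) (simp, blast intro: eq)
  moreover have "heat_factor \<kappa> t t = 1" "heat_factor \<kappa> t 0 = exp (- (\<theta>\<^sup>2 * t / 2))"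
    using t by (simp_all add: heat_factor_def \<kappa>_def)
  ultimately show "(\<integral>x. cos (\<theta> * x + \<alpha>) \<partial>?m t) =
      exp (- (\<theta>\<^sup>2 * t / 2)) * (\<integral>x. cos (\<theta> * x + \<alpha>) \<partial>?m 0) + (LINT s:{0..t}|lborel. ?J s)"
    using weak(2) \<rho> by (simp add: mult.commute)
qed

lemma (in mild_evolution) continuous_cos:
  "continuous_on {0..} (\<lambda>t. \<integral>x. cos (\<theta> * x + \<alpha>) \<partial>m t)"
proof -
  define J where "J s = exp (\<theta>\<^sup>2 * s / 2) * (\<integral>x. cos (\<theta> * x + \<alpha>) * c s x \<partial>m s)" for s
  have split: "exp (- (\<theta>\<^sup>2 * (t - s) / 2)) = exp (- (\<theta>\<^sup>2 * t / 2)) * exp (\<theta>\<^sup>2 * s / 2)" for t s :: real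
    by (simp add: algebra_simps diff_divide_distrib flip: exp_add)
  have int: "set_integrable lborel {0..t} J" if "0 \<le> t" for t
  proof -
    have "set_integrable lborel {0..t} (\<lambda>s. exp (- (\<theta>\<^sup>2 * t / 2)) * J s)"
      using cos_integrable[OF that, of \<theta> \<alpha>] unfolding split J_def by (simp only: mult.assoc)
    then show ?thesis by (subst (asm) set_integrable_mult_right_iff) auto
  qed
  have eqt: "(\<integral>x. cos (\<theta> * x + \<alpha>) \<partial>m t) = exp (- (\<theta>\<^sup>2 * t / 2)) *
      ((\<integral>x. cos (\<theta> * x + \<alpha>) \<partial>m 0) + integral {0..t} J)" if "t \<in> {0..}" for t
  proof -
    have "(LINT s:{0..t}|lborel. exp (- (\<theta>\<^sup>2 * t / 2)) * J s) = exp (- (\<theta>\<^sup>2 * t / 2)) * integral {0..t} J"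
      using that int[of t] by (simp add: set_borel_integral_eq_integral(2))
    then show ?thesis
      using that duhamel_cos[of t \<theta> \<alpha>] unfolding split J_def by (simp add: distrib_left mult.assoc)
  qed
  have "continuous_on {0..} (\<lambda>t. integral {0..t} J)"
    unfolding continuous_on_eq_continuous_within
  proof
    fix t :: real assume t: "t \<in> {0..}"
    have "continuous_on {0..t + 1} (\<lambda>t. integral {0..t} J)"
      using int[of "t + 1"] t
      by (intro indefinite_integral_continuous_1 set_borel_integral_eq_integral(1)) auto
    then have "continuous (at t within {0..t + 1}) (\<lambda>t. integral {0..t} J)"
      using t by (auto simp: continuous_on_eq_continuous_within)
    moreover have "at t within {0..t + 1} = at t within {0..}"
      by (rule at_within_nhd[of t "{..<t + 1}"]) auto
    ultimately show "continuous (at t within {0..}) (\<lambda>t. integral {0..t} J)" by simp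
  qed
  then have "continuous_on {0..} (\<lambda>t. exp (- (\<theta>\<^sup>2 * t / 2)) *
      ((\<integral>x. cos (\<theta> * x + \<alpha>) \<partial>m 0) + integral {0..t} J))"
    by (intro continuous_intros) auto
  then show ?thesis by (rule continuous_on_eq) (rule eqt[symmetric])
qed

text \<open>The Duhamel formula makes the characteristic functions continuous in time. By Levy's continuity
theorem the measures are weakly continuous, which admits test functions that are continuous almost
everywhere.\<close>

lemma (in mild_evolution) weakly_continuous:
  fixes g :: "real \<Rightarrow> real"
  assumes prob: "\<And>t. 0 \<le> t \<Longrightarrow> prob_space (m t)"
    and g: "g \<in> borel_measurable borel" "\<And>x. \<bar>g x\<bar> \<le> B"
    and null: "\<And>t. 0 \<le> t \<Longrightarrow> emeasure (m t) {x. \<not> isCont g x} = 0"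
  shows "continuous_on {0..} (\<lambda>t. \<integral>x. g x \<partial>m t)"
  unfolding continuous_on_sequentially comp_def
proof (intro allI ballI impI, elim conjE)
  fix ts t assume t: "(t::real) \<in> {0..}" and ts: "\<forall>n. ts n \<in> {0..}" "ts \<longlonglongrightarrow> t"
  have dist: "real_distribution (m s)" if "0 \<le> s" for s
    using prob[OF that] sets_eq[OF that] by (simp add: real_distribution_def real_distribution_axioms_def)
  have "(\<lambda>n. char (m (ts n)) \<theta>) \<longlonglongrightarrow> char (m t) \<theta>" for \<theta>
  proof -
    have lim: "(\<lambda>n. \<integral>x. cos (\<theta> * x + \<alpha>) \<partial>m (ts n)) \<longlonglongrightarrow> (\<integral>x. cos (\<theta> * x + \<alpha>) \<partial>m t)" for \<alpha>
      by (rule continuous_on_tendsto_compose[OF continuous_cos ts(2) t]) (use ts in auto)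
    have sin: "sin (\<theta> * x) = cos (\<theta> * x + - (pi / 2))" for x
      by (simp add: cos_diff)
    have "(\<lambda>n. Complex (Re (char (m (ts n)) \<theta>)) (Im (char (m (ts n)) \<theta>))) \<longlonglongrightarrow>
        Complex (Re (char (m t) \<theta>)) (Im (char (m t) \<theta>))"
      using lim[of 0] lim[of "- (pi / 2)"] ts t
      by (intro tendsto_Complex) (simp_all add: char_eq_cos_sin dist sin)
    then show ?thesis by simp
  qed
  then have "weak_conv_m (\<lambda>n. m (ts n)) (m t)"
    using ts t by (intro levy_continuity dist) auto
  then show "(\<lambda>n. \<integral>x. g x \<partial>m (ts n)) \<longlonglongrightarrow> (\<integral>x. g x \<partial>m t)"
    using ts t g null by (intro weak_conv_imp_bdd_ae_continuous_conv[where B=B] dist) auto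
qed

text \<open>The function \<open>G q t = \<mu>\<^sub>t(\<omega>(\<cdot> - q))\<close> is continuous in \<open>t\<close>: a monotone \<open>\<omega>\<close> has countably many
discontinuities, and \<open>\<mu>\<^sub>t\<close> has a density. It is monotone in \<open>q\<close>, so the infimum that defines the barrier may be
taken over rational \<open>q\<close>, which makes it measurable. It is not \<open>\<infinity>\<close> because \<open>\<Lambda> G q t\<close> tends to
\<open>\<Lambda> > f t\<close> as \<open>q\<close> grows.\<close>

theorem solution_barrier_is_barrier:
  assumes \<omega>: "selection_weighting \<omega>" and f: "\<And>t. 0 \<le> t \<Longrightarrow> 0 \<le> f t" "\<And>t. 0 \<le> t \<Longrightarrow> f t < \<Lambda>"
    and cont: "continuous_on {0..} f" and \<Lambda>: "0 < \<Lambda>"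
    and sol: "weak_solution \<omega> \<Lambda> f \<rho> u b"
  shows "barrier b"
proof -
  let ?m = "\<lambda>t. density_measure (\<lambda>x. u x t)"
  define G where "G q t = (\<integral>y. \<omega> (y - q) \<partial>?m t)" for q t
  note [measurable] = selection_weighting_measurable[OF \<omega>]
  have \<omega>01: "\<bar>\<omega> x\<bar> \<le> 1" for x using \<omega> by (simp add: selection_weighting_def)
  interpret mild_evolution ?m "growth_rate \<omega> \<Lambda> f b" \<Lambda> "\<lambda>_. 1"
    by (rule weak_solution_mild_evolution[OF \<omega> f(1) less_imp_le[OF f(2)] less_imp_le[OF \<Lambda>] sol])
  have dens: "prob_density_fun (\<lambda>x. u x t)" if "0 \<le> t" for t
    using sol that unfolding weak_solution_def by blast
  have dist: "real_distribution (?m t)" if "0 \<le> t" for t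
    by (rule real_distribution_density_measure[OF dens[OF that]])
  have int: "integrable (?m t) (\<lambda>y. \<omega> (y - q))" if "0 \<le> t" for t q
    by (rule bounded_integrable[OF that, where B=1]) (auto simp: \<omega>01)
  have G_mono: "G q t \<le> G q' t" if "0 \<le> t" "q \<le> q'" for q q' t
    unfolding G_def using int[OF that(1)] \<omega> that(2)
    by (intro integral_mono) (auto simp: selection_weighting_def antimono_def)
  have G_cont: "continuous_on {0..} (G q)" for q
    unfolding G_def[abs_def]
  proof (rule weakly_continuous)
    show "prob_space (?m t)" if "0 \<le> t" for t
      using dist[OF that] by (simp add: real_distribution_def)
    show "(\<lambda>y. \<omega> (y - q)) \<in> borel_measurable borel" by measurable
    show "\<bar>\<omega> (y - q)\<bar> \<le> 1" for y by (rule \<omega>01)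
    fix t :: real assume t: "0 \<le> t"
    have "mono (\<lambda>y. - \<omega> (y - q))"
      using \<omega> by (auto simp: selection_weighting_def antimono_def mono_def)
    then have "countable {y. \<not> isCont (\<lambda>y. - \<omega> (y - q)) y}" by (rule mono_ctble_discont)
    moreover have "isCont (\<lambda>y. - \<omega> (y - q)) y \<longleftrightarrow> isCont (\<lambda>y. \<omega> (y - q)) y" for y
      using continuous_minus[of "at y" "\<lambda>y. - \<omega> (y - q)"] continuous_minus[of "at y" "\<lambda>y. \<omega> (y - q)"] by auto
    ultimately have c: "countable {y. \<not> isCont (\<lambda>y. \<omega> (y - q)) y}" by simp
    have u: "(\<lambda>x. u x t) \<in> borel_measurable borel"
      by (rule real_distribution_density_measure(2)[OF dens[OF t]])
    have "{y. \<not> isCont (\<lambda>y. \<omega> (y - q)) y} \<in> null_sets lborel"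
      using countable_imp_null_set_lborel[OF c] .
    then have "{y. \<not> isCont (\<lambda>y. \<omega> (y - q)) y} \<in> null_sets (?m t)"
      unfolding density_measure_def using u
      by (subst null_sets_density_iff) (auto dest: AE_not_in)
    then show "emeasure (?m t) {y. \<not> isCont (\<lambda>y. \<omega> (y - q)) y} = 0" by auto
  qed
  have b: "b t = Inf {ereal x |x. f t \<le> \<Lambda> * G x t}" if "0 \<le> t" for t
    using sol that unfolding weak_solution_def solution_barrier_def G_def by blast
  have b': "b t = (INF q::rat. if f t \<le> \<Lambda> * G (of_rat q) t then ereal (of_rat q) else \<infinity>)" (is "_ = ?R")
    if t: "0 \<le> t" for t
    unfolding b[OF t]
  proof (rule antisym)
    show "Inf {ereal x |x. f t \<le> \<Lambda> * G x t} \<le> ?R"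
      by (intro INF_greatest) (auto intro!: Inf_lower)
    show "?R \<le> Inf {ereal x |x. f t \<le> \<Lambda> * G x t}"
    proof (intro Inf_greatest, elim CollectE exE conjE)
      fix y x assume x: "y = ereal x" "f t \<le> \<Lambda> * G x t"
      show "?R \<le> y" unfolding x(1)
      proof (rule dense_ge)
        fix w assume "ereal x < w"
        then obtain q :: rat where q: "ereal x < ereal (of_rat q)" "ereal (of_rat q) < w"
          using ereal_dense3 by blast
        have "\<Lambda> * G x t \<le> \<Lambda> * G (of_rat q) t"
          using G_mono[OF t, of x "of_rat q"] q(1) \<Lambda> by (intro mult_left_mono) auto
        then have "f t \<le> \<Lambda> * G (of_rat q) t" using x(2) by linarith
        then have "?R \<le> ereal (of_rat q)"
          by (intro INF_lower2[of q]) auto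
        then show "?R \<le> w" using q(2) by simp
      qed
    qed
  qed
  have "(\<lambda>t. INF q::rat. if f t \<le> \<Lambda> * G (of_rat q) t then ereal (of_rat q) else \<infinity>)
      \<in> borel_measurable (restrict_space borel {0..})"
  proof -
    have [measurable]: "f \<in> borel_measurable (restrict_space borel {0..})"
        "G q \<in> borel_measurable (restrict_space borel {0..})" for q
      using cont G_cont by (auto intro: borel_measurable_continuous_on_restrict)
    show ?thesis by measurable
  qed
  then have "b \<in> borel_measurable (restrict_space borel {0..})"
    by (subst measurable_cong[OF b']) (auto simp: space_restrict_space)
  moreover have "b t \<noteq> \<infinity>" if t: "0 \<le> t" for t
  proof -
    interpret D: real_distribution "?m t" by (rule dist[OF t])
    have "(\<lambda>n. G (real n) t) \<longlonglongrightarrow> (\<integral>y. 1 \<partial>?m t)"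
      unfolding G_def
    proof (rule integral_dominated_convergence[where w="\<lambda>_. 1"])
      show "AE y in ?m t. (\<lambda>n. \<omega> (y - real n)) \<longlonglongrightarrow> 1"
      proof (rule AE_I2)
        fix y
        have "filterlim (\<lambda>n. - y + real n) at_top sequentially"
          by (rule filterlim_tendsto_add_at_top[OF tendsto_const filterlim_real_sequentially])
        then have "filterlim (\<lambda>n. y - real n) at_bot sequentially"
          by (simp add: filterlim_uminus_at_bot)
        then show "(\<lambda>n. \<omega> (y - real n)) \<longlonglongrightarrow> 1"
          using \<omega> filterlim_compose unfolding selection_weighting_def by blast
      qed
    qed (auto simp: \<omega>01)
    moreover have "(\<integral>y. 1 \<partial>?m t) = (1::real)" using D.prob_space by simp
    ultimately have "(\<lambda>n. \<Lambda> * G (real n) t) \<longlonglongrightarrow> \<Lambda> * 1"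
      by (intro tendsto_intros) simp
    then have "\<forall>\<^sub>F n in sequentially. f t < \<Lambda> * G (real n) t"
      using f(2)[OF t] by (intro order_tendstoD) auto
    then obtain n where "f t < \<Lambda> * G (real n) t"
      by (meson eventually_happens sequentially_bot)
    then have "b t \<le> ereal (real n)"
      unfolding b[OF t] by (intro Inf_lower) auto
    then show ?thesis by auto
  qed
  ultimately show ?thesis unfolding barrier_def by blast
qed


section \<open>The distribution of the killing time\<close>

locale soft_killing = brownian M W for M :: "'a measure" and W +
  fixes U :: "'a \<Rightarrow> real" and \<rho> \<omega> :: "real \<Rightarrow> real" and \<Lambda> :: real and b :: "real \<Rightarrow> ereal"
  assumes killing: "killing_setup M W U \<rho>" and \<omega>: "selection_weighting \<omega>"
    and \<Lambda>: "0 < \<Lambda>" and b: "barrier b"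
begin

text \<open>With \<open>f = 0\<close> the growth rate is the negative of the killing rate, so its action is minus the accumulated
hazard and inherits the measurability and continuity of actions.\<close>

sublocale hazard: feynman_kac M W "growth_rate \<omega> \<Lambda> (\<lambda>_. 0) b" \<Lambda>
proof
  show "(\<lambda>p. growth_rate \<omega> \<Lambda> (\<lambda>_. 0) b (fst p) (snd p)) \<in> borel_measurable (borel \<Otimes>\<^sub>M borel)"
    by (rule growth_rate_jointly_measurable[OF \<omega> _ b]) simp
  show "\<bar>growth_rate \<omega> \<Lambda> (\<lambda>_. 0) b s x\<bar> \<le> \<Lambda>" for s x
    using \<Lambda> by (intro abs_growth_rate_le[OF \<omega>]) auto
qed

definition hazard :: "real \<Rightarrow> 'a \<Rightarrow> real" where
  "hazard y z = \<Lambda> * (LINT s:{0..y}|lborel. shifted_weight \<omega> (W s z) (b s))"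

lemma hazard_eq_action: "hazard y z = - hazard.action y z"
proof -
  have "hazard.action y z = (LINT s:{0..y}|lborel. - \<Lambda> * shifted_weight \<omega> (W s z) (b s))"
    unfolding hazard.action_def by (rule set_lebesgue_integral_cong) (auto simp: growth_rate_def)
  also have "\<dots> = - \<Lambda> * (LINT s:{0..y}|lborel. shifted_weight \<omega> (W s z) (b s))"
    by (rule set_integral_mult_right)
  finally show ?thesis by (simp add: hazard_def)
qed

lemma hazard_measurable: "hazard y \<in> borel_measurable M"
  using hazard.action_random_variable[of y] by (simp add: hazard_eq_action[abs_def])

lemma hazard_Lipschitz: "z \<in> space M \<Longrightarrow> x \<le> y \<Longrightarrow> hazard y z - hazard x z \<le> \<Lambda> * (y - x)"
  using hazard.action_Lipschitz[of z x y] by (simp add: hazard_eq_action)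

lemma weight_along_path_integrable:
  assumes "z \<in> space M"
  shows "set_integrable lborel {0..y} (\<lambda>s. shifted_weight \<omega> (W s z) (b s))"
proof -
  have "set_integrable lborel {0..y} (\<lambda>s. growth_rate \<omega> \<Lambda> (\<lambda>_. 0) b s (W (max 0 s) z))"
    by (rule bounded_set_integrable[OF hazard.path_rate_measurable[OF assms] hazard.c_le])
  then have "set_integrable lborel {0..y} (\<lambda>s. - \<Lambda> * shifted_weight \<omega> (W s z) (b s))"
    by (rule set_integrable_cong[THEN iffD1, OF refl refl, rotated]) (auto simp: growth_rate_def)
  then show ?thesis using \<Lambda> by (subst (asm) set_integrable_mult_right_iff) auto
qed

lemma hazard_mono:
  assumes "z \<in> space M" "0 \<le> x" "x \<le> y" shows "hazard x z \<le> hazard y z"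
proof -
  have "0 \<le> (LINT s:{x..y}|lborel. shifted_weight \<omega> (W s z) (b s))"
    unfolding set_lebesgue_integral_def
    by (intro Bochner_Integration.integral_nonneg) (auto simp: shifted_weight_bounds[OF \<omega>])
  then show ?thesis
    using set_integral_split[OF weight_along_path_integrable[OF assms(1)] assms(2,3)] \<Lambda>
    by (simp add: hazard_def)
qed

lemma hazard_nonneg: "0 \<le> hazard y z"
  unfolding hazard_def set_lebesgue_integral_def using \<Lambda>
  by (intro mult_nonneg_nonneg Bochner_Integration.integral_nonneg) (auto simp: shifted_weight_bounds[OF \<omega>])

lemma killing_time_hazard:
  "killing_time \<omega> \<Lambda> b W U z = Inf {ereal t |t. 0 \<le> t \<and> U z \<le> hazard t z}"
  by (simp add: killing_time_def hazard_def)

lemma killing_time_nonneg: "0 \<le> killing_time \<omega> \<Lambda> b W U z"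
  unfolding killing_time_hazard by (rule Inf_greatest) auto

text \<open>If the hazard at time \<open>y\<close> is below \<open>U\<close>, it takes at least \<open>(U - hazard) / \<Lambda>\<close> more time to reach \<open>U\<close>,
since it grows at rate at most \<open>\<Lambda>\<close>; this gap makes the inequality for the infimum strict.\<close>

lemma less_killing_time_iff:
  assumes z: "z \<in> space M" and y: "0 \<le> y"
  shows "ereal y < killing_time \<omega> \<Lambda> b W U z \<longleftrightarrow> hazard y z < U z"
proof
  assume less: "ereal y < killing_time \<omega> \<Lambda> b W U z"
  show "hazard y z < U z"
  proof (rule ccontr)
    assume "\<not> hazard y z < U z"
    then have "killing_time \<omega> \<Lambda> b W U z \<le> ereal y"
      unfolding killing_time_hazard using y by (intro Inf_lower) auto
    then show False using less by simp
  qed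
next
  assume less: "hazard y z < U z"
  have "ereal (y + (U z - hazard y z) / \<Lambda>) \<le> killing_time \<omega> \<Lambda> b W U z"
    unfolding killing_time_hazard
  proof (rule Inf_greatest, elim CollectE exE conjE)
    fix x t assume t: "x = ereal t" "0 \<le> t" "U z \<le> hazard t z"
    have "y \<le> t"
      using hazard_mono[OF z t(2), of y] t(3) less by linarith
    then have "U z - hazard y z \<le> (t - y) * \<Lambda>"
      using hazard_Lipschitz[OF z, of y t] t(3) by (simp add: mult.commute)
    then have "(U z - hazard y z) / \<Lambda> \<le> t - y" using \<Lambda> by (simp add: divide_le_eq)
    then show "ereal (y + (U z - hazard y z) / \<Lambda>) \<le> x" by (simp add: t(1))
  qed
  moreover have "y < y + (U z - hazard y z) / \<Lambda>" using less \<Lambda> by simp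
  ultimately show "ereal y < killing_time \<omega> \<Lambda> b W U z"
    using less_ereal.simps(1) order_less_le_trans by blast
qed

lemma U_distributed: "distributed M lborel U (\<lambda>x. ennreal (exponential_density 1 x))"
  using killing unfolding killing_setup_def by simp

lemma U_measurable: "U \<in> borel_measurable M"
  using distributed_measurable[OF U_distributed] by simp

lemma killing_time_measurable: "killing_time \<omega> \<Lambda> b W U \<in> borel_measurable M"
proof (rule borel_measurableI_greater)
  fix y :: ereal
  note [measurable] = U_measurable hazard_measurable
  show "{z \<in> space M. y < killing_time \<omega> \<Lambda> b W U z} \<in> sets M"
  proof (cases "0 \<le> y")
    case True
    show ?thesis
    proof (cases y)
      case (real r)
      then have "{z \<in> space M. y < killing_time \<omega> \<Lambda> b W U z} = {z \<in> space M. hazard r z < U z}"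
        using True less_killing_time_iff by auto
      then show ?thesis by simp
    qed (use True in auto)
  next
    case False
    then have "y < killing_time \<omega> \<Lambda> b W U z" for z
      using killing_time_nonneg[of z] by (meson less_le_trans not_le)
    then have "{z \<in> space M. y < killing_time \<omega> \<Lambda> b W U z} = space M" by simp
    then show ?thesis by simp
  qed
qed

text \<open>The hazard up to \<open>y\<close> is measurable with respect to the sigma-algebra of the whole path, from which \<open>U\<close>
is independent.\<close>

lemma indep_hazard:
  assumes y: "0 \<le> y" shows "indep_var borel (hazard y) borel U"
proof -
  let ?F = "vimage_algebra (space M) (\<lambda>z. \<lambda>t\<in>{0..}. W t z) (Pi\<^sub>M {0..} (\<lambda>_. borel))"
  have W: "W t \<in> borel_measurable ?F" if "0 \<le> t" for t
  proof -
    have "(\<lambda>z. (\<lambda>t\<in>{0..}. W t z) t) \<in> borel_measurable ?F"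
      by (rule measurable_compose[OF measurable_vimage_algebra1 measurable_component_singleton])
         (use that in \<open>auto simp: space_PiM split: if_splits\<close>)
    then show ?thesis using that by simp
  qed
  have "hazard.action y \<in> borel_measurable ?F"
    by (rule hazard.action_measurable[OF _ W y]) auto
  then have A: "hazard y \<in> borel_measurable ?F"
    by (simp add: hazard_eq_action[abs_def])
  have sub: "{hazard y -` A \<inter> space M |A. A \<in> sets borel} \<subseteq> sets ?F"
    using measurable_sets[OF A] by auto
  have gen: "sigma_sets (space M) {hazard y -` A \<inter> space M |A. A \<in> sets borel} \<subseteq> sets ?F"
    using sets.sigma_sets_subset[OF sub] by simp
  have U: "sigma_sets (space M) {U -` A \<inter> space M |A. A \<in> sets borel} = sets (vimage_algebra (space M) U borel)"
    by (simp add: sets_vimage_algebra)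
  have ind: "indep_set (sets (vimage_algebra (space M) U borel)) (sets ?F)"
    using killing unfolding killing_setup_def indep_of_process_def by simp
  have "indep_set (sigma_sets (space M) {hazard y -` A \<inter> space M |A. A \<in> sets borel})
      (sets (vimage_algebra (space M) U borel))"
  proof (rule indep_setI)
    fix A B assume "A \<in> sigma_sets (space M) {hazard y -` A \<inter> space M |A. A \<in> sets borel}"
      "B \<in> sets (vimage_algebra (space M) U borel)"
    then have "prob (B \<inter> A) = prob B * prob A"
      using gen by (intro indep_setD[OF ind]) auto
    then show "prob (A \<inter> B) = prob A * prob B" by (simp add: Int_commute mult.commute)
  qed (use gen indep_setD_ev1[OF ind] indep_setD_ev2[OF ind] in auto)
  then show ?thesis
    unfolding indep_var_eq U using U_measurable hazard_measurable by simp
qed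

text \<open>Given the path, \<open>U\<close> exceeds the hazard \<open>a\<close> with probability \<open>exp(- a)\<close>.\<close>

lemma prob_less_killing_time:
  assumes y: "0 \<le> y"
  shows "prob {z \<in> space M. ereal y < killing_time \<omega> \<Lambda> b W U z} = expectation (\<lambda>z. exp (- hazard y z))"
proof -
  note [measurable] = U_measurable hazard_measurable[of y]
  have pU: "prob_space (distr M borel U)" by (rule prob_space_distr) measurable
  interpret DU: prob_space "distr M borel U" by (rule pU)
  let ?P = "distr M borel (hazard y) \<Otimes>\<^sub>M distr M borel U" and ?S = "{p :: real \<times> real. fst p < snd p}"
  have S: "?S \<in> sets (borel \<Otimes>\<^sub>M borel)"
  proof -
    have "{p \<in> space (borel \<Otimes>\<^sub>M borel). fst p < (snd p :: real)} \<in> sets (borel \<Otimes>\<^sub>M borel)"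
      by measurable
    then show ?thesis by (simp add: space_pair_measure)
  qed
  have joint: "?P = distr M (borel \<Otimes>\<^sub>M borel) (\<lambda>z. (hazard y z, U z))"
    using indep_hazard[OF y] unfolding indep_var_distribution_eq by simp
  have tail: "emeasure (distr M borel U) {a<..} = ennreal (exp (- a))" if "0 \<le> a" for a
  proof -
    have "prob {z \<in> space M. a < U z} = exp (- a * 1)"
      by (rule exponential_distributedD_gt[OF U_distributed that]) simp
    moreover have "U -` {a<..} \<inter> space M = {z \<in> space M. a < U z}" by auto
    ultimately show ?thesis by (simp add: emeasure_distr emeasure_eq_measure)
  qed
  have "{z \<in> space M. ereal y < killing_time \<omega> \<Lambda> b W U z} = (\<lambda>z. (hazard y z, U z)) -` ?S \<inter> space M"
    using less_killing_time_iff[OF _ y] by auto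
  then have "emeasure M {z \<in> space M. ereal y < killing_time \<omega> \<Lambda> b W U z} = emeasure ?P ?S"
    unfolding joint using S by (simp add: emeasure_distr)
  also have "\<dots> = (\<integral>\<^sup>+a. emeasure (distr M borel U) (Pair a -` ?S) \<partial>distr M borel (hazard y))"
    using S by (intro DU.emeasure_pair_measure_alt) simp
  also have "\<dots> = (\<integral>\<^sup>+a. emeasure (distr M borel U) {a<..} \<partial>distr M borel (hazard y))"
    by (intro nn_integral_cong arg_cong2[where f=emeasure]) auto
  also have "\<dots> = (\<integral>\<^sup>+z. emeasure (distr M borel U) {hazard y z<..} \<partial>M)"
  proof (rule nn_integral_distr[where M'=borel])
    have eq: "(\<lambda>a. emeasure (distr M borel U) {a<..}) = (\<lambda>a. emeasure (distr M borel U) (Pair a -` ?S))"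
      by (intro ext arg_cong2[where f=emeasure]) auto
    show "(\<lambda>a. emeasure (distr M borel U) {a<..}) \<in> borel_measurable (distr M borel (hazard y))"
      unfolding eq measurable_distr_eq1 using S by (intro DU.measurable_emeasure_Pair) simp
  qed measurable
  also have "\<dots> = (\<integral>\<^sup>+z. ennreal (exp (- hazard y z)) \<partial>M)"
    by (simp add: tail hazard_nonneg)
  also have "\<dots> = ennreal (expectation (\<lambda>z. exp (- hazard y z)))"
  proof (rule nn_integral_eq_integral)
    show "integrable M (\<lambda>z. exp (- hazard y z))"
      by (rule integrable_const_bound[where B=1]) (auto simp: hazard_nonneg)
  qed simp
  finally show ?thesis by (simp add: emeasure_eq_measure)
qed

end


section \<open>Unit mass determines the evolution\<close>

text \<open>Vanishing integrals over initial intervals extend, by intersection-stability of the half-lines, to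
all Borel sets, which determine a function up to null sets.\<close>

lemma AE_eq_0_if_integrals_vanish:
  fixes g :: "real \<Rightarrow> real"
  assumes int: "\<And>t. 0 \<le> t \<Longrightarrow> set_integrable lborel {0..t} g"
    and zero: "\<And>t. 0 \<le> t \<Longrightarrow> (LINT s:{0..t}|lborel. g s) = 0"
  shows "AE s in lborel. 0 \<le> s \<longrightarrow> g s = 0"
proof -
  have T: "AE s in lborel. indicator {0..T} s * g s = 0" if T: "0 \<le> T" for T
  proof (rule density_unique_real)
    let ?h = "\<lambda>s. indicator {0..T} s * g s"
    show h: "integrable lborel ?h" using int[OF T] by (simp add: set_integrable_def)
    show "integrable lborel (\<lambda>s. 0 :: real)" by simp
    have hA: "set_integrable lborel A ?h" if "A \<in> sets borel" for A
      using set_integrable_subset[of lborel UNIV ?h A] h that by (simp add: set_integrable_def)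
    have "(LINT s:A|lborel. ?h s) = 0" if "A \<in> sets borel" for A
    proof -
      have stable: "Int_stable (range atMost :: real set set)"
      proof -
        have "{..a} \<inter> {..b} = {..min a b}" for a b :: real by auto
        then show ?thesis by (simp add: Int_stable_def)
      qed
      have sub: "range (atMost :: real \<Rightarrow> real set) \<subseteq> Pow UNIV" by simp
      have sig: "sigma_sets UNIV (range (atMost :: real \<Rightarrow> real set)) = sets borel"
        by (simp add: borel_eq_atMost)
      have "A \<in> sigma_sets UNIV (range atMost)" using that sig by simp
      from stable sub this show ?thesis
      proof (induction A rule: sigma_sets_induct_disjoint)
        case (basic A)
        then obtain a where A: "A = {..a}" by auto
        show ?case
        proof (cases "0 \<le> a")
          case True
          have "(LINT s:A|lborel. ?h s) = (LINT s:{0..min a T}|lborel. g s)"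
            unfolding set_lebesgue_integral_def A
            by (intro Bochner_Integration.integral_cong) (auto simp: indicator_def)
          then show ?thesis using zero[of "min a T"] True T by simp
        next
          case False
          have "(LINT s:A|lborel. ?h s) = (\<integral>s. 0 \<partial>(lborel :: real measure))"
            unfolding set_lebesgue_integral_def A
            by (intro Bochner_Integration.integral_cong) (use False in \<open>auto simp: indicator_def\<close>)
          then show ?thesis by simp
        qed
      next
        case empty
        then show ?case by (simp add: set_lebesgue_integral_def)
      next
        case (compl A)
        then have A: "A \<in> sets borel" using sig by simp
        have "(LINT s:A \<union> (UNIV - A)|lborel. ?h s) = (LINT s:A|lborel. ?h s) + (LINT s:UNIV - A|lborel. ?h s)"
          by (rule set_integral_Un) (use A hA in auto)
        moreover have "(LINT s:A \<union> (UNIV - A)|lborel. ?h s) = (LINT s:{0..T}|lborel. g s)"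
          by (simp add: set_lebesgue_integral_def)
        ultimately show ?case using compl zero[OF T] by simp
      next
        case (union A)
        have A: "A i \<in> sets borel" for i using union(2) sig by auto
        have "(LINT s:(\<Union>i. A i)|lborel. ?h s) = (\<Sum>i. (LINT s:A i|lborel. ?h s))"
          by (rule lebesgue_integral_countable_add)
             (use A hA union(1) in \<open>auto simp: disjoint_family_on_def\<close>)
        then show ?case using union(3) by simp
      qed
    qed
    then show "(LINT s:A|lborel. ?h s) = (LINT s:A|lborel. 0)" if "A \<in> sets lborel" for A
      using that by (simp add: set_lebesgue_integral_def)
  qed
  have "AE s in lborel. \<forall>n::nat. indicator {0..real n} s * g s = 0"
    unfolding AE_all_countable using T by simp
  then show ?thesis
  proof eventually_elim
    case (elim s)
    show ?case
    proof
      assume "0 \<le> s"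
      moreover obtain n :: nat where "s \<le> real n" using real_arch_simple by blast
      ultimately show "g s = 0" using elim[rule_format, of n] by simp
    qed
  qed
qed

text \<open>The frequency \<open>\<theta> = 0\<close> turns the Duhamel formula into the mass balance.\<close>

lemma (in mild_evolution) flux_vanishes:
  assumes mass: "\<And>t. 0 \<le> t \<Longrightarrow> measure (m t) UNIV = 1"
  shows "AE s in lborel. 0 \<le> s \<longrightarrow> (\<integral>x. c s x \<partial>m s) = 0"
proof (rule AE_eq_0_if_integrals_vanish)
  fix t :: real assume t: "0 \<le> t"
  show "set_integrable lborel {0..t} (\<lambda>s. \<integral>x. c s x \<partial>m s)"
    using cos_integrable[OF t, of 0 0] by simp
  have one: "(\<integral>x. 1 \<partial>m s) = (1::real)" if "0 \<le> s" for s
    using mass[OF that] by (simp add: space_eq[OF that])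
  show "(LINT s:{0..t}|lborel. (\<integral>x. c s x \<partial>m s)) = 0"
    using duhamel_cos[OF t, of 0 0] one[OF t] one[of 0] by simp
qed

lemma integral_difference_scaled:
  fixes h :: "real \<Rightarrow> real"
  assumes D: "\<And>g. g \<in> borel_measurable borel \<Longrightarrow> (\<And>x. \<bar>g x\<bar> \<le> 1) \<Longrightarrow>
      \<bar>(\<integral>x. g x \<partial>m) - (\<integral>x. g x \<partial>m')\<bar> \<le> (D::real)"
    and B: "0 < B" and h: "h \<in> borel_measurable borel" "\<And>x. \<bar>h x\<bar> \<le> B"
  shows "\<bar>(\<integral>x. h x \<partial>m) - (\<integral>x. h x \<partial>m')\<bar> \<le> B * D"
proof -
  have "\<bar>(\<integral>x. h x / B \<partial>m) - (\<integral>x. h x / B \<partial>m')\<bar> \<le> D"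
    using B h by (intro D) auto
  moreover have "(\<integral>x. h x / B \<partial>m) - (\<integral>x. h x / B \<partial>m') = ((\<integral>x. h x \<partial>m) - (\<integral>x. h x \<partial>m')) / B"
    by (simp add: diff_divide_distrib)
  ultimately show ?thesis using B by (simp add: divide_le_eq mult.commute)
qed

text \<open>Raising the barrier raises the weight at every point; this is where monotonicity of \<open>\<omega>\<close> enters the
uniqueness proof.\<close>

lemma growth_rate_difference_same_sign:
  assumes "selection_weighting \<omega>" "0 \<le> \<Lambda>"
  shows "(\<forall>x. growth_rate \<omega> \<Lambda> f b s x \<le> growth_rate \<omega> \<Lambda> f b' s x) \<or>
    (\<forall>x. growth_rate \<omega> \<Lambda> f b' s x \<le> growth_rate \<omega> \<Lambda> f b s x)"
  using shifted_weight_mono[OF assms(1), of "b s" "b' s"] shifted_weight_mono[OF assms(1), of "b' s" "b s"] assms(2)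
  by (cases "b s \<le> b' s") (auto simp: growth_rate_def intro!: mult_left_mono)

lemma (in finite_measure) abs_integral_same_sign:
  fixes g :: "'a \<Rightarrow> real"
  assumes "(\<forall>x. 0 \<le> g x) \<or> (\<forall>x. g x \<le> 0)"
  shows "(\<integral>x. \<bar>g x\<bar> \<partial>M) = \<bar>\<integral>x. g x \<partial>M\<bar>"
proof (cases "\<forall>x. 0 \<le> g x")
  case True
  then show ?thesis by (simp add: Bochner_Integration.integral_nonneg)
next
  case False
  then have g: "\<bar>g x\<bar> = - g x" "0 \<le> - g x" for x using assms by (auto simp: abs_of_nonpos)
  have "0 \<le> (\<integral>x. - g x \<partial>M)" by (intro Bochner_Integration.integral_nonneg g)
  then show ?thesis by (simp add: g(1))
qed

text \<open>Split the difference of the source terms as \<open>(m - m')(\<psi> c) + m'(\<psi> (c - c'))\<close>. The first part is at most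
\<open>\<Lambda>\<close> times the distance \<open>D\<close>. As \<open>c - c'\<close> has constant sign, the second is at most
\<open>\<bar>m'(c) - m'(c')\<bar>\<close>, and by flux balance for both evolutions this equals \<open>\<bar>m'(c) - m(c)\<bar> \<le> \<Lambda> D\<close>.
Hence the constant \<open>2 \<Lambda>\<close>, whatever the distance between the two barriers.\<close>

theorem unit_mass_evolution_unique:
  assumes \<omega>: "selection_weighting \<omega>" and \<Lambda>: "0 < \<Lambda>"
    and m: "mild_evolution m (growth_rate \<omega> \<Lambda> f b) \<Lambda> K" and m': "mild_evolution m' (growth_rate \<omega> \<Lambda> f b') \<Lambda> K'"
    and init: "m 0 = m' 0"
    and mass: "\<And>t. 0 \<le> t \<Longrightarrow> measure (m t) UNIV = 1" "\<And>t. 0 \<le> t \<Longrightarrow> measure (m' t) UNIV = 1"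
    and t: "0 \<le> t"
  shows "m t = m' t"
proof (rule mild_evolution_unique[OF m m' init _ _ t])
  interpret m: mild_evolution m "growth_rate \<omega> \<Lambda> f b" \<Lambda> K by fact
  interpret m': mild_evolution m' "growth_rate \<omega> \<Lambda> f b'" \<Lambda> K' by fact
  show "0 \<le> 2 * \<Lambda>" using \<Lambda> by simp
  have flux_m: "AE s in lborel. 0 \<le> s \<longrightarrow> (\<integral>x. growth_rate \<omega> \<Lambda> f b s x \<partial>m s) = 0"
    by (rule m.flux_vanishes) (rule mass)
  have flux_m': "AE s in lborel. 0 \<le> s \<longrightarrow> (\<integral>x. growth_rate \<omega> \<Lambda> f b' s x \<partial>m' s) = 0"
    by (rule m'.flux_vanishes) (rule mass)
  let ?c = "growth_rate \<omega> \<Lambda> f b" and ?c' = "growth_rate \<omega> \<Lambda> f b'"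
  show "AE s in lborel. 0 \<le> s \<longrightarrow> (\<forall>\<psi> D. \<psi> \<in> borel_measurable borel \<longrightarrow> (\<forall>x. \<bar>\<psi> x\<bar> \<le> 1) \<longrightarrow>
        (\<forall>g\<in>borel_measurable borel. (\<forall>x. \<bar>g x\<bar> \<le> 1) \<longrightarrow> \<bar>(\<integral>x. g x \<partial>m s) - (\<integral>x. g x \<partial>m' s)\<bar> \<le> D) \<longrightarrow>
        \<bar>(\<integral>x. \<psi> x * ?c s x \<partial>m s) - (\<integral>x. \<psi> x * ?c' s x \<partial>m' s)\<bar> \<le> 2 * \<Lambda> * D)"
    using flux_m flux_m'
  proof eventually_elim
    case (elim s)
    show ?case
    proof (intro impI allI)
      fix \<psi> :: "real \<Rightarrow> real" and D :: real
      assume s: "0 \<le> s" and \<psi>: "\<psi> \<in> borel_measurable borel" "\<forall>x. \<bar>\<psi> x\<bar> \<le> 1"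
        and "\<forall>g\<in>borel_measurable borel. (\<forall>x. \<bar>g x\<bar> \<le> 1) \<longrightarrow> \<bar>(\<integral>x. g x \<partial>m s) - (\<integral>x. g x \<partial>m' s)\<bar> \<le> D"
      then have D: "\<bar>(\<integral>x. g x \<partial>m s) - (\<integral>x. g x \<partial>m' s)\<bar> \<le> D"
        if "g \<in> borel_measurable borel" "\<And>x. \<bar>g x\<bar> \<le> 1" for g
        using that by blast
      have flux: "(\<integral>x. ?c s x \<partial>m s) = 0" "(\<integral>x. ?c' s x \<partial>m' s) = 0"
        using elim s by auto
      note [measurable] = \<psi>(1) m.c_measurable[OF s] m'.c_measurable[OF s]
      have \<psi>c: "\<bar>\<psi> x * ?c s x\<bar> \<le> \<Lambda>" "\<bar>\<psi> x * ?c' s x\<bar> \<le> \<Lambda>" for x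
        using mult_mono[of "\<bar>\<psi> x\<bar>" 1 "\<bar>?c s x\<bar>" \<Lambda>] mult_mono[of "\<bar>\<psi> x\<bar>" 1 "\<bar>?c' s x\<bar>" \<Lambda>]
          \<psi>(2) m.c_bound[OF s] m'.c_bound[OF s] by (auto simp: abs_mult)
      have diff: "\<bar>?c s x - ?c' s x\<bar> \<le> \<Lambda> + \<Lambda>" for x
        using m.c_bound[OF s, of x] m'.c_bound[OF s, of x] by linarith
      interpret F: finite_measure "m' s" by (rule m'.finite_measure[OF s])
      have int: "integrable (m' s) (\<lambda>x. \<psi> x * ?c s x)" "integrable (m' s) (\<lambda>x. \<psi> x * ?c' s x)"
        "integrable (m' s) (\<lambda>x. ?c s x)" "integrable (m' s) (\<lambda>x. ?c' s x)"
        "integrable (m' s) (\<lambda>x. \<bar>?c s x - ?c' s x\<bar>)"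
        by (rule m'.bounded_integrable[OF s _ \<psi>c(1)] m'.bounded_integrable[OF s _ \<psi>c(2)]
              m'.bounded_integrable[OF s _ m.c_bound[OF s]] m'.bounded_integrable[OF s _ m'.c_bound[OF s]]
              m'.bounded_integrable[OF s, where B="\<Lambda> + \<Lambda>"]; use diff in simp)+
      have first: "\<bar>(\<integral>x. \<psi> x * ?c s x \<partial>m s) - (\<integral>x. \<psi> x * ?c s x \<partial>m' s)\<bar> \<le> \<Lambda> * D"
        by (rule integral_difference_scaled[OF D \<Lambda>]) (use \<psi>c in auto)
      have "\<bar>(\<integral>x. ?c s x \<partial>m s) - (\<integral>x. ?c s x \<partial>m' s)\<bar> \<le> \<Lambda> * D"
        by (rule integral_difference_scaled[OF D \<Lambda>]) (use m.c_bound[OF s] in auto)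
      moreover have "(\<integral>x. \<bar>?c s x - ?c' s x\<bar> \<partial>m' s) = \<bar>\<integral>x. ?c s x - ?c' s x \<partial>m' s\<bar>"
        using growth_rate_difference_same_sign[OF \<omega> less_imp_le[OF \<Lambda>], of f b s b']
        by (intro F.abs_integral_same_sign) auto
      ultimately have second: "(\<integral>x. \<bar>?c s x - ?c' s x\<bar> \<partial>m' s) \<le> \<Lambda> * D"
        using int flux by simp
      have "\<bar>(\<integral>x. \<psi> x * ?c s x \<partial>m' s) - (\<integral>x. \<psi> x * ?c' s x \<partial>m' s)\<bar>
          = \<bar>\<integral>x. \<psi> x * ?c s x - \<psi> x * ?c' s x \<partial>m' s\<bar>"
        using int by simp
      also have "\<dots> \<le> (\<integral>x. \<bar>\<psi> x * ?c s x - \<psi> x * ?c' s x\<bar> \<partial>m' s)"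
        by (rule integral_abs_bound)
      also have "\<dots> \<le> (\<integral>x. \<bar>?c s x - ?c' s x\<bar> \<partial>m' s)"
      proof (rule integral_mono)
        show "integrable (m' s) (\<lambda>x. \<bar>\<psi> x * ?c s x - \<psi> x * ?c' s x\<bar>)"
          using int by auto
        show "\<bar>\<psi> x * ?c s x - \<psi> x * ?c' s x\<bar> \<le> \<bar>?c s x - ?c' s x\<bar>" for x
          using mult_right_mono[of "\<bar>\<psi> x\<bar>" 1 "\<bar>?c s x - ?c' s x\<bar>"] \<psi>(2)
          by (simp add: abs_mult flip: right_diff_distrib)
      qed (rule int)
      finally show "\<bar>(\<integral>x. \<psi> x * ?c s x \<partial>m s) - (\<integral>x. \<psi> x * ?c' s x \<partial>m' s)\<bar> \<le> 2 * \<Lambda> * D"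
        using first second by linarith
    qed
  qed
qed

text \<open>The linear problem, in which the masses are not known in advance: boundedness of the rate alone makes the
source term Lipschitz.\<close>

theorem same_barrier_evolution_unique:
  assumes m: "mild_evolution m c L K" and m': "mild_evolution m' c L K'" and L: "0 < L"
    and init: "m 0 = m' 0" and t: "0 \<le> t"
  shows "m t = m' t"
proof (rule mild_evolution_unique[OF m m' init less_imp_le[OF L] _ t], intro AE_I2 impI allI)
  interpret m: mild_evolution m c L K by fact
  fix s D :: real and \<psi> :: "real \<Rightarrow> real"
  assume s: "0 \<le> s" and \<psi>: "\<psi> \<in> borel_measurable borel" "\<forall>x. \<bar>\<psi> x\<bar> \<le> 1"
    and D: "\<forall>g\<in>borel_measurable borel. (\<forall>x. \<bar>g x\<bar> \<le> 1) \<longrightarrow> \<bar>(\<integral>x. g x \<partial>m s) - (\<integral>x. g x \<partial>m' s)\<bar> \<le> D"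
  note [measurable] = \<psi>(1) m.c_measurable[OF s]
  show "\<bar>(\<integral>x. \<psi> x * c s x \<partial>m s) - (\<integral>x. \<psi> x * c s x \<partial>m' s)\<bar> \<le> L * D"
  proof (rule integral_difference_scaled)
    show "\<bar>\<psi> x * c s x\<bar> \<le> L" for x
      using mult_mono[of "\<bar>\<psi> x\<bar>" 1 "\<bar>c s x\<bar>" L] \<psi>(2) m.c_bound[OF s] by (simp add: abs_mult)
    show "(\<lambda>x. \<psi> x * c s x) \<in> borel_measurable borel" by measurable
  qed (use D L in auto)
qed

text \<open>Let \<open>x0\<close> be a median of \<open>\<omega>\<close>: at least \<open>1/2\<close> to its left and less than \<open>1/2\<close> to its right. Between \<open>x0 + \<beta>\<close>
and \<open>x0 + \<beta>'\<close> the two weights lie on different sides of \<open>1/2\<close>, and \<open>m\<close> charges this interval.\<close>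

lemma shifted_weight_integral_strict_mono:
  assumes \<omega>: "selection_weighting \<omega>" and m: "finite_measure m" "sets m = sets borel"
    and pos: "\<And>p q. p < q \<Longrightarrow> 0 < measure m {p<..<q}"
    and \<beta>: "\<beta> < \<beta>'" "\<beta>' \<noteq> \<infinity>"
  shows "(\<integral>x. shifted_weight \<omega> x \<beta> \<partial>m) < (\<integral>x. shifted_weight \<omega> x \<beta>' \<partial>m)"
proof -
  interpret finite_measure m by fact
  have int: "integrable m (\<lambda>x. shifted_weight \<omega> x \<beta>)" for \<beta>
    using shifted_weight_measurable[OF \<omega>] shifted_weight_bounds[OF \<omega>]
    by (intro integrable_const_bound[where B=1]) (auto simp: measurable_cong_sets[OF m(2) refl])
  (* The supremum is finite because the weighting tends to 1 on the left and to 0 on the right. *)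
  define x0 where "x0 = Sup {x. 1/2 \<le> \<omega> x}"
  have anti: "x \<le> y \<Longrightarrow> \<omega> y \<le> \<omega> x" for x y
    using \<omega> by (auto simp: selection_weighting_def antimono_def)
  have "eventually (\<lambda>x. 1/2 < \<omega> x) at_bot" "eventually (\<lambda>x. \<omega> x < 1/2) at_top"
    using \<omega> order_tendstoD(1)[of \<omega> 1 at_bot "1/2"] order_tendstoD(2)[of \<omega> 0 at_top "1/2"]
    unfolding selection_weighting_def by simp_all
  then obtain l r where l: "1/2 < \<omega> l" and r: "\<omega> r < 1/2"
    unfolding eventually_at_bot_linorder eventually_at_top_linorder by blast
  have bdd: "bdd_above {x. 1/2 \<le> \<omega> x}"
  proof (rule bdd_aboveI)
    fix x assume "x \<in> {x. 1/2 \<le> \<omega> x}"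
    then show "x \<le> r" using anti[of r x] r by fastforce
  qed
  have below: "1/2 \<le> \<omega> x" if "x < x0" for x
  proof -
    have "\<exists>y\<in>{x. 1/2 \<le> \<omega> x}. x < y"
      using that l bdd unfolding x0_def by (subst (asm) less_cSup_iff) (auto intro: less_imp_le)
    then obtain y where "1/2 \<le> \<omega> y" "x < y" by auto
    then show ?thesis using anti[of x y] by simp
  qed
  have above: "\<omega> x < 1/2" if "x0 < x" for x
    using cSup_upper[OF _ bdd, of x] that unfolding x0_def by (auto simp: not_le[symmetric])
  obtain p q where pq: "p < q" and strict: "\<And>x. p < x \<Longrightarrow> x < q \<Longrightarrow> shifted_weight \<omega> x \<beta> < shifted_weight \<omega> x \<beta>'"
  proof -
    obtain r' where r': "\<beta>' = ereal r'" using \<beta> by (cases \<beta>') auto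
    show thesis
    proof (cases \<beta>)
      case (real r)
      show ?thesis
      proof (rule that[of "x0 + r" "x0 + r'"])
        fix x assume "x0 + r < x" "x < x0 + r'"
        then show "shifted_weight \<omega> x \<beta> < shifted_weight \<omega> x \<beta>'"
          using above[of "x - r"] below[of "x - r'"] by (simp add: real r')
      qed (use \<beta> real r' in simp)
    next
      case MInf
      show ?thesis
      proof (rule that[of "x0 + r' - 1" "x0 + r'"])
        fix x assume "x < x0 + r'"
        then show "shifted_weight \<omega> x \<beta> < shifted_weight \<omega> x \<beta>'"
          using below[of "x - r'"] by (simp add: MInf r')
      qed simp
    qed (use \<beta> in auto)
  qed
  have le: "0 \<le> shifted_weight \<omega> x \<beta>' - shifted_weight \<omega> x \<beta>" for x
    using shifted_weight_mono[OF \<omega> less_imp_le[OF \<beta>(1)], of x] by simp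
  have "(\<integral>x. shifted_weight \<omega> x \<beta>' - shifted_weight \<omega> x \<beta> \<partial>m) \<noteq> 0"
  proof
    assume "(\<integral>x. shifted_weight \<omega> x \<beta>' - shifted_weight \<omega> x \<beta> \<partial>m) = 0"
    then have "AE x in m. shifted_weight \<omega> x \<beta>' - shifted_weight \<omega> x \<beta> = 0"
      using int le by (subst (asm) integral_nonneg_eq_0_iff_AE) auto
    then have "AE x in m. x \<notin> {p<..<q}"
      by eventually_elim (use strict in force)
    then have "{p<..<q} \<in> null_sets m"
      by (subst AE_iff_null_sets) (auto simp: m(2))
    then show False using pos[OF pq] by (simp add: measure_eq_0_null_sets)
  qed
  moreover have "0 \<le> (\<integral>x. shifted_weight \<omega> x \<beta>' - shifted_weight \<omega> x \<beta> \<partial>m)"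
    by (rule Bochner_Integration.integral_nonneg) (rule le)
  ultimately show ?thesis using int by simp
qed

text \<open>Cover the line by intervals of half the length of \<open>{p<..<q}\<close>. One of them carries the initial value with positive
probability, and a Gaussian increment of matching size, independent of it, leads into \<open>{p<..<q}\<close>.\<close>

lemma (in brownian) prob_interval_pos:
  assumes s: "0 < s" and pq: "p < q"
  shows "0 < prob {z \<in> space M. W s z \<in> {p<..<q}}"
proof -
  define \<delta> where "\<delta> = (q - p) / 2"
  have \<delta>: "0 < \<delta>" using pq by (simp add: \<delta>_def)
  note [measurable] = W_measurable[of 0, simplified] W_measurable[OF less_imp_le[OF s]]
  define J where "J k = {real_of_int k * \<delta>..<real_of_int (k + 1) * \<delta>}" for k :: int
  have cover: "\<exists>k. x \<in> J k" for x
  proof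
    have "real_of_int \<lfloor>x / \<delta>\<rfloor> \<le> x / \<delta>" "x / \<delta> < real_of_int (\<lfloor>x / \<delta>\<rfloor> + 1)" by linarith+
    then have "real_of_int \<lfloor>x / \<delta>\<rfloor> * \<delta> \<le> x" "x < real_of_int (\<lfloor>x / \<delta>\<rfloor> + 1) * \<delta>"
      using \<delta> by (simp_all only: pos_le_divide_eq pos_divide_less_eq)
    then show "x \<in> J \<lfloor>x / \<delta>\<rfloor>" by (simp only: J_def atLeastLessThan_iff)
  qed
  have "\<exists>k. prob (W 0 -` J k \<inter> space M) \<noteq> 0"
  proof (rule ccontr)
    assume "\<not> ?thesis"
    then have "W 0 -` J k \<inter> space M \<in> null_sets M" for k
      by (auto simp: null_sets_def emeasure_eq_measure J_def)
    then have "(\<Union>k. W 0 -` J k \<inter> space M) \<in> null_sets M" by (intro null_sets_UN) auto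
    moreover have "(\<Union>k. W 0 -` J k \<inter> space M) = space M" using cover by auto
    ultimately show False by (simp add: null_sets_def emeasure_space_1)
  qed
  then obtain k where k: "prob (W 0 -` J k \<inter> space M) \<noteq> 0" by blast
  (* A starting point in J k moved by an increment between a and a + delta ends between p and p + 2 delta = q. *)
  define a where "a = p - real_of_int k * \<delta>"
  let ?D = "\<lambda>z. W s z - W 0 z"
  have D: "prob (?D -` {a<..<a + \<delta>} \<inter> space M) \<noteq> 0"
  proof
    assume "prob (?D -` {a<..<a + \<delta>} \<inter> space M) = 0"
    then have "(\<integral>\<^sup>+x. ennreal (normal_density 0 (sqrt (s - 0)) x) * indicator {a<..<a + \<delta>} x \<partial>lborel) = 0"
      using distributed_emeasure[OF increment_normal[OF order_refl s], of "{a<..<a + \<delta>}"]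
      by (simp add: emeasure_eq_measure)
    then have "AE x in lborel. ennreal (normal_density 0 (sqrt (s - 0)) x) * indicator {a<..<a + \<delta>} x = 0"
      by (subst (asm) nn_integral_0_iff_AE) auto
    then have "AE x in lborel. x \<notin> {a<..<a + \<delta>}"
    proof eventually_elim
      case (elim x)
      have "0 < normal_density 0 (sqrt s) x" using s by (intro normal_density_pos) simp
      then show ?case using elim by (auto simp: indicator_def split: if_splits)
    qed
    then have "{a<..<a + \<delta>} \<in> null_sets lborel" by (subst AE_iff_null_sets) auto
    then show False using \<delta> by (auto simp: null_sets_def)
  qed
  have "prob (W 0 -` J k \<inter> space M \<inter> (?D -` {a<..<a + \<delta>} \<inter> space M)) =
      prob (W 0 -` J k \<inter> space M) * prob (?D -` {a<..<a + \<delta>} \<inter> space M)"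
  proof (rule indep_setD)
    show "indep_set (sigma_sets (space M) {W 0 -` A \<inter> space M |A. A \<in> sets borel})
        (sigma_sets (space M) {?D -` A \<inter> space M |A. A \<in> sets borel})"
      using indep_initial_increment[OF s] unfolding indep_var_eq by simp
    show "W 0 -` J k \<inter> space M \<in> sigma_sets (space M) {W 0 -` A \<inter> space M |A. A \<in> sets borel}"
      by (rule sigma_sets.Basic) (auto simp: J_def)
    show "?D -` {a<..<a + \<delta>} \<inter> space M \<in> sigma_sets (space M) {?D -` A \<inter> space M |A. A \<in> sets borel}"
      by (rule sigma_sets.Basic) auto
  qed
  then have "0 < prob (W 0 -` J k \<inter> space M \<inter> (?D -` {a<..<a + \<delta>} \<inter> space M))"
    using k D by (simp add: zero_less_measure_iff)
  also have "\<dots> \<le> prob {z \<in> space M. W s z \<in> {p<..<q}}"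
  proof (rule finite_measure_mono)
    show "W 0 -` J k \<inter> space M \<inter> (?D -` {a<..<a + \<delta>} \<inter> space M) \<subseteq> {z \<in> space M. W s z \<in> {p<..<q}}"
    proof
      fix z assume z: "z \<in> W 0 -` J k \<inter> space M \<inter> (?D -` {a<..<a + \<delta>} \<inter> space M)"
      then have "real_of_int k * \<delta> \<le> W 0 z" "W 0 z < real_of_int k * \<delta> + \<delta>" "a < ?D z" "?D z < a + \<delta>"
        by (auto simp: J_def distrib_right)
      then have "p < W s z" "W s z < q"
        unfolding a_def using \<delta>_def by (auto simp: field_simps)
      then show "z \<in> {z \<in> space M. W s z \<in> {p<..<q}}" using z by simp
    qed
  qed measurable
  finally show ?thesis .
qed

lemma (in feynman_kac) tilted_interval_pos:
  assumes s: "0 < s" and pq: "p < q"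
  shows "0 < measure (tilted s) {p<..<q}"
proof -
  have s0: "0 \<le> s" using s by simp
  note [measurable] = W_measurable[OF s0] action_random_variable[of s]
  interpret T: finite_measure "tilted s" by (rule finite_measure_tilted[OF s0])
  have "measure (tilted s) {p<..<q} = (\<integral>x. indicator {p<..<q} x \<partial>tilted s)"
    by (simp add: tilted_def)
  also have "\<dots> = expectation (\<lambda>z. exp (action s z) * indicator {p<..<q} (W s z))"
    by (rule integral_tilted[OF s0]) simp
  finally have eq: "measure (tilted s) {p<..<q} = expectation (\<lambda>z. exp (action s z) * indicator {p<..<q} (W s z))" .
  have "0 < exp (- (L * s)) * prob {z \<in> space M. W s z \<in> {p<..<q}}"
    using prob_interval_pos[OF s pq] by simp
  also have "\<dots> = expectation (\<lambda>z. exp (- (L * s)) * indicator {z \<in> space M. W s z \<in> {p<..<q}} z)"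
    by simp
  also have "\<dots> \<le> expectation (\<lambda>z. exp (action s z) * indicator {p<..<q} (W s z))"
  proof (rule integral_mono)
    show "integrable M (\<lambda>z. exp (action s z) * indicator {p<..<q} (W s z))"
      using exp_action_le[OF s0 order_refl]
      by (intro integrable_const_bound[where B="exp (L * s)"]) (auto simp: indicator_def)
    show "exp (- (L * s)) * indicator {z \<in> space M. W s z \<in> {p<..<q}} z \<le> exp (action s z) * indicator {p<..<q} (W s z)"
      if "z \<in> space M" for z
      using abs_action_le[OF s0, of z] that by (auto simp: indicator_def)
  qed (auto intro!: integrable_mult_right integrable_real_indicator simp: emeasure_eq_measure)
  finally show ?thesis using eq by simp
qed

section \<open>Survival functions and barriers\<close>

locale soft_killing_rate = soft_killing +
  fixes f :: "real \<Rightarrow> real"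
  assumes f: "continuous_on {0..} f" "\<And>t. 0 \<le> t \<Longrightarrow> 0 \<le> f t" "\<And>t. 0 \<le> t \<Longrightarrow> f t \<le> \<Lambda>"
begin

sublocale growth: feynman_kac M W "growth_rate \<omega> \<Lambda> f b" \<Lambda>
proof
  show "(\<lambda>p. growth_rate \<omega> \<Lambda> f b (fst p) (snd p)) \<in> borel_measurable (borel \<Otimes>\<^sub>M borel)"
    by (rule growth_rate_jointly_measurable[OF \<omega> f(1) b])
  show "\<bar>growth_rate \<omega> \<Lambda> f b s x\<bar> \<le> \<Lambda>" for s x
    using \<Lambda> f by (intro abs_growth_rate_le[OF \<omega>]) auto
qed

lemma f_integrable: "set_integrable lborel {0..t} f"
  by (rule borel_integrable_atLeastAtMost', rule continuous_on_subset[OF f(1)]) auto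

lemma growth_action_eq:
  assumes "z \<in> space M"
  shows "growth.action t z = (LINT s:{0..t}|lborel. f s) - hazard t z"
proof -
  have "growth.action t z = (LINT s:{0..t}|lborel. f s - \<Lambda> * shifted_weight \<omega> (W s z) (b s))"
    unfolding growth.action_def by (rule set_lebesgue_integral_cong) (auto simp: growth_rate_def)
  also have "\<dots> = (LINT s:{0..t}|lborel. f s) - (LINT s:{0..t}|lborel. \<Lambda> * shifted_weight \<omega> (W s z) (b s))"
    by (rule set_integral_diff(2)[OF f_integrable set_integrable_mult_right[OF weight_along_path_integrable[OF assms]]])
  finally show ?thesis by (simp add: hazard_def)
qed

lemma tilted_mass:
  assumes "0 \<le> t"
  shows "measure (growth.tilted t) UNIV =
    exp (LINT s:{0..t}|lborel. f s) * prob {z \<in> space M. ereal t < killing_time \<omega> \<Lambda> b W U z}"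
proof -
  have "measure (growth.tilted t) UNIV = expectation (\<lambda>z. exp (LINT s:{0..t}|lborel. f s) * exp (- hazard t z))"
    unfolding growth.measure_tilted_UNIV[OF assms]
    by (rule Bochner_Integration.integral_cong) (simp_all add: growth_action_eq flip: exp_add)
  then show ?thesis by (simp add: prob_less_killing_time[OF assms])
qed

lemma survival_function_iff_unit_mass:
  "has_survival_function M (killing_time \<omega> \<Lambda> b W U) f \<longleftrightarrow> (\<forall>t\<ge>0. measure (growth.tilted t) UNIV = 1)"
  unfolding has_survival_function_def using killing_time_measurable
  by (auto simp: tilted_mass exp_minus field_simps)

lemma tilted_0: "growth.tilted 0 = density_measure \<rho>"
proof -
  have "growth.tilted 0 = distr M lborel (W 0)"
    unfolding growth.tilted_def by (simp add: growth.action_nonpos density_1 cong: distr_cong)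
  also have "\<dots> = density_measure \<rho>"
    using killing unfolding killing_setup_def density_measure_def
    by (intro distributed_distr_eq_density) auto
  finally show ?thesis .
qed

text \<open>The survival function gives the probabilities of \<open>\<tau> > s\<close>; those of \<open>\<tau> \<ge> t\<close> follow by letting \<open>s\<close> increase
to \<open>t\<close>, as \<open>exp(- F)\<close> is continuous.\<close>

lemma target_distribution_killing_time:
  assumes surv: "has_survival_function M (killing_time \<omega> \<Lambda> b W U) f"
  shows "target_distribution f (distr M borel (killing_time \<omega> \<Lambda> b W U))"
  unfolding target_distribution_def
proof (intro conjI allI impI)
  let ?T = "killing_time \<omega> \<Lambda> b W U" and ?F = "\<lambda>t. LINT s:{0..t}|lborel. f s"
  note [measurable] = killing_time_measurable
  show "prob_space (distr M borel ?T)" by (rule prob_space_distr) measurable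
  show "sets (distr M borel ?T) = sets borel" by simp
  fix t :: real assume t: "0 \<le> t"
  have eq: "measure (distr M borel ?T) {ereal t..} = prob {z \<in> space M. ereal t \<le> ?T z}"
    by (subst measure_distr) (auto intro!: arg_cong[where f=prob])
  have surv': "prob {z \<in> space M. ereal s < ?T z} = exp (- ?F s)" if "0 \<le> s" for s
    using surv that unfolding has_survival_function_def by simp
  show "measure (distr M borel ?T) {ereal t..} = exp (- ?F t)"
  proof (cases "t = 0")
    case True
    have "{z \<in> space M. ereal t \<le> ?T z} = space M"
      using True killing_time_nonneg by (simp add: zero_ereal_def)
    moreover have "?F 0 = 0"
      using abs_set_integral_le[of 0 0 f \<Lambda>] f by simp
    ultimately show ?thesis unfolding eq using True by (simp add: prob_space)
  next
    case False
    then have t0: "0 < t" using t by simp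
    show ?thesis unfolding eq
    proof (rule antisym)
      have "exp (- ?F t) = prob {z \<in> space M. ereal t < ?T z}" using surv'[OF t] by simp
      also have "\<dots> \<le> prob {z \<in> space M. ereal t \<le> ?T z}"
        by (rule finite_measure_mono) auto
      finally show "exp (- ?F t) \<le> prob {z \<in> space M. ereal t \<le> ?T z}" .
      have near: "prob {z \<in> space M. ereal t \<le> ?T z} \<le> exp (\<Lambda> * (t * (1 / real (Suc n))) - ?F t)" for n
      proof -
        define s where "s = t - t * (1 / real (Suc n))"
        have "t * (1 / real (Suc n)) \<le> t * 1" using t0 by (intro mult_left_mono) auto
        then have s: "0 \<le> s" "s < t" using t0 by (auto simp: s_def)
        have "prob {z \<in> space M. ereal t \<le> ?T z} \<le> prob {z \<in> space M. ereal s < ?T z}"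
          using s(2) by (intro finite_measure_mono) (auto intro: less_le_trans[of "ereal s" "ereal t"])
        also have "\<dots> = exp (- ?F s)" by (rule surv'[OF s(1)])
        also have "?F t = ?F s + (LINT r:{s..t}|lborel. f r)"
          by (rule set_integral_split[OF f_integrable]) (use s in auto)
        moreover have "\<bar>LINT r:{s..t}|lborel. f r\<bar> \<le> \<Lambda> * (t - s)"
          by (rule abs_set_integral_le) (use s f in auto)
        ultimately have "- ?F s \<le> \<Lambda> * (t - s) - ?F t" by linarith
        then have "exp (- ?F s) \<le> exp (\<Lambda> * (t * (1 / real (Suc n))) - ?F t)" by (simp add: s_def)
        then show ?thesis
          using \<open>prob {z \<in> space M. ereal t \<le> ?T z} \<le> prob {z \<in> space M. ereal s < ?T z}\<close> surv'[OF s(1)] by linarith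
      qed
      have "(\<lambda>n. exp (\<Lambda> * (t * (1 / real (Suc n))) - ?F t)) \<longlonglongrightarrow> exp (\<Lambda> * (t * 0) - ?F t)"
        by (intro tendsto_intros LIMSEQ_Suc[OF lim_1_over_n])
      then show "prob {z \<in> space M. ereal t \<le> ?T z} \<le> exp (- ?F t)"
        using LIMSEQ_le_const[of _ "exp (- ?F t)" "prob {z \<in> space M. ereal t \<le> ?T z}"] near by simp
    qed
  qed
qed

end

theorem theorem2:
  fixes \<omega> f \<rho> :: "real \<Rightarrow> real" and \<Lambda> :: real
    and u :: "real \<Rightarrow> real \<Rightarrow> real" and b :: "real \<Rightarrow> ereal"
    and M :: "'a measure" and W :: "real \<Rightarrow> 'a \<Rightarrow> real" and U :: "'a \<Rightarrow> real"
  assumes "selection_weighting \<omega>"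
    and "\<omega> = indicat_real {..0} \<or> (C_k 3 \<omega> \<and> antimono \<omega> \<and> bounded {x. \<omega> x \<in> {0<..<1}})"
    and "\<forall>t\<ge>0. 0 \<le> f t"
    and "continuous_on {0..} f"
    and "bdd_above (f ` {0..})"
    and "0 < \<Lambda>"
    and "(SUP t\<in>{0..}. f t) < \<Lambda>"
    and "prob_density_fun \<rho>"
    and "C_k 2 \<rho>"
    and "bounded (range \<rho>)"
    and "bounded (range (deriv \<rho>))"
    and "bounded (range (deriv (deriv \<rho>)))"
    and "weak_solution \<omega> \<Lambda> f \<rho> u b"
    and "killing_setup M W U \<rho>"
  shows "(barrier b \<and> has_survival_function M (killing_time \<omega> \<Lambda> b W U) f) \<and>
    (\<forall>b'. barrier b' \<and> has_survival_function M (killing_time \<omega> \<Lambda> b' W U) f \<longrightarrow>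
       (AE t in lborel. 0 \<le> t \<longrightarrow> b' t = b t)) \<and>
    (\<exists>p. target_distribution f p \<and> solves_soft_killed_ifp M W U \<omega> \<Lambda> \<rho> p b)"
proof -
  note \<omega> = assms(1) and \<Lambda> = \<open>0 < \<Lambda>\<close> and sol = \<open>weak_solution \<omega> \<Lambda> f \<rho> u b\<close>
    and kill = \<open>killing_setup M W U \<rho>\<close>
  have f0: "0 \<le> f t" if "0 \<le> t" for t using assms(3) that by simp
  have f\<Lambda>: "f t < \<Lambda>" if "0 \<le> t" for t
    using cSUP_upper[OF _ \<open>bdd_above (f ` {0..})\<close>, of t] \<open>(SUP t\<in>{0..}. f t) < \<Lambda>\<close> that by simp
  let ?m = "\<lambda>t. density_measure (\<lambda>x. u x t)"
  have bm: "brownian_motion M W" using kill unfolding killing_setup_def by simp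
  have b: "barrier b"
    by (rule solution_barrier_is_barrier[OF \<omega> f0 f\<Lambda> \<open>continuous_on {0..} f\<close> \<Lambda> sol])
  have rate: "soft_killing_rate M W U \<rho> \<omega> \<Lambda> b' f" if "barrier b'" for b'
  proof -
    have "prob_space M" using bm unfolding brownian_motion_def by simp
    then show ?thesis
      unfolding soft_killing_rate_def soft_killing_def soft_killing_axioms_def soft_killing_rate_axioms_def
        brownian_def brownian_axioms_def
      using bm kill \<omega> \<Lambda> that f0 less_imp_le[OF f\<Lambda>] \<open>continuous_on {0..} f\<close> by auto
  qed
  interpret K: soft_killing_rate M W U \<rho> \<omega> \<Lambda> b f by (rule rate[OF b])
  have m: "mild_evolution ?m (growth_rate \<omega> \<Lambda> f b) \<Lambda> (\<lambda>_. 1)"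
    by (rule weak_solution_mild_evolution[OF \<omega> f0 less_imp_le[OF f\<Lambda>] less_imp_le[OF \<Lambda>] sol])
  have m0: "?m 0 = density_measure \<rho>"
    using sol unfolding weak_solution_def by simp
  have mass: "measure (?m t) UNIV = 1" if "0 \<le> t" for t
  proof -
    have "prob_density_fun (\<lambda>x. u x t)" using sol that unfolding weak_solution_def by blast
    then interpret D: real_distribution "?m t" by (rule real_distribution_density_measure)
    show ?thesis using D.prob_space by simp
  qed
  have m_eq: "?m t = K.growth.tilted t" if "0 \<le> t" for t
    by (rule same_barrier_evolution_unique[OF m K.growth.tilted_mild_evolution \<Lambda> _ that])
       (simp add: m0 K.tilted_0)
  have surv: "has_survival_function M (killing_time \<omega> \<Lambda> b W U) f"
    unfolding K.survival_function_iff_unit_mass using m_eq mass by simp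
  have unique: "AE t in lborel. 0 \<le> t \<longrightarrow> b' t = b t"
    if b': "barrier b'" and surv': "has_survival_function M (killing_time \<omega> \<Lambda> b' W U) f" for b'
  proof -
    interpret K': soft_killing_rate M W U \<rho> \<omega> \<Lambda> b' f by (rule rate[OF b'])
    have mass': "measure (K'.growth.tilted t) UNIV = 1" if "0 \<le> t" for t
      using surv' that unfolding K'.survival_function_iff_unit_mass by simp
    have eq: "?m t = K'.growth.tilted t" if "0 \<le> t" for t
      by (rule unit_mass_evolution_unique[OF \<omega> \<Lambda> m K'.growth.tilted_mild_evolution _ mass mass' that])
         (simp_all add: m0 K'.tilted_0)
    interpret E: mild_evolution ?m "growth_rate \<omega> \<Lambda> f b" \<Lambda> "\<lambda>_. 1" by (rule m)
    interpret E': mild_evolution K'.growth.tilted "growth_rate \<omega> \<Lambda> f b'" \<Lambda> "\<lambda>T. exp (\<Lambda> * T)"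
      by (rule K'.growth.tilted_mild_evolution)
    have flux_b: "AE s in lborel. 0 \<le> s \<longrightarrow> (\<integral>x. growth_rate \<omega> \<Lambda> f b s x \<partial>?m s) = 0"
      by (rule E.flux_vanishes) (rule mass)
    have flux_b': "AE s in lborel. 0 \<le> s \<longrightarrow> (\<integral>x. growth_rate \<omega> \<Lambda> f b' s x \<partial>K'.growth.tilted s) = 0"
      by (rule E'.flux_vanishes) (rule mass')
    show ?thesis
      using flux_b flux_b' AE_lborel_singleton[of 0]
    proof eventually_elim
      case (elim s)
      show ?case
      proof
        assume s: "0 \<le> s"
        then have s0: "0 < s" using elim by simp
        interpret F: finite_measure "?m s" by (rule E.finite_measure[OF s])
        have pos: "0 < measure (?m s) {p<..<q}" if "p < q" for p q
          unfolding eq[OF s] by (rule K'.growth.tilted_interval_pos[OF s0 that])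
        note strict = shifted_weight_integral_strict_mono[OF \<omega> E.finite_measure[OF s] E.sets_eq[OF s] pos]
        have flux: "f s = \<Lambda> * (\<integral>x. shifted_weight \<omega> x (\<beta> s) \<partial>?m s)"
          if "(\<integral>x. growth_rate \<omega> \<Lambda> f \<beta> s x \<partial>?m s) = 0" for \<beta>
        proof -
          have "integrable (?m s) (\<lambda>x. shifted_weight \<omega> x (\<beta> s))"
            using shifted_weight_bounds[OF \<omega>] shifted_weight_measurable[OF \<omega>]
            by (intro E.bounded_integrable[OF s, where B=1]) auto
          then have "(\<integral>x. growth_rate \<omega> \<Lambda> f \<beta> s x \<partial>?m s) = f s - \<Lambda> * (\<integral>x. shifted_weight \<omega> x (\<beta> s) \<partial>?m s)"
            using s mass[OF s] E.space_eq[OF s] by (simp add: growth_rate_def)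
          then show ?thesis using that by simp
        qed
        have "f s = \<Lambda> * (\<integral>x. shifted_weight \<omega> x (b s) \<partial>?m s)"
          by (rule flux) (use elim s in simp)
        moreover have "f s = \<Lambda> * (\<integral>x. shifted_weight \<omega> x (b' s) \<partial>?m s)"
          by (rule flux) (use elim s eq[OF s] in simp)
        ultimately have "\<Lambda> * (\<integral>x. shifted_weight \<omega> x (b s) \<partial>?m s) = \<Lambda> * (\<integral>x. shifted_weight \<omega> x (b' s) \<partial>?m s)"
          by linarith
        then have "(\<integral>x. shifted_weight \<omega> x (b s) \<partial>?m s) = (\<integral>x. shifted_weight \<omega> x (b' s) \<partial>?m s)"
          using \<Lambda> by simp
        moreover have "b s \<noteq> \<infinity>" "b' s \<noteq> \<infinity>" using b b' s unfolding barrier_def by auto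
        ultimately show "b' s = b s"
          using strict[of "b s" "b' s"] strict[of "b' s" "b s"] by (cases "b s" "b' s" rule: linorder_cases) auto
      qed
    qed
  qed
  have "target_distribution f (distr M borel (killing_time \<omega> \<Lambda> b W U))"
    by (rule K.target_distribution_killing_time[OF surv])
  moreover have "solves_soft_killed_ifp M W U \<omega> \<Lambda> \<rho> (distr M borel (killing_time \<omega> \<Lambda> b W U)) b"
    unfolding solves_soft_killed_ifp_def using kill b K.killing_time_measurable by simp
  ultimately show ?thesis using b surv unique by blast
qed

end
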